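(* Let $\nu>0$, $\beta\in(0,1)$, $\alpha=2$, and let $d$ be a positive integer with $d<\min\{2,\beta^{-1}\}\alpha$ (i.e. $d<4$ and $\beta d<2$). Let $\sigma:\mathbb{R}\to\mathbb{R}$ be globally Lipschitz with Lipschitz constant $\mathrm{Lip}_\sigma$ and $\sigma(0)=0$. Let $u_0:\mathbb{R}^d\to\mathbb{R}_+$ be measurable, bounded, with compact support, and strictly positive on some open subset of $(0,\infty)^d$. Let $u$ be the mild solution of $$\partial_t^\beta u_t(x)=\nu\Delta u_t(x)+I_t^{1-\beta}[\sigma(u)\dot W(t,x)],\quad t>0,\ x\in\mathbb{R}^d,\qquad u_0(x)=u_0(x),$$ and set $$\mathscr{L}(\theta):=\limsup_{t\to\infty}\frac1t\sup_{|x|>\theta t}\log\mathbb{E}\big(|u_t(x)|^2\big),\qquad \theta\ge 0.$$ Then $$\mathscr{L}(\theta)<0\quad\text{whenever}\quad \theta>(2\nu)^{1/\beta}\,(\mathrm{Lip}_\sigma c_0)^{2\frac{2-\beta}{2-\beta d}},$$ where $c_0$ is the constant defined in the context. Moreover, if in addition $L_\sigma:=\inf_{z\neq 0}|\sigma(z)/z|>0$, then there exists $\theta_0>0$ such that $\mathscr{L}(\theta)>0$ for all $\theta\in(0,\theta_0)$.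
   Context: $\dot W$ is space-time white noise on $\mathbb{R}_+\times\mathbb{R}^d$ on a filtered probability space $(\Omega,\mathcal F,\mathcal F_t,\mathbb P)$. The Caputo derivative is $\partial_t^\beta u_t(x)=\frac{1}{\Gamma(1-\beta)}\int_0^t\frac{\partial u_r(x)}{\partial r}\frac{dr}{(t-r)^\beta}$ and $I_t^\gamma f(t)=\frac1{\Gamma(\gamma)}\int_0^t(t-\tau)^{\gamma-1}f(\tau)d\tau$. Let $D=\{D_r\}$ be a $\beta$-stable subordinator with $\mathbb E e^{-sD_1}=e^{-s^\beta}$, let $g_\beta$ be the density of $D_1$, and let $E_t=\inf\{u:D(u)>t\}$ be its inverse, with density $f_{E_t}(s)=t\beta^{-1}s^{-1-1/\beta}g_\beta(ts^{-1/\beta})$. Let $p_s(x)=(4\pi\nu s)^{-d/2}e^{-|x|^2/(4\nu s)}$ (so $\int e^{i\xi\cdot x}p_s(x)dx=e^{-s\nu|\xi|^2}$). The heat kernel is $G_t(x)=\int_0^\infty p_s(x)f_{E_t}(s)\,ds$. A mild solution is an $\mathcal F_t$-adapted random field satisfying $\sup_{t\le T}\sup_x\mathbb E|u_t(x)|^2<\infty$ for all $T$ and $$u_t(x)=\int_{\mathbb{R}^d}u_0(y)G_t(x-y)dy+\int_0^t\int_{\mathbb{R}^d}\sigma(u_r(y))G_{t-r}(x-y)W(dr\,dy)$$ (Walsh stochastic integral); it exists and is unique under these assumptions. Constants: $a_0^d(\beta):=\int_0^\infty w^{\beta d/4}g_\beta(w)\,dw=\mathbb E(D_1^{\beta d/4})$,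 $$M:=\max\Big\{a_0^d(\beta)\sqrt{\Gamma(1-\tfrac{\beta d}{2})},\ \frac{3\sqrt{\beta\,\Gamma(2\beta(1-\frac d4))}}{2^\beta\Gamma(1+\beta)}\Big\},\qquad c_0:=\sqrt{\frac{M^2}{(2\nu)^{\frac1\beta-\frac d2}(1-2^{\beta-2})^2(8\pi\nu)^{d/2}}}.$$ *)

theory Defs
  imports "HOL-Analysis.Analysis" "HOL-Probability.Probability"
begin

definition is_filtration :: "'w measure \<Rightarrow> (real \<Rightarrow> 'w measure) \<Rightarrow> bool" where
  "is_filtration P F \<longleftrightarrow>
     (\<forall>t. subalgebra P (F t)) \<and> (\<forall>s t. s \<le> t \<longrightarrow> sets (F s) \<subseteq> sets (F t))"

definition wn_set :: "(real \<times> (real^'d::finite)) set \<Rightarrow> bool" where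
  "wn_set A \<longleftrightarrow> A \<in> sets lborel \<and> A \<subseteq> {0..} \<times> UNIV \<and> emeasure lborel A < \<infinity>"

definition is_white_noise ::
  "'w measure \<Rightarrow> (real \<Rightarrow> 'w measure) \<Rightarrow> ((real \<times> (real^'d::finite)) set \<Rightarrow> 'w \<Rightarrow> real) \<Rightarrow> bool" where
  "is_white_noise P F W \<longleftrightarrow>
     (\<forall>A. wn_set A \<longrightarrow> W A \<in> borel_measurable P) \<and>
     (\<forall>A. wn_set A \<longrightarrow>
        (if measure lborel A > 0
         then distributed P lborel (W A) (normal_density 0 (sqrt (measure lborel A)))
         else (AE \<omega> in P. W A \<omega> = 0))) \<and>
     (\<forall>A B. wn_set A \<longrightarrow> wn_set B \<longrightarrow> A \<inter> B = {} \<longrightarrow>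
        (AE \<omega> in P. W (A \<union> B) \<omega> = W A \<omega> + W B \<omega>)) \<and>
     (\<forall>\<A>. finite \<A> \<longrightarrow> disjoint \<A> \<longrightarrow> (\<forall>A\<in>\<A>. wn_set A) \<longrightarrow>
        prob_space.indep_vars P (\<lambda>_. borel) W \<A>) \<and>
     (\<forall>t A. wn_set A \<longrightarrow> A \<subseteq> {0..t} \<times> UNIV \<longrightarrow> W A \<in> borel_measurable (F t)) \<and>
     (\<forall>t A. wn_set A \<longrightarrow> A \<subseteq> {t<..} \<times> UNIV \<longrightarrow>
        prob_space.indep_set P (sets (F t)) {W A -` B \<inter> space P | B. B \<in> sets borel})"

text \<open>Elementary integrand Z(w) 1_{(a,b]}(r) 1_A(y), with Z bounded and F_a-measurable.\<close>
definition elem_ok ::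
  "'w measure \<Rightarrow> (real \<Rightarrow> 'w measure) \<Rightarrow> ('w \<Rightarrow> real) \<times> real \<times> real \<times> (real^'d::finite) set \<Rightarrow> bool" where
  "elem_ok P F p \<longleftrightarrow> (case p of (Z, a, b, A) \<Rightarrow>
     0 \<le> a \<and> a < b \<and> A \<in> sets lborel \<and> emeasure lborel A < \<infinity> \<and>
     Z \<in> borel_measurable (F a) \<and> bounded (Z ` space P))"

definition simple_field ::
  "(('w \<Rightarrow> real) \<times> real \<times> real \<times> (real^'d::finite) set) list \<Rightarrow> real \<Rightarrow> real^'d \<Rightarrow> 'w \<Rightarrow> real" where
  "simple_field ps r y \<omega> =
     (\<Sum>(Z, a, b, A) \<leftarrow> ps. Z \<omega> * indicator {a<..b} r * indicator A y)"

definition simple_walsh ::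
  "((real \<times> (real^'d::finite)) set \<Rightarrow> 'w \<Rightarrow> real) \<Rightarrow> real \<Rightarrow>
   (('w \<Rightarrow> real) \<times> real \<times> real \<times> (real^'d) set) list \<Rightarrow> 'w \<Rightarrow> real" where
  "simple_walsh W t ps \<omega> =
     (\<Sum>(Z, a, b, A) \<leftarrow> ps. Z \<omega> * W ({a<..min b t} \<times> A) \<omega>)"

definition walsh_integral ::
  "'w measure \<Rightarrow> (real \<Rightarrow> 'w measure) \<Rightarrow> ((real \<times> (real^'d::finite)) set \<Rightarrow> 'w \<Rightarrow> real) \<Rightarrow>
   real \<Rightarrow> (real \<Rightarrow> real^'d \<Rightarrow> 'w \<Rightarrow> real) \<Rightarrow> ('w \<Rightarrow> real) \<Rightarrow> bool" where
  "walsh_integral P F W t X Y \<longleftrightarrow>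
     Y \<in> borel_measurable P \<and>
     (\<lambda>(\<omega>, (r, y)). X r y \<omega>) \<in> borel_measurable (P \<Otimes>\<^sub>M (lborel :: (real \<times> (real^'d)) measure)) \<and>
     (\<exists>ps :: nat \<Rightarrow> (('w \<Rightarrow> real) \<times> real \<times> real \<times> (real^'d) set) list.
        (\<forall>n. \<forall>p \<in> set (ps n). elem_ok P F p) \<and>
        ((\<lambda>n. \<integral>\<^sup>+ \<omega>. (\<integral>\<^sup>+ ry. indicator ({0..t} \<times> UNIV) ry *
              ennreal ((X (fst ry) (snd ry) \<omega> - simple_field (ps n) (fst ry) (snd ry) \<omega>)\<^sup>2) \<partial>lborel) \<partial>P)
          \<longlonglongrightarrow> 0) \<and>
        ((\<lambda>n. \<integral>\<^sup>+ \<omega>. ennreal ((Y \<omega> - simple_walsh W t (ps n) \<omega>)\<^sup>2) \<partial>P) \<longlonglongrightarrow> 0))"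

text \<open>Density g_beta of D_1 for the beta-stable subordinator: E exp(-s D_1) = exp(-s^beta).\<close>
definition stable_density :: "real \<Rightarrow> real \<Rightarrow> real" where
  "stable_density \<beta> = (SOME g. g \<in> borel_measurable borel \<and> (\<forall>w. 0 \<le> g w) \<and> (\<forall>w\<le>0. g w = 0) \<and>
       (\<forall>s\<ge>0. (\<integral>\<^sup>+ w. ennreal (exp (- s * w) * g w) \<partial>lborel) = ennreal (exp (- (s powr \<beta>)))))"

text \<open>Density of the inverse subordinator E_t.\<close>
definition fE :: "real \<Rightarrow> real \<Rightarrow> real \<Rightarrow> real" where
  "fE \<beta> t s = t / \<beta> * s powr (-1 - 1/\<beta>) * stable_density \<beta> (t * s powr (-1/\<beta>))"

definition heat_p :: "real \<Rightarrow> real \<Rightarrow> real^'d::finite \<Rightarrow> real" where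
  "heat_p \<nu> s x = (4 * pi * \<nu> * s) powr (- real CARD('d) / 2) * exp (- (norm x)\<^sup>2 / (4 * \<nu> * s))"

definition heat_G :: "real \<Rightarrow> real \<Rightarrow> real \<Rightarrow> real^'d::finite \<Rightarrow> real" where
  "heat_G \<nu> \<beta> t x = (LINT s:{0<..}|lborel. heat_p \<nu> s x * fE \<beta> t s)"

definition mild_solution ::
  "'w measure \<Rightarrow> (real \<Rightarrow> 'w measure) \<Rightarrow> ((real \<times> (real^'d::finite)) set \<Rightarrow> 'w \<Rightarrow> real) \<Rightarrow>
   real \<Rightarrow> real \<Rightarrow> (real \<Rightarrow> real) \<Rightarrow> (real^'d \<Rightarrow> real) \<Rightarrow> (real \<Rightarrow> real^'d \<Rightarrow> 'w \<Rightarrow> real) \<Rightarrow> bool" where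
  "mild_solution P F W \<nu> \<beta> \<sigma> u0 u \<longleftrightarrow>
     (\<forall>t\<ge>0. \<forall>x. u t x \<in> borel_measurable (F t)) \<and>
     (\<forall>t\<ge>0. \<forall>x. integrable P (\<lambda>\<omega>. (u t x \<omega>)\<^sup>2)) \<and>
     (\<forall>T. \<exists>C. \<forall>t\<in>{0..T}. \<forall>x. (\<integral>\<omega>. (u t x \<omega>)\<^sup>2 \<partial>P) \<le> C) \<and>
     (\<forall>t>0. \<forall>x. \<exists>Y. walsh_integral P F W t (\<lambda>r y \<omega>. \<sigma> (u r y \<omega>) * heat_G \<nu> \<beta> (t - r) (x - y)) Y \<and>
        (AE \<omega> in P. u t x \<omega> = (\<integral>y. u0 y * heat_G \<nu> \<beta> t (x - y) \<partial>lborel) + Y \<omega>))"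

definition a0 :: "real \<Rightarrow> nat \<Rightarrow> real" where
  "a0 \<beta> d = (\<integral>w. w powr (\<beta> * real d / 4) * stable_density \<beta> w \<partial>lborel)"

definition const_M :: "real \<Rightarrow> nat \<Rightarrow> real" where
  "const_M \<beta> d = max (a0 \<beta> d * sqrt (Gamma (1 - \<beta> * real d / 2)))
      (3 * sqrt (\<beta> * Gamma (2 * \<beta> * (1 - real d / 4))) / (2 powr \<beta> * Gamma (1 + \<beta>)))"

definition const_c0 :: "real \<Rightarrow> real \<Rightarrow> nat \<Rightarrow> real" where
  "const_c0 \<nu> \<beta> d = sqrt ((const_M \<beta> d)\<^sup>2 /
      ((2 * \<nu>) powr (1/\<beta> - real d / 2) * (1 - 2 powr (\<beta> - 2))\<^sup>2 * (8 * pi * \<nu>) powr (real d / 2)))"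

definition elog :: "real \<Rightarrow> ereal" where
  "elog v = (if v > 0 then ereal (ln v) else -\<infinity>)"

definition growth_L :: "'w measure \<Rightarrow> (real \<Rightarrow> real^'d::finite \<Rightarrow> 'w \<Rightarrow> real) \<Rightarrow> real \<Rightarrow> ereal" where
  "growth_L P u \<theta> = Limsup at_top (\<lambda>t::real.
     (SUP x\<in>{x::real^'d. norm x > \<theta> * t}. ereal (1 / t) * elog (\<integral>\<omega>. (u t x \<omega>)\<^sup>2 \<partial>P)))"

end

theory Submission
  imports Defs "HOL-Real_Asymp.Real_Asymp"
begin

text \<open>Let \<open>v t x\<close> be the second moment of the solution, \<open>h\<close> its deterministic part and
  \<open>S\<close> the second moment of \<open>\<sigma>(u)\<close>. The Walsh isometry turns the mild equation into the renewal equation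
  \<open>v = h\<^sup>2 + S * G\<^sup>2\<close> (convolution in space-time), where \<open>S\<close> is comparable to \<open>v\<close>.

  For the upper bound one computes \<open>\<integral> exp (- \<gamma> t + c \<bullet> x) G\<^sup>2\<close>: the Gaussian integral in \<open>x\<close> reduces it to
  moments of the stable law, which are quotients of Gamma values. As soon as \<open>Lip\<^sup>2\<close> times this integral is less
  than 1, iterating the renewal inequality gives \<open>v t x \<le> A exp (\<gamma> t - c \<bullet> x)\<close> uniformly in the direction of \<open>c\<close>,
  and optimizing over \<open>\<gamma>\<close> and \<open>|c|\<close> yields the threshold for \<open>\<theta>\<close>.

  For the lower bound integrate \<open>exp (- \<gamma> t) S\<close> over the cone \<open>x\<^sub>i > \<theta> t\<close>. Since the cone is an additive semigroup, the
  renewal inequality bounds this mass below by \<open>L\<^sup>2\<close> times the mass times the integral of \<open>exp (- \<gamma> t) G\<^sup>2\<close> over the cone,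
  and the latter integral tends to infinity as \<open>\<gamma>, \<theta> \<rightarrow> 0\<close> by the scaling of \<open>G\<close> and \<open>\<beta> d < 2\<close>. So the mass
  is infinite, which is incompatible with nonpositive exponential growth outside \<open>|x| \<le> \<theta> t\<close> and the upper bound.\<close>

subsection \<open>The one-sided stable law\<close>

text \<open>Three obstacles shape the proof. \<open>stable_density\<close> is a choice among
  densities with a given Laplace transform, so the law must be constructed before any moment can be
  computed; afterwards only its specification is used. Estimates are therefore made for an
  extended-valued kernel that agrees with \<open>heat_G\<close> off the origin. A mild solution is
  known only pointwise, through mean-square limits of elementary integrals, so the isometry, the
  vanishing mean and the joint measurability of the source have to be extracted from these limits.
  In \<open>const_c0\<close>, \<open>(8 * pi * \<nu>) powr (d / 2)\<close> comes from integrating a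
  product of two Gaussians, \<open>a0\<close> and its Gamma factor from the term of index 0 in the
  series of the exponentially tilted kernel, and \<open>1 - 2 powr (\<beta> - 2)\<close> from a
  geometric series that dominates the remaining terms.\<close>

text \<open>The weights of the Sibuya law, whose generating function is \<open>1 - (1 - z)\<^sup>b\<close>; sums of \<open>n\<close>
  independent copies, scaled by \<open>n\<close> to the power \<open>- 1 / b\<close>, converge to the stable law.\<close>

definition sibuya_weight :: "real \<Rightarrow> nat \<Rightarrow> real" where
  "sibuya_weight b k = (if k = 0 then 0 else (- 1) ^ (k + 1) * (b gchoose k))"

text \<open>Consecutive binomial coefficients have ratio \<open>(b - k) / (k + 1)\<close>, which is
  negative for \<open>k \<ge> 1\<close> because \<open>b < 1\<close>. From index 1 on the
  coefficients alternate in sign, and the factor in the definition cancels the alternation.\<close>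

lemma sibuya_weight_nonneg:
  assumes b: "0 < b" "b < 1"
  shows "0 \<le> sibuya_weight b k"
proof -
  have "0 \<le> (- 1) ^ k * (b gchoose Suc k)" for k
  proof (induction k)
    case 0
    then show ?case using b by simp
  next
    case (Suc k)
    have "(b gchoose Suc (Suc k)) * real (Suc (Suc k)) = (b - real (Suc k)) * (b gchoose Suc k)"
      using gbinomial_mult_1[of b "Suc k"] by (simp add: algebra_simps)
    then have eq: "(b gchoose Suc (Suc k)) = (b - real (Suc k)) / real (Suc (Suc k)) * (b gchoose Suc k)"
      by (simp add: field_simps)
    have "(- 1) ^ Suc k * (b gchoose Suc (Suc k)) =
        ((real (Suc k) - b) / real (Suc (Suc k))) * ((- 1) ^ k * (b gchoose Suc k))"
      unfolding eq by (simp add: field_simps)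
    moreover have "0 \<le> (real (Suc k) - b) / real (Suc (Suc k))"
      using b by (intro divide_nonneg_nonneg) auto
    ultimately show ?case using Suc by (metis mult_nonneg_nonneg)
  qed
  then show ?thesis
    by (cases k) (auto simp: sibuya_weight_def)
qed

lemma sibuya_weight_pgf:
  assumes b: "0 < b" "b < 1" and z: "0 \<le> z" "z < 1"
  shows "(\<lambda>k. sibuya_weight b k * z ^ k) sums (1 - (1 - z) powr b)"
proof -
  have "(\<lambda>n. (b gchoose n) * (- z) ^ n) sums (1 + - z) powr b"
    using z by (intro gen_binomial_real) auto
  then have "(\<lambda>n. (if n = 0 then 1 else 0) - (b gchoose n) * (- z) ^ n) sums (1 - (1 - z) powr b)"
    using sums_If_finite_set[of "{0::nat}" "\<lambda>_. 1::real"] by (intro sums_diff) auto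
  moreover have "(if n = 0 then 1 else 0) - (b gchoose n) * (- z) ^ n = sibuya_weight b n * z ^ n" for n
    by (cases n) (auto simp: sibuya_weight_def power_minus[of z])
  ultimately show ?thesis by simp
qed

text \<open>An Abel argument at the endpoint of convergence. The generating function dominates its
  partial sums and is dominated by the total mass when \<open>z < 1\<close>; letting
  \<open>z\<close> tend to 1 from the left gives one inequality in each direction.\<close>

lemma sibuya_weight_sums_1:
  assumes b: "0 < b" "b < 1"
  shows "sibuya_weight b sums 1"
proof -
  let ?w = "sibuya_weight b"
  have w0: "0 \<le> ?w k" for k by (rule sibuya_weight_nonneg[OF b])
  have partial: "(\<Sum>k<N. ?w k) \<le> 1" for N
  proof -
    have "((\<lambda>z. \<Sum>k<N. ?w k * z ^ k) \<longlongrightarrow> (\<Sum>k<N. ?w k * 1 ^ k)) (at_left 1)"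
      by (intro tendsto_intros)
    moreover have "\<forall>\<^sub>F z in at_left 1. (\<Sum>k<N. ?w k * z ^ k) \<le> 1"
    proof -
      have "(\<Sum>k<N. ?w k * z ^ k) \<le> 1" if z: "0 < z" "z < 1" for z
      proof -
        have "(\<Sum>k<N. ?w k * z ^ k) \<le> 1 - (1 - z) powr b"
          using sibuya_weight_pgf[OF b, of z] z w0
          by (metis (no_types, lifting) less_imp_le mult_nonneg_nonneg sum_le_suminf finite_lessThan
              sums_iff zero_le_power)
        then show ?thesis by (smt (verit) powr_ge_zero)
      qed
      then show ?thesis
        using eventually_at_left[of 0 "1::real"] by (auto intro!: exI[of _ 0])
    qed
    ultimately have "(\<Sum>k<N. ?w k * 1 ^ k) \<le> 1"
      by (intro tendsto_upperbound[of _ _ "at_left 1"]) auto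
    then show ?thesis by simp
  qed
  have summ: "summable ?w"
    using w0 partial by (intro summableI_nonneg_bounded[of _ 1]) auto
  have "suminf ?w \<le> 1"
    using partial summ by (intro suminf_le_const) auto
  moreover have "1 \<le> suminf ?w"
  proof -
    have "((\<lambda>z. 1 - (1 - z) powr b) \<longlongrightarrow> 1 - (1 - 1) powr b) (at_left (1::real))"
      using b by (intro tendsto_intros tendsto_powr2) (auto simp: eventually_at_filter)
    moreover have "\<forall>\<^sub>F z in at_left 1. 1 - (1 - z) powr b \<le> suminf ?w"
    proof -
      have "1 - (1 - z) powr b \<le> suminf ?w" if z: "0 < z" "z < 1" for z
      proof -
        have "(\<Sum>k. ?w k * z ^ k) \<le> suminf ?w"
          using sibuya_weight_pgf[OF b, of z] z w0 summ
          by (intro suminf_le) (auto simp: sums_iff intro!: mult_left_le power_le_one)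
        then show ?thesis
          using sibuya_weight_pgf[OF b, of z] z by (simp add: sums_iff)
      qed
      then show ?thesis
        using eventually_at_left[of 0 "1::real"] by (auto intro!: exI[of _ 0])
    qed
    ultimately show ?thesis
      using b by (intro tendsto_upperbound[of _ _ "at_left 1", where x = "1"]) auto
  qed
  ultimately show ?thesis using summ by (simp add: sums_iff)
qed

text \<open>The convolution powers of the Sibuya law, built by adding one independent copy at a
  time: \<open>bind_pmf\<close> followed by \<open>map_pmf\<close> is the law of an independent sum,
  so generating functions multiply.\<close>

lemma exists_pmf_power_pgf:
  assumes b: "0 < b" "b < 1"
  shows "\<exists>p :: nat pmf. \<forall>z. 0 \<le> z \<longrightarrow> z < 1 \<longrightarrow>
    (\<integral>\<^sup>+ k. ennreal (z ^ k) \<partial>measure_pmf p) = ennreal ((1 - (1 - z) powr b) ^ n)"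
proof (induction n)
  case 0
  show ?case by (intro exI[of _ "return_pmf 0"]) auto
next
  case (Suc n)
  then obtain p :: "nat pmf" where p: "\<And>z. 0 \<le> z \<Longrightarrow> z < 1 \<Longrightarrow>
    (\<integral>\<^sup>+ k. ennreal (z ^ k) \<partial>measure_pmf p) = ennreal ((1 - (1 - z) powr b) ^ n)" by blast
  define q where "q = embed_pmf (sibuya_weight b)"
  have tot: "(\<integral>\<^sup>+ k. ennreal (sibuya_weight b k) \<partial>count_space UNIV) = 1"
    using sibuya_weight_sums_1[OF b] sibuya_weight_nonneg[OF b]
    by (subst nn_integral_count_space_nat, subst suminf_ennreal2) (auto simp: sums_iff)
  have q: "(\<integral>\<^sup>+ k. ennreal (z ^ k) \<partial>measure_pmf q) = ennreal (1 - (1 - z) powr b)"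
    if z: "0 \<le> z" "z < 1" for z
    using sibuya_weight_pgf[OF b z] sibuya_weight_nonneg[OF b] z unfolding q_def
    by (subst nn_integral_measure_pmf, subst pmf_embed_pmf[OF sibuya_weight_nonneg[OF b] tot],
        subst nn_integral_count_space_nat)
       (auto simp: sums_iff ennreal_mult'[symmetric] suminf_ennreal2)
  have "(\<integral>\<^sup>+ k. ennreal (z ^ k) \<partial>measure_pmf (bind_pmf q (\<lambda>x. map_pmf ((+) x) p))) =
      ennreal ((1 - (1 - z) powr b) ^ Suc n)" if z: "0 \<le> z" "z < 1" for z
  proof -
    have le: "(1 - z) powr b \<le> 1" using z b by (simp add: powr_le1)
    have "(\<integral>\<^sup>+ k. ennreal (z ^ k) \<partial>measure_pmf (bind_pmf q (\<lambda>x. map_pmf ((+) x) p))) =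
       (\<integral>\<^sup>+ x. ennreal (z ^ x) * (\<integral>\<^sup>+ k. ennreal (z ^ k) \<partial>measure_pmf p) \<partial>measure_pmf q)"
      using z by (simp add: power_add ennreal_mult nn_integral_cmult)
    also have "\<dots> = ennreal (1 - (1 - z) powr b) * ennreal ((1 - (1 - z) powr b) ^ n)"
      using z by (simp add: p q nn_integral_multc)
    also have "\<dots> = ennreal ((1 - (1 - z) powr b) ^ Suc n)"
      using le by (subst ennreal_mult[symmetric]) auto
    finally show ?thesis .
  qed
  then show ?case by blast
qed

text \<open>Writing \<open>max x 0\<close> in place of \<open>x\<close> changes nothing almost
  surely, but makes the Laplace integrand bounded and continuous on the whole line, as weak
  convergence demands.\<close>

lemma exists_real_distribution_prelimit:
  assumes b: "0 < b" "b < 1" and n: "0 < n"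
  shows "\<exists>M. real_distribution M \<and> (AE x in M. 0 \<le> x) \<and>
    (\<forall>s>0. (\<integral>x. exp (- s * max x 0) \<partial>M) = (1 - (1 - exp (- s * real n powr (- 1 / b))) powr b) ^ n)"
proof -
  obtain p :: "nat pmf" where p: "\<And>z. 0 \<le> z \<Longrightarrow> z < 1 \<Longrightarrow>
    (\<integral>\<^sup>+ k. ennreal (z ^ k) \<partial>measure_pmf p) = ennreal ((1 - (1 - z) powr b) ^ n)"
    using exists_pmf_power_pgf[OF b, of n] by blast
  define h where "h = real n powr (- 1 / b)"
  have h: "0 < h" using n by (simp add: h_def)
  define M where "M = distr (measure_pmf p) borel (\<lambda>k. real k * h)"
  have "prob_space M" unfolding M_def by (intro measure_pmf.prob_space_distr) auto
  then have rd: "real_distribution M"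
    by (auto simp: real_distribution_def real_distribution_axioms_def M_def)
  moreover have "AE x in M. 0 \<le> x"
    unfolding M_def using h by (subst AE_distr_iff) auto
  moreover have "(\<integral>x. exp (- s * max x 0) \<partial>M) = (1 - (1 - exp (- s * h)) powr b) ^ n" if s: "0 < s" for s
  proof -
    have le: "(1 - exp (- s * h)) powr b \<le> 1" using s h b by (simp add: powr_le1)
    have "(\<integral>x. exp (- s * max x 0) \<partial>M) = enn2real (\<integral>\<^sup>+x. ennreal (exp (- s * max x 0)) \<partial>M)"
      by (rule integral_eq_nn_integral) (auto simp: M_def)
    also have "(\<integral>\<^sup>+x. ennreal (exp (- s * max x 0)) \<partial>M) =
        (\<integral>\<^sup>+ k. ennreal (exp (- s * h) ^ k) \<partial>measure_pmf p)"
      unfolding M_def using h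
      by (subst nn_integral_distr) (auto simp: exp_of_nat_mult[symmetric] mult_ac max.absorb1 intro!: nn_integral_cong)
    also have "\<dots> = ennreal ((1 - (1 - exp (- s * h)) powr b) ^ n)"
      using s h by (intro p) auto
    finally show ?thesis using le by simp
  qed
  ultimately show ?thesis unfolding h_def by blast
qed

text \<open>With \<open>h\<close> the scaling factor, \<open>(1 - exp (- s * h)) powr b\<close>
  behaves like \<open>s powr b / n\<close>, so the transforms of the rescaled sums converge to
  \<open>exp (- (s powr b))\<close>. Tightness supplies a weak limit along a subsequence, and the
  limit of the transforms identifies it.\<close>

lemma exists_stable_distribution:
  assumes b: "0 < b" "b < 1"
  shows "\<exists>M. real_distribution M \<and> (AE x in M. 0 \<le> x) \<and>
    (\<forall>s>0. (\<integral>x. exp (- s * x) \<partial>M) = exp (- (s powr b)))"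
proof -
  define h where "h n = real (Suc n) powr (- 1 / b)" for n
  have hb: "h n powr b = 1 / real (Suc n)" for n
  proof -
    have "h n powr b = real (Suc n) powr ((- 1 / b) * b)" unfolding h_def by (rule powr_powr)
    then show ?thesis using b by (simp add: powr_minus_divide del: of_nat_Suc)
  qed
  have h0: "0 < h n" for n by (simp add: h_def)
  have "\<exists>M. \<forall>n. real_distribution (M n) \<and> (AE x in M n. 0 \<le> x) \<and>
    (\<forall>s>0. (\<integral>x. exp (- s * max x 0) \<partial>M n) = (1 - (1 - exp (- s * h n)) powr b) ^ Suc n)"
    unfolding h_def by (intro choice allI exists_real_distribution_prelimit[OF b]) auto
  then obtain M where rd: "\<And>n. real_distribution (M n)" and pos: "\<And>n. AE x in M n. 0 \<le> x"
    and lt: "\<And>n s. 0 < s \<Longrightarrow> (\<integral>x. exp (- s * max x 0) \<partial>M n) = (1 - (1 - exp (- s * h n)) powr b) ^ Suc n"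
    by blast
  \<comment> \<open>Bernoulli's inequality bounds the transforms from below uniformly in
    \<open>n\<close>. As \<open>s\<close> tends to 0 the bound tends to 1, which is what tightness
    rests on.\<close>
  have ltlow: "1 - s powr b \<le> (\<integral>x. exp (- s * max x 0) \<partial>M n)" if s: "0 < s" for s n
  proof -
    let ?x = "(1 - exp (- s * h n)) powr b"
    have "1 - exp (- s * h n) \<le> s * h n"
      using exp_ge_add_one_self[of "- s * h n"] by simp
    then have "?x \<le> (s * h n) powr b"
      using s h0[of n] b by (intro powr_mono2) (auto simp: less_imp_le)
    also have "\<dots> = s powr b / real (Suc n)"
      using s h0[of n] hb[of n] by (simp add: powr_mult)
    finally have le: "real (Suc n) * ?x \<le> s powr b" by (simp add: field_simps)
    have x1: "?x \<le> 1" using s h0[of n] b by (simp add: powr_le1)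
    have "1 + real (Suc n) * (- ?x) \<le> (1 + - ?x) ^ Suc n"
      by (rule Bernoulli_inequality) (use x1 in auto)
    with le show ?thesis unfolding lt[OF s] by simp
  qed
  have tight: "tight M"
    unfolding tight_def
  proof (intro conjI allI impI rd)
    fix e :: real assume e: "0 < e"
    \<comment> \<open>Chosen so that the transform at \<open>s\<close> is at least
      \<open>1 - e / 4\<close>. Beyond \<open>1 / s\<close> the integrand is at most
      \<open>exp (-1) \<le> 1 / 2\<close>, so the mass there is at most
      \<open>e / 2\<close>.\<close>
    define s where "s = (e / 4) powr (1 / b)"
    have s: "0 < s" "s powr b = e / 4" using e b by (auto simp: s_def powr_powr)
    have "1 - e < measure (M n) {-1<..1/s}" for n
    proof -
      interpret real_distribution "M n" by (rule rd)
      have "(\<integral>x. exp (- s * max x 0) \<partial>M n) \<le> (\<integral>x. 1 - (1 - exp (-1)) * indicator {1/s<..} x \<partial>M n)"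
      proof (intro integral_mono)
        show "integrable (M n) (\<lambda>x. exp (- s * max x 0))"
          using s by (intro integrable_const_bound[of _ 1]) (auto intro!: mult_nonneg_nonneg)
        fix x
        show "exp (- s * max x 0) \<le> 1 - (1 - exp (-1)) * indicator {1/s<..} x"
        proof (cases "1 / s < x")
          case True
          then have "1 < s * x" "0 < x" using s by (auto simp: field_simps intro: less_trans[of 0 "1/s"])
          then show ?thesis using True by (simp add: max_def)
        next
          case False
          then show ?thesis using s by (simp add: mult_nonneg_nonneg)
        qed
      qed (intro Bochner_Integration.integrable_diff integrable_mult_right integrable_real_indicator,
          auto simp: emeasure_eq_measure)
      also have "\<dots> = 1 - (1 - exp (-1)) * prob {1/s<..}"
        using prob_space
        by (subst Bochner_Integration.integral_diff)
          (auto simp: emeasure_eq_measure intro!: integrable_real_indicator)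
      finally have "(1 - exp (-1)) * prob {1/s<..} \<le> e / 4"
        using ltlow[OF s(1), of n] s by simp
      moreover have "exp (-1::real) \<le> 1/2"
        using exp_ge_add_one_self[of "1::real"] by (simp add: exp_minus field_simps)
      then have "1/2 * prob {1/s<..} \<le> (1 - exp (-1)) * prob {1/s<..}"
        by (intro mult_right_mono) auto
      ultimately have up: "prob {1/s<..} \<le> e / 2" by simp
      have "1 = prob {0..}"
        using pos[of n] prob_eq_1[of "{0..}"] by simp
      also have "\<dots> \<le> prob ({-1<..1/s} \<union> {1/s<..})"
        by (intro finite_measure_mono) auto
      also have "\<dots> \<le> prob {-1<..1/s} + prob {1/s<..}"
        by (intro measure_Un_le) auto
      finally show ?thesis using up e by simp
    qed
    moreover have "-1 < 1 / s" using s by (smt (verit) divide_pos_pos)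
    ultimately show "\<exists>a b. a < b \<and> (\<forall>n. 1 - e < measure (M n) {a<..b})" by blast
  qed
  from tight_imp_convergent_subsubsequence[OF tight strict_mono_id]
  obtain r N where r: "strict_mono (r :: nat \<Rightarrow> nat)" and N: "real_distribution N"
    and wc: "weak_conv_m (M \<circ> id \<circ> r) N" by blast
  have conv: "(\<lambda>n. \<integral>x. f x \<partial>M (r n)) \<longlonglongrightarrow> (\<integral>x. f x \<partial>N)"
    if "\<And>x. isCont f x" "\<And>x. norm (f x) \<le> B" for f :: "real \<Rightarrow> real" and B
    using weak_conv_imp_integral_bdd_continuous_conv[of "M \<circ> id \<circ> r" N f B] that rd N wc by simp
  interpret N: real_distribution N by (rule N)
  have AEpos: "AE x in N. 0 \<le> x"
  proof -
    \<comment> \<open>A bounded continuous test function that vanishes exactly on the nonnegative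
      half-line; it carries nonnegativity over to the weak limit.\<close>
    let ?f = "\<lambda>x::real. max 0 (min 1 (- x))"
    have "(\<integral>x. ?f x \<partial>M n) = 0" for n
    proof -
      have "(\<integral>x. ?f x \<partial>M n) = (\<integral>x. 0 \<partial>M n)"
      proof (rule integral_cong_AE)
        interpret real_distribution "M n" by (rule rd)
        show "?f \<in> borel_measurable (M n)" by simp
      qed (use pos[of n] in auto)
      then show ?thesis by simp
    qed
    moreover have "isCont ?f x" for x by (intro continuous_intros)
    ultimately have "(\<lambda>n. 0) \<longlonglongrightarrow> (\<integral>x. ?f x \<partial>N)"
      using conv[of ?f 1] by (simp add: max_def min_def)
    then have "(\<integral>x. ?f x \<partial>N) = 0" by (simp add: LIMSEQ_const_iff)
    then have "AE x in N. ?f x = 0"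
      by (subst (asm) integral_nonneg_eq_0_iff_AE) (auto intro!: N.integrable_const_bound[of _ 1])
    then show ?thesis by eventually_elim (auto simp: max_def min_def split: if_splits)
  qed
  have "(\<integral>x. exp (- s * x) \<partial>N) = exp (- (s powr b))" if s: "0 < s" for s
  proof -
    have hlim: "h \<longlonglongrightarrow> 0"
      unfolding h_def using b by real_asymp
    have "((\<lambda>h. (1 - exp (- s * h)) / h) \<longlongrightarrow> s) (at_right 0)" by real_asymp
    moreover have "filterlim h (at_right 0) sequentially"
      using hlim h0 by (intro tendsto_imp_filterlim_at_right) auto
    ultimately have "(\<lambda>n. (1 - exp (- s * h n)) / h n) \<longlonglongrightarrow> s"
      by (rule filterlim_compose)
    then have "(\<lambda>n. ((1 - exp (- s * h n)) / h n) powr b) \<longlonglongrightarrow> s powr b"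
      using s by (intro tendsto_powr) auto
    then have c: "(\<lambda>n. (1 - exp (- s * h n)) powr b * real (Suc n)) \<longlonglongrightarrow> s powr b"
      using s h0 hb by (simp add: powr_divide less_imp_le)
    have "(\<lambda>n. (1 + (- ((1 - exp (- s * h n)) powr b * real (Suc n))) / real (Suc n)) ^ Suc n)
        \<longlonglongrightarrow> exp (- (s powr b))"
    proof -
      let ?c = "\<lambda>n. (1 - exp (- s * h n)) powr b * real (Suc n)"
      have "(\<lambda>n. (1 + (- (s powr b)) / real (Suc n)) ^ Suc n) \<longlonglongrightarrow> exp (- (s powr b))"
        using LIMSEQ_Suc[OF tendsto_exp_limit_sequentially[of "- (s powr b)"]] by simp
      moreover have "(\<lambda>n. (1 + - ?c n / real (Suc n)) ^ Suc n - (1 + - (s powr b) / real (Suc n)) ^ Suc n)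
          \<longlonglongrightarrow> 0"
      proof (rule Lim_null_comparison)
        show "(\<lambda>n. \<bar>?c n - s powr b\<bar>) \<longlonglongrightarrow> 0"
          using tendsto_rabs_zero[OF LIM_zero[OF c]] by simp
        \<comment> \<open>Powers of two numbers in the unit interval differ by at most the exponent
          times the difference of the bases. The second base lies there only from some
          \<open>n\<close> on.\<close>
        have "(\<lambda>n. s powr b / real (Suc n)) \<longlonglongrightarrow> 0" by real_asymp
        then have "\<forall>\<^sub>F n in sequentially. s powr b / real (Suc n) < 1"
          by (rule order_tendstoD) simp
        then show "\<forall>\<^sub>F n in sequentially.
          norm ((1 + - ?c n / real (Suc n)) ^ Suc n - (1 + - (s powr b) / real (Suc n)) ^ Suc n)
            \<le> \<bar>?c n - s powr b\<bar>"
        proof eventually_elim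
          case (elim n)
          have x1: "(1 - exp (- s * h n)) powr b \<le> 1" using s h0[of n] b by (simp add: powr_le1)
          have "norm ((1 + - ?c n / real (Suc n)) ^ Suc n - (1 + - (s powr b) / real (Suc n)) ^ Suc n)
            \<le> real (Suc n) * norm ((1 + - ?c n / real (Suc n)) - (1 + - (s powr b) / real (Suc n)))"
            using x1 elim by (intro norm_power_diff) (auto simp: abs_le_iff simp del: of_nat_Suc)
          also have "\<dots> = norm (real (Suc n) * ((1 + - ?c n / real (Suc n)) - (1 + - (s powr b) / real (Suc n))))"
            unfolding norm_mult by (simp del: of_nat_Suc)
          also have "real (Suc n) * ((1 + - ?c n / real (Suc n)) - (1 + - (s powr b) / real (Suc n))) = s powr b - ?c n"
            by (simp add: field_simps del: of_nat_Suc)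
          finally show ?case by (simp add: abs_minus_commute)
        qed
      qed
      ultimately show ?thesis by (rule Lim_transform)
    qed
    then have "(\<lambda>n. \<integral>x. exp (- s * max x 0) \<partial>M n) \<longlonglongrightarrow> exp (- (s powr b))"
      using lt[OF s] by (simp del: power_Suc)
    then have "(\<lambda>n. \<integral>x. exp (- s * max x 0) \<partial>M (r n)) \<longlonglongrightarrow> exp (- (s powr b))"
      using LIMSEQ_subseq_LIMSEQ[OF _ r] by (auto simp: comp_def)
    moreover have "(\<lambda>n. \<integral>x. exp (- s * max x 0) \<partial>M (r n)) \<longlonglongrightarrow> (\<integral>x. exp (- s * max x 0) \<partial>N)"
      using s by (intro conv[of _ 1]) (auto intro!: continuous_intros mult_nonneg_nonneg)
    ultimately have "(\<integral>x. exp (- s * max x 0) \<partial>N) = exp (- (s powr b))"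
      by (rule LIMSEQ_unique[symmetric])
    moreover have "(\<integral>x. exp (- s * max x 0) \<partial>N) = (\<integral>x. exp (- s * x) \<partial>N)"
    proof (rule integral_cong_AE)
      show "AE x in N. exp (- s * max x 0) = exp (- s * x)"
        using AEpos by eventually_elim (simp add: max.absorb1)
    qed auto
    ultimately show ?thesis by simp
  qed
  with N AEpos show ?thesis by blast
qed

section \<open>Gamma-type integrals and the density of the stable law\<close>

lemma nn_integral_powr_exp:
  fixes a s :: real
  assumes a: "0 < a" and s: "0 < s"
  shows "(\<integral>\<^sup>+x\<in>{0<..}. ennreal (x powr (a - 1) * exp (- s * x)) \<partial>lborel) = ennreal (Gamma a * s powr (- a))"
proof -
  let ?f = "\<lambda>t::real. ennreal (indicator {0..} t * t powr (a - 1) / exp t)"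
  have "ennreal (Gamma a) = ennreal \<bar>s\<bar> * (\<integral>\<^sup>+x. ?f (0 + s * x) \<partial>lborel)"
    unfolding Gamma_conv_nn_integral_real[OF a] using s by (intro nn_integral_real_affine) auto
  also have "(\<integral>\<^sup>+x. ?f (0 + s * x) \<partial>lborel) =
      (\<integral>\<^sup>+x. ennreal (s powr (a - 1)) * (ennreal (x powr (a - 1) * exp (- s * x)) * indicator {0<..} x) \<partial>lborel)"
    using s
    by (intro nn_integral_cong)
      (auto simp: indicator_def zero_le_mult_iff powr_mult exp_minus field_simps ennreal_mult'[symmetric]
         intro: antisym)
  also have "\<dots> = ennreal (s powr (a - 1)) * (\<integral>\<^sup>+x\<in>{0<..}. ennreal (x powr (a - 1) * exp (- s * x)) \<partial>lborel)"
    by (intro nn_integral_cmult) auto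
  finally have eq: "ennreal (Gamma a) = ennreal (s powr a) * (\<integral>\<^sup>+x\<in>{0<..}. ennreal (x powr (a - 1) * exp (- s * x)) \<partial>lborel)"
    using s by (simp add: mult.assoc[symmetric] ennreal_mult'[symmetric] powr_mult_base del: ennreal_mult'')
  have "ennreal (s powr (- a)) * ennreal (Gamma a) = ennreal (s powr (- a)) * ennreal (s powr a)
      * (\<integral>\<^sup>+x\<in>{0<..}. ennreal (x powr (a - 1) * exp (- s * x)) \<partial>lborel)"
    by (simp only: eq mult.assoc)
  also have "ennreal (s powr (- a)) * ennreal (s powr a) = 1"
    using s by (simp add: ennreal_mult'[symmetric] powr_add[symmetric])
  finally show ?thesis using a by (simp add: ennreal_mult' mult.commute Gamma_real_pos)
qed

text \<open>Read from right to left, this recovers a Laplace transform from its derivative by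
  Tonelli. With \<open>x\<close> as a rate it is also the tail of an exponential law.\<close>

lemma nn_integral_exp_Ioi:
  fixes x :: real
  assumes x: "0 < x"
  shows "(\<integral>\<^sup>+r\<in>{s<..}. ennreal (x * exp (- r * x)) \<partial>lborel) = ennreal (exp (- s * x))"
proof -
  have "(\<integral>\<^sup>+r\<in>{s<..}. ennreal (x * exp (- r * x)) \<partial>lborel) = (\<integral>\<^sup>+r\<in>{s..}. ennreal (x * exp (- r * x)) \<partial>lborel)"
    by (intro nn_integral_cong_AE) (use AE_lborel_singleton[of s] in \<open>auto simp: indicator_def\<close>)
  also have "\<dots> = ennreal (0 - (- exp (- s * x)))"
  proof (rule nn_integral_FTC_atLeast)
    have "filterlim (\<lambda>r. x * r) at_top at_top"
      using x filterlim_tendsto_pos_mult_at_top[OF tendsto_const x filterlim_ident] by simp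
    then show "((\<lambda>r. - exp (- r * x)) \<longlongrightarrow> 0) at_top"
      using x by real_asymp
  qed (use x in \<open>auto intro!: derivative_eq_intros\<close>)
  finally show ?thesis by simp
qed

text \<open>If \<open>N\<close> has Laplace transform \<open>F s = exp (- s\<^sup>b)\<close>, then \<open>- F' s = b s\<^sup>b\<^sup>-\<^sup>1 F s\<close> is the
  transform of the convolution of \<open>N\<close> with \<open>b / Gamma (1 - b) x\<^sup>-\<^sup>b\<close>; since it is also that of
  \<open>x N(dx)\<close>, dividing this convolution by \<open>x\<close> gives the density.\<close>

lemma exists_stable_density:
  assumes b: "0 < b" "b < (1::real)"
  shows "\<exists>g. g \<in> borel_measurable borel \<and> (\<forall>w. 0 \<le> g w) \<and> (\<forall>w\<le>0. g w = 0) \<and>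
       (\<forall>s\<ge>0. (\<integral>\<^sup>+ w. ennreal (exp (- s * w) * g w) \<partial>lborel) = ennreal (exp (- (s powr b))))"
proof -
  obtain N where N: "real_distribution N" and pos: "AE x in N. 0 \<le> x"
    and lt: "\<And>s. 0 < s \<Longrightarrow> (\<integral>x. exp (- s * x) \<partial>N) = exp (- (s powr b))"
    using exists_stable_distribution[OF b] by blast
  interpret real_distribution N by (rule N)
  have ltn: "(\<integral>\<^sup>+x. ennreal (exp (- s * x)) \<partial>N) = ennreal (exp (- (s powr b)))" if s: "0 < s" for s
  proof (subst nn_integral_eq_integral)
    show "integrable N (\<lambda>x. exp (- s * x))"
      using pos s by (intro integrable_const_bound[of _ 1]) (auto elim!: eventually_mono)
  qed (use lt[OF s] in auto)
  define c where "c = b / Gamma (1 - b)"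
  have c: "0 < c" using b by (auto simp: c_def Gamma_real_pos)
  define k where "k x = (\<integral>\<^sup>+y\<in>{..<x}. ennreal (c * (x - y) powr (- b)) \<partial>N)" for x
  have [measurable]: "k \<in> borel_measurable borel"
  proof -
    have "(\<lambda>x. \<integral>\<^sup>+y. ennreal (c * (x - y) powr (- b)) * indicator {0<..} (x - y) \<partial>N) \<in> borel_measurable borel"
      by measurable
    moreover have "k = (\<lambda>x. \<integral>\<^sup>+y. ennreal (c * (x - y) powr (- b)) * indicator {0<..} (x - y) \<partial>N)"
      unfolding k_def by (intro ext nn_integral_cong) (auto simp: indicator_def)
    ultimately show ?thesis by simp
  qed
  have k0: "k x = 0" if "x \<le> 0" for x
    unfolding k_def using pos that
    by (subst nn_integral_0_iff_AE) (auto elim!: eventually_mono simp: indicator_def)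
  have ltk: "(\<integral>\<^sup>+x. ennreal (exp (- s * x)) * k x \<partial>lborel) = ennreal (b * s powr (b - 1) * exp (- (s powr b)))"
    if s: "0 < s" for s
  proof -
    have inner: "(\<integral>\<^sup>+x. ennreal (exp (- s * x)) * (ennreal (c * (x - y) powr (- b)) * indicator {0<..} (x - y)) \<partial>lborel)
      = ennreal (b * s powr (b - 1)) * ennreal (exp (- s * y))" (is "?L = _") for y
    proof -
      have "?L = (\<integral>\<^sup>+x. ennreal (exp (- s * (y + 1 * x))) * (ennreal (c * ((y + 1 * x) - y) powr (- b)) *
          indicator {0<..} ((y + 1 * x) - y)) \<partial>lborel)"
        by (subst nn_integral_real_affine[of _ 1 y]) auto
      also have "\<dots> = (\<integral>\<^sup>+x. (ennreal (exp (- s * y)) * ennreal c) *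
         (ennreal (x powr ((1 - b) - 1) * exp (- s * x)) * indicator {0<..} x) \<partial>lborel)"
        using c by (intro nn_integral_cong)
          (auto simp: indicator_def ennreal_mult'[symmetric] exp_add[symmetric] algebra_simps)
      also have "\<dots> = (ennreal (exp (- s * y)) * ennreal c) * ennreal (Gamma (1 - b) * s powr (- (1 - b)))"
        using b s by (subst nn_integral_cmult, measurable, subst nn_integral_powr_exp) auto
      also have "\<dots> = ennreal (exp (- s * y)) * ennreal (c * (Gamma (1 - b) * s powr (- (1 - b))))"
        using c by (simp add: ennreal_mult' mult.assoc)
      also have "c * (Gamma (1 - b) * s powr (- (1 - b))) = b * s powr (b - 1)"
        using less_imp_neq[OF Gamma_real_pos[of "1 - b"]] b by (simp add: c_def)
      finally show ?thesis by (simp add: mult.commute)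
    qed
    have "(\<integral>\<^sup>+x. ennreal (exp (- s * x)) * k x \<partial>lborel) =
       (\<integral>\<^sup>+x. (\<integral>\<^sup>+y. ennreal (exp (- s * x)) * (ennreal (c * (x - y) powr (- b)) * indicator {0<..} (x - y)) \<partial>N) \<partial>lborel)"
      unfolding k_def
      by (subst nn_integral_cmult[symmetric]) (auto intro!: nn_integral_cong simp: indicator_def)
    also have "\<dots> = (\<integral>\<^sup>+y. (\<integral>\<^sup>+x. ennreal (exp (- s * x)) * (ennreal (c * (x - y) powr (- b)) * indicator {0<..} (x - y)) \<partial>lborel) \<partial>N)"
    proof -
      interpret pair_sigma_finite N lborel ..
      show ?thesis by (rule Fubini') measurable
    qed
    also have "\<dots> = ennreal (b * s powr (b - 1)) * (\<integral>\<^sup>+y. ennreal (exp (- s * y)) \<partial>N)"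
      unfolding inner by (rule nn_integral_cmult) auto
    finally show ?thesis unfolding ltn[OF s] using b by (simp add: ennreal_mult')
  qed
  \<comment> \<open>The convolution may be infinite on a null set. A finite transform at the single
    value 1 confines it to such a set, so passing to \<open>enn2real\<close> loses nothing under the
    integral.\<close>
  have kfin: "AE x in lborel. k x \<noteq> \<infinity>"
  proof -
    have "AE x in lborel. ennreal (exp (- 1 * x)) * k x \<noteq> \<infinity>"
      by (rule nn_integral_noteq_infinite) (auto simp: ltk[of 1, simplified])
    then show ?thesis by eventually_elim (auto simp: ennreal_mult_top)
  qed
  define g where "g x = (if 0 < x then enn2real (k x) / x else 0)" for x
  have [measurable]: "g \<in> borel_measurable borel" unfolding g_def by measurable
  have g0: "0 \<le> g x" for x by (auto simp: g_def)
  \<comment> \<open>Writing \<open>exp (- s * w)\<close> as an integral of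
    \<open>w * exp (- r * w)\<close> over \<open>r > s\<close> produces the factor \<open>w\<close>
    that cancels the division by \<open>x\<close> in \<open>g\<close>. What remains is the integral
    of an exact derivative.\<close>
  have ltg: "(\<integral>\<^sup>+ w. ennreal (exp (- s * w) * g w) \<partial>lborel) = ennreal (exp (- (s powr b)))" if s: "0 < s" for s
  proof -
    have "(\<integral>\<^sup>+ w. ennreal (exp (- s * w) * g w) \<partial>lborel) =
       (\<integral>\<^sup>+ w. (\<integral>\<^sup>+ r. ennreal (w * exp (- r * w)) * indicator {s<..} r * ennreal (g w) \<partial>lborel) \<partial>lborel)"
    proof (rule nn_integral_cong)
      fix w
      show "ennreal (exp (- s * w) * g w) =
        (\<integral>\<^sup>+ r. ennreal (w * exp (- r * w)) * indicator {s<..} r * ennreal (g w) \<partial>lborel)"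
      proof (cases "0 < w")
        case True
        then show ?thesis
          by (subst nn_integral_multc, measurable, subst nn_integral_exp_Ioi[OF True])
            (rule ennreal_mult''[OF g0])
      qed (simp add: g_def)
    qed
    also have "\<dots> = (\<integral>\<^sup>+ r. (\<integral>\<^sup>+ w. ennreal (w * exp (- r * w)) * indicator {s<..} r * ennreal (g w) \<partial>lborel) \<partial>lborel)"
      by (rule lborel_pair.Fubini') measurable
    also have "\<dots> = (\<integral>\<^sup>+ r. ennreal (b * r powr (b - 1) * exp (- (r powr b))) * indicator {s<..} r \<partial>lborel)"
    proof (rule nn_integral_cong)
      fix r
      show "(\<integral>\<^sup>+ w. ennreal (w * exp (- r * w)) * indicator {s<..} r * ennreal (g w) \<partial>lborel) =
          ennreal (b * r powr (b - 1) * exp (- (r powr b))) * indicator {s<..} r"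
      proof (cases "s < r")
        case True
        have "(\<integral>\<^sup>+ w. ennreal (w * exp (- r * w)) * indicator {s<..} r * ennreal (g w) \<partial>lborel) =
          (\<integral>\<^sup>+ w. ennreal (exp (- r * w)) * k w \<partial>lborel)"
        proof (rule nn_integral_cong_AE)
          show "AE w in lborel. ennreal (w * exp (- r * w)) * indicator {s<..} r * ennreal (g w) = ennreal (exp (- r * w)) * k w"
            using kfin
          proof eventually_elim
            case (elim w)
            show ?case
            proof (cases "0 < w")
              case w: True
              obtain q where q: "k w = ennreal q" "0 \<le> q" using elim by (cases "k w") auto
              show ?thesis using w q True by (simp add: g_def ennreal_mult'[symmetric] ennreal_mult''[symmetric])
            qed (use k0[of w] in \<open>simp add: g_def\<close>)
          qed
        qed
        then show ?thesis using ltk[of r] True s by simp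
      qed simp
    qed
    also have "\<dots> = (\<integral>\<^sup>+ r. ennreal (b * r powr (b - 1) * exp (- (r powr b))) * indicator {s..} r \<partial>lborel)"
      by (intro nn_integral_cong_AE) (use AE_lborel_singleton[of s] in \<open>auto simp: indicator_def\<close>)
    also have "\<dots> = ennreal (0 - (- exp (- (s powr b))))"
    proof (rule nn_integral_FTC_atLeast)
      show "((\<lambda>r. - exp (- (r powr b))) \<longlongrightarrow> 0) at_top" using b by real_asymp
      fix r assume "s \<le> r"
      then show "((\<lambda>r. - exp (- (r powr b))) has_real_derivative b * r powr (b - 1) * exp (- (r powr b))) (at r)"
        using s b by (auto intro!: derivative_eq_intros)
      show "0 \<le> b * r powr (b - 1) * exp (- (r powr b))" using b by simp
    qed measurable
    finally show ?thesis by simp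
  qed
  \<comment> \<open>The value at 0 is not covered by the computation for positive arguments;
    monotone convergence along \<open>1 / real (Suc n)\<close> supplies it.\<close>
  have ltg0: "(\<integral>\<^sup>+ w. ennreal (g w) \<partial>lborel) = 1"
  proof -
    have "(\<lambda>n. \<integral>\<^sup>+ w. ennreal (exp (- (1 / real (Suc n)) * w) * g w) \<partial>lborel) \<longlonglongrightarrow> (\<integral>\<^sup>+ w. ennreal (g w) \<partial>lborel)"
    proof (rule nn_integral_LIMSEQ)
      show "incseq (\<lambda>n w. ennreal (exp (- (1 / real (Suc n)) * w) * g w))"
      proof (intro incseq_SucI le_funI ennreal_leI)
        fix n w
        show "exp (- (1 / real (Suc n)) * w) * g w \<le> exp (- (1 / real (Suc (Suc n))) * w) * g w"
        proof (cases "0 < w")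
          case True
          then have "w / real (Suc (Suc n)) \<le> w / real (Suc n)" by (intro divide_left_mono) auto
          then show ?thesis by (intro mult_right_mono g0) simp
        qed (simp add: g_def)
      qed
      fix w
      have "(\<lambda>n. exp (- (1 / real (Suc n)) * w)) \<longlonglongrightarrow> 1" by real_asymp
      then have "(\<lambda>n. exp (- (1 / real (Suc n)) * w) * g w) \<longlonglongrightarrow> 1 * g w" by (intro tendsto_intros)
      then show "(\<lambda>n. ennreal (exp (- (1 / real (Suc n)) * w) * g w)) \<longlonglongrightarrow> ennreal (g w)" by simp
    qed measurable
    moreover have "(\<lambda>n. exp (- ((1 / real (Suc n)) powr b))) \<longlonglongrightarrow> 1" using b by real_asymp
    then have "(\<lambda>n. ennreal (exp (- ((1 / real (Suc n)) powr b)))) \<longlonglongrightarrow> ennreal 1" by (intro tendsto_ennrealI)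
    moreover have "(\<integral>\<^sup>+ w. ennreal (exp (- (1 / real (Suc n)) * w) * g w) \<partial>lborel) = ennreal (exp (- ((1 / real (Suc n)) powr b)))" for n
      by (rule ltg) auto
    ultimately show ?thesis using LIMSEQ_unique by fastforce
  qed
  show ?thesis
  proof (intro exI[of _ g] conjI allI impI)
    fix s :: real assume "0 \<le> s"
    then show "(\<integral>\<^sup>+ w. ennreal (exp (- s * w) * g w) \<partial>lborel) = ennreal (exp (- (s powr b)))"
      using ltg[of s] ltg0 b by (cases "s = 0") auto
  qed (auto simp: g0, auto simp: g_def)
qed

section \<open>Power substitutions and fractional powers as Laplace-type integrals\<close>

lemma nn_integral_exp_subst:
  fixes f :: "real \<Rightarrow> ennreal"
  assumes [measurable]: "f \<in> borel_measurable borel"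
  shows "(\<integral>\<^sup>+x\<in>{0<..}. f x \<partial>lborel) = (\<integral>\<^sup>+z. f (exp z) * ennreal (exp z) \<partial>lborel)"
proof -
  have step: "(\<integral>\<^sup>+x. f x * indicator {exp (- real (Suc n))..exp (real (Suc n))} x \<partial>lborel) =
     (\<integral>\<^sup>+z. f (exp z) * ennreal (exp z) * indicator {- real (Suc n)..real (Suc n)} z \<partial>lborel)" for n
    by (rule nn_integral_substitution_aux) (auto intro!: derivative_eq_intros continuous_intros)
  have "(\<lambda>n. \<integral>\<^sup>+x. f x * indicator {exp (- real (Suc n))..exp (real (Suc n))} x \<partial>lborel)
      \<longlonglongrightarrow> (\<integral>\<^sup>+x\<in>{0<..}. f x \<partial>lborel)"
  proof (rule nn_integral_LIMSEQ)
    show "incseq (\<lambda>n x. f x * indicator {exp (- real (Suc n))..exp (real (Suc n))} x)"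
    proof (intro incseq_SucI le_funI mult_left_mono)
      fix n x
      have "exp (- real (Suc (Suc n))) \<le> exp (- real (Suc n))" "exp (real (Suc n)) \<le> exp (real (Suc (Suc n)))" by simp_all
      then show "indicator {exp (- real (Suc n))..exp (real (Suc n))} x \<le>
          (indicator {exp (- real (Suc (Suc n)))..exp (real (Suc (Suc n)))} x :: ennreal)"
        unfolding indicator_def by (auto simp del: exp_le_cancel_iff)
    qed auto
    fix x :: real
    show "(\<lambda>n. f x * indicator {exp (- real (Suc n))..exp (real (Suc n))} x) \<longlonglongrightarrow> f x * indicator {0<..} x"
    proof (cases "0 < x")
      case True
      obtain N :: nat where N: "\<bar>ln x\<bar> \<le> real N" using real_arch_simple by blast
      have "\<forall>\<^sub>F n in sequentially. f x * indicator {exp (- real (Suc n))..exp (real (Suc n))} x = f x * indicator {0<..} x"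
        using eventually_ge_at_top[of N]
      proof eventually_elim
        case (elim n)
        then have "- real (Suc n) \<le> ln x" "ln x \<le> real (Suc n)" using N by auto
        then have "exp (- real (Suc n)) \<le> exp (ln x)" "exp (ln x) \<le> exp (real (Suc n))" by (simp_all only: exp_le_cancel_iff)
        then show ?case using True by (simp add: indicator_def)
      qed
      then show ?thesis by (rule tendsto_eventually)
    next
      case False
      then have "\<not> exp (- real (Suc n)) \<le> x" for n by (smt (verit) exp_gt_zero)
      then show ?thesis using False by (simp add: indicator_def)
    qed
  qed measurable
  moreover have "(\<lambda>n. \<integral>\<^sup>+z. f (exp z) * ennreal (exp z) * indicator {- real (Suc n)..real (Suc n)} z \<partial>lborel)
      \<longlonglongrightarrow> (\<integral>\<^sup>+z. f (exp z) * ennreal (exp z) \<partial>lborel)"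
  proof (rule nn_integral_LIMSEQ)
    show "incseq (\<lambda>n z. f (exp z) * ennreal (exp z) * indicator {- real (Suc n)..real (Suc n)} z)"
      by (intro incseq_SucI le_funI mult_left_mono) (auto simp: indicator_def)
    fix z :: real
    obtain N :: nat where N: "\<bar>z\<bar> \<le> real N" using real_arch_simple by blast
    have "\<forall>\<^sub>F n in sequentially. f (exp z) * ennreal (exp z) * indicator {- real (Suc n)..real (Suc n)} z = f (exp z) * ennreal (exp z)"
      using eventually_ge_at_top[of N]
      by eventually_elim (use N in \<open>auto simp: indicator_def\<close>)
    then show "(\<lambda>n. f (exp z) * ennreal (exp z) * indicator {- real (Suc n)..real (Suc n)} z) \<longlonglongrightarrow> f (exp z) * ennreal (exp z)"
      by (rule tendsto_eventually)
  qed measurable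
  ultimately show ?thesis unfolding step by (rule LIMSEQ_unique)
qed

text \<open>In the logarithmic coordinate \<open>x = exp z\<close> a power map becomes affine, so
  positive and negative exponents are handled by the same affine change of variables.\<close>

lemma nn_integral_powr_subst:
  fixes f :: "real \<Rightarrow> ennreal"
  assumes [measurable]: "f \<in> borel_measurable borel" and p: "p \<noteq> 0" and c: "0 < c"
  shows "(\<integral>\<^sup>+x\<in>{0<..}. f (c * x powr p) * ennreal (c * \<bar>p\<bar> * x powr (p - 1)) \<partial>lborel) = (\<integral>\<^sup>+x\<in>{0<..}. f x \<partial>lborel)"
proof -
  have "(\<integral>\<^sup>+x\<in>{0<..}. f (c * x powr p) * ennreal (c * \<bar>p\<bar> * x powr (p - 1)) \<partial>lborel) =
     (\<integral>\<^sup>+z. f (c * exp z powr p) * ennreal (c * \<bar>p\<bar> * exp z powr (p - 1)) * ennreal (exp z) \<partial>lborel)"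
    by (rule nn_integral_exp_subst) measurable
  also have "\<dots> = (\<integral>\<^sup>+z. ennreal \<bar>p\<bar> * (f (exp (ln c + p * z)) * ennreal (exp (ln c + p * z))) \<partial>lborel)"
  proof (rule nn_integral_cong)
    fix z
    have "c * exp z powr p = exp (ln c + p * z)" using c by (simp add: exp_add powr_def)
    moreover have "c * \<bar>p\<bar> * exp z powr (p - 1) * exp z = \<bar>p\<bar> * exp (ln c + p * z)"
      using c by (simp add: exp_add powr_def algebra_simps exp_diff)
    ultimately have eq: "ennreal (c * \<bar>p\<bar> * exp z powr (p - 1)) * ennreal (exp z) = ennreal \<bar>p\<bar> * ennreal (exp (ln c + p * z))"
      and eq2: "c * exp z powr p = exp (ln c + p * z)"
      by (simp_all only: ennreal_mult''[symmetric] exp_ge_zero)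
    show "f (c * exp z powr p) * ennreal (c * \<bar>p\<bar> * exp z powr (p - 1)) * ennreal (exp z) =
       ennreal \<bar>p\<bar> * (f (exp (ln c + p * z)) * ennreal (exp (ln c + p * z)))"
      unfolding eq2 by (subst mult.assoc, subst eq) (rule mult.left_commute)
  qed
  also have "\<dots> = ennreal \<bar>p\<bar> * (\<integral>\<^sup>+z. f (exp (ln c + p * z)) * ennreal (exp (ln c + p * z)) \<partial>lborel)"
    by (rule nn_integral_cmult) measurable
  also have "\<dots> = (\<integral>\<^sup>+z. f (exp z) * ennreal (exp z) \<partial>lborel)"
    by (rule nn_integral_real_affine[symmetric]) (use p in auto)
  also have "\<dots> = (\<integral>\<^sup>+x\<in>{0<..}. f x \<partial>lborel)"
    by (rule nn_integral_exp_subst[symmetric]) measurable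
  finally show ?thesis .
qed

text \<open>Represents a positive fractional power as a mixture of functions
  \<open>1 - exp (- s * w)\<close>. Expanding this difference as an integral of
  \<open>w * exp (- v * w)\<close> over \<open>[0, s]\<close> and exchanging the order leaves a
  Gamma integral.\<close>

lemma nn_integral_one_minus_exp_powr:
  fixes r w :: real
  assumes r: "0 < r" "r < 1" and w: "0 < w"
  shows "(\<integral>\<^sup>+s\<in>{0<..}. ennreal ((1 - exp (- s * w)) * s powr (- r - 1)) \<partial>lborel) = ennreal (Gamma (1 - r) / r * w powr r)"
proof -
  have "(\<integral>\<^sup>+s\<in>{0<..}. ennreal ((1 - exp (- s * w)) * s powr (- r - 1)) \<partial>lborel) =
      (\<integral>\<^sup>+s. (\<integral>\<^sup>+v. ennreal (w * exp (- v * w)) * indicator {0<..} v * (ennreal (s powr (- r - 1)) * indicator {0..} (s - v)) \<partial>lborel) \<partial>lborel)"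
  proof (rule nn_integral_cong)
    fix s :: real
    show "ennreal ((1 - exp (- s * w)) * s powr (- r - 1)) * indicator {0<..} s =
      (\<integral>\<^sup>+v. ennreal (w * exp (- v * w)) * indicator {0<..} v * (ennreal (s powr (- r - 1)) * indicator {0..} (s - v)) \<partial>lborel)"
    proof (cases "0 < s")
      case True
      have "(\<integral>\<^sup>+v. ennreal (w * exp (- v * w)) * indicator {0..s} v \<partial>lborel) = ennreal ((- exp (- s * w)) - (- exp (- 0 * w)))"
        using w True by (intro nn_integral_FTC_Icc) (auto intro!: derivative_eq_intros)
      also have "(\<integral>\<^sup>+v. ennreal (w * exp (- v * w)) * indicator {0..s} v \<partial>lborel) =
        (\<integral>\<^sup>+v. ennreal (w * exp (- v * w)) * indicator {0<..s} v \<partial>lborel)"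
        by (intro nn_integral_cong_AE) (use AE_lborel_singleton[of 0] in \<open>auto simp: indicator_def\<close>)
      finally have eq: "(\<integral>\<^sup>+v. ennreal (w * exp (- v * w)) * indicator {0<..s} v \<partial>lborel) = ennreal (1 - exp (- s * w))" by simp
      have "(\<integral>\<^sup>+v. ennreal (w * exp (- v * w)) * indicator {0<..} v * (ennreal (s powr (- r - 1)) * indicator {0..} (s - v)) \<partial>lborel) =
         (\<integral>\<^sup>+v. (ennreal (w * exp (- v * w)) * indicator {0<..s} v) * ennreal (s powr (- r - 1)) \<partial>lborel)"
        by (intro nn_integral_cong) (auto simp: indicator_def)
      also have "\<dots> = ennreal (1 - exp (- s * w)) * ennreal (s powr (- r - 1))"
        by (subst nn_integral_multc, measurable, subst eq) simp
      finally show ?thesis using True by (simp add: ennreal_mult'')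
    next
      case False
      then have z: "indicator {0<..} v * (ennreal (s powr (- r - 1)) * indicator {0..} (s - v)) = 0" for v :: real by (auto simp: indicator_def)
      have "(\<integral>\<^sup>+v. ennreal (w * exp (- v * w)) * indicator {0<..} v * (ennreal (s powr (- r - 1)) * indicator {0..} (s - v)) \<partial>lborel) = (\<integral>\<^sup>+v. 0 \<partial>(lborel :: real measure))"
        by (intro nn_integral_cong) (simp only: mult.assoc mult_zero_right z)
      with False show ?thesis by simp
    qed
  qed
  also have "\<dots> = (\<integral>\<^sup>+v. (\<integral>\<^sup>+s. ennreal (w * exp (- v * w)) * indicator {0<..} v * (ennreal (s powr (- r - 1)) * indicator {0..} (s - v)) \<partial>lborel) \<partial>lborel)"
    by (rule lborel_pair.Fubini') measurable
  also have "\<dots> = (\<integral>\<^sup>+v. ennreal (w / r) * (ennreal (v powr ((1 - r) - 1) * exp (- w * v)) * indicator {0<..} v) \<partial>lborel)"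
  proof (rule nn_integral_cong)
    fix v :: real
    show "(\<integral>\<^sup>+s. ennreal (w * exp (- v * w)) * indicator {0<..} v * (ennreal (s powr (- r - 1)) * indicator {0..} (s - v)) \<partial>lborel) =
      ennreal (w / r) * (ennreal (v powr ((1 - r) - 1) * exp (- w * v)) * indicator {0<..} v)"
    proof (cases "0 < v")
      case True
      have "(\<integral>\<^sup>+s. ennreal (s powr (- r - 1)) * indicator {v..} s \<partial>lborel) = ennreal (0 - (- (v powr (- r) / r)))"
      proof (rule nn_integral_FTC_atLeast)
        show "((\<lambda>s. - (s powr (- r) / r)) \<longlongrightarrow> 0) at_top" using r by real_asymp
        fix s assume "v \<le> s"
        then show "((\<lambda>s. - (s powr (- r) / r)) has_real_derivative s powr (- r - 1)) (at s)"
          using r True by (auto intro!: derivative_eq_intros simp: algebra_simps)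
      qed auto
      then have tail: "(\<integral>\<^sup>+s. ennreal (s powr (- r - 1)) * indicator {0..} (s - v) \<partial>lborel) = ennreal (v powr (- r) / r)"
        by (simp add: indicator_def)
      have "(\<integral>\<^sup>+s. ennreal (w * exp (- v * w)) * indicator {0<..} v * (ennreal (s powr (- r - 1)) * indicator {0..} (s - v)) \<partial>lborel)
         = ennreal (w * exp (- v * w)) * ennreal (v powr (- r) / r)"
        using True by (subst nn_integral_cmult, measurable, subst tail) simp
      also have "\<dots> = ennreal (w * exp (- v * w) * (v powr (- r) / r))"
        using w r by (subst ennreal_mult[symmetric]) auto
      also have "\<dots> = ennreal ((w / r) * (v powr ((1 - r) - 1) * exp (- w * v)))"
        by (simp add: mult_ac)
      also have "\<dots> = ennreal (w / r) * ennreal (v powr ((1 - r) - 1) * exp (- w * v))"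
        using w r by (subst ennreal_mult[symmetric]) auto
      finally show ?thesis using True by simp
    qed simp
  qed
  also have "\<dots> = ennreal (w / r) * ennreal (Gamma (1 - r) * w powr (- (1 - r)))"
    using r w by (subst nn_integral_cmult, measurable, subst nn_integral_powr_exp) auto
  also have "\<dots> = ennreal (Gamma (1 - r) / r * w powr r)"
    using r w Gamma_real_pos[of "1 - r"]
    by (subst ennreal_mult[symmetric]) (auto simp: powr_mult_base)
  finally show ?thesis .
qed

subsection \<open>Moments of the stable law\<close>

locale stable_index =
  fixes b :: real
  assumes b0: "0 < b" and b1: "b < 1"
begin

abbreviation "g \<equiv> stable_density b"

text \<open>The existence of a suitable density discharges the Hilbert choice; everything later
  relies on these properties of the chosen function.\<close>

lemma stable_density_spec:
  "g \<in> borel_measurable borel \<and> (\<forall>w. 0 \<le> g w) \<and> (\<forall>w\<le>0. g w = 0) \<and>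
     (\<forall>s\<ge>0. (\<integral>\<^sup>+ w. ennreal (exp (- s * w) * g w) \<partial>lborel) = ennreal (exp (- (s powr b))))"
  unfolding stable_density_def by (rule someI_ex[OF exists_stable_density[OF b0 b1]])

lemma g_measurable [measurable]: "g \<in> borel_measurable borel"
  and g_nonneg: "0 \<le> g w"
  and g_zero: "w \<le> 0 \<Longrightarrow> g w = 0"
  and laplace_g: "0 \<le> s \<Longrightarrow> (\<integral>\<^sup>+ w. ennreal (exp (- s * w) * g w) \<partial>lborel) = ennreal (exp (- (s powr b)))"
  using stable_density_spec by auto

lemma nn_integral_g: "(\<integral>\<^sup>+ w. ennreal (g w) \<partial>lborel) = 1"
  using laplace_g[of 0] b0 by simp

text \<open>A negative power is a Gamma mixture of exponentials, so Tonelli reduces the moment to an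
  integral of the Laplace transform, which \<open>u = s powr b\<close> turns into another Gamma
  integral.\<close>

lemma negative_moment:
  assumes r: "0 < r"
  shows "(\<integral>\<^sup>+ w. ennreal (w powr (- r) * g w) \<partial>lborel) = ennreal (Gamma (r / b) / (b * Gamma r))"
proof -
  have "ennreal (Gamma r) * (\<integral>\<^sup>+ w. ennreal (w powr (- r) * g w) \<partial>lborel)
      = (\<integral>\<^sup>+ w. ennreal (Gamma r) * ennreal (w powr (- r) * g w) \<partial>lborel)"
    by (rule nn_integral_cmult[symmetric]) measurable
  also have "\<dots> = (\<integral>\<^sup>+ w. (\<integral>\<^sup>+s. ennreal (s powr (r - 1) * exp (- w * s)) * indicator {0<..} s * ennreal (g w) \<partial>lborel) \<partial>lborel)"
  proof (rule nn_integral_cong)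
    fix w
    show "ennreal (Gamma r) * ennreal (w powr (- r) * g w) =
      (\<integral>\<^sup>+s. ennreal (s powr (r - 1) * exp (- w * s)) * indicator {0<..} s * ennreal (g w) \<partial>lborel)"
    proof (cases "0 < w")
      case True
      have "ennreal (Gamma r) * ennreal (w powr (- r) * g w) = ennreal (Gamma r * w powr (- r)) * ennreal (g w)"
        using Gamma_real_pos[OF r]
        by (subst ennreal_mult'[symmetric], simp, subst ennreal_mult''[symmetric, OF g_nonneg]) (simp add: mult.assoc)
      then show ?thesis
        using r True by (subst nn_integral_multc, measurable, subst nn_integral_powr_exp) auto
    qed (simp add: g_zero)
  qed
  also have "\<dots> = (\<integral>\<^sup>+ s. (\<integral>\<^sup>+w. ennreal (s powr (r - 1) * exp (- w * s)) * indicator {0<..} s * ennreal (g w) \<partial>lborel) \<partial>lborel)"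
    by (rule lborel_pair.Fubini') measurable
  also have "\<dots> = (\<integral>\<^sup>+ s\<in>{0<..}. ennreal (s powr (r - 1) * exp (- (s powr b))) \<partial>lborel)"
  proof (rule nn_integral_cong)
    fix s :: real
    show "(\<integral>\<^sup>+w. ennreal (s powr (r - 1) * exp (- w * s)) * indicator {0<..} s * ennreal (g w) \<partial>lborel) =
      ennreal (s powr (r - 1) * exp (- (s powr b))) * indicator {0<..} s"
    proof (cases "0 < s")
      case True
      have "(\<integral>\<^sup>+w. ennreal (s powr (r - 1) * exp (- w * s)) * indicator {0<..} s * ennreal (g w) \<partial>lborel) =
        (\<integral>\<^sup>+w. ennreal (s powr (r - 1)) * ennreal (exp (- s * w) * g w) \<partial>lborel)"
        using True by (intro nn_integral_cong) (simp add: ennreal_mult''[symmetric] ennreal_mult'[symmetric] g_nonneg mult_ac)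
      also have "\<dots> = ennreal (s powr (r - 1)) * ennreal (exp (- (s powr b)))"
        using True by (subst nn_integral_cmult, measurable, subst laplace_g) auto
      finally show ?thesis using True by (simp add: ennreal_mult')
    qed simp
  qed
  also have "\<dots> = (\<integral>\<^sup>+ s\<in>{0<..}. ennreal ((1 / b) * ((1 * s powr b) powr (r / b - 1) * exp (- (1 * s powr b)))) *
       ennreal (1 * \<bar>b\<bar> * s powr (b - 1)) \<partial>lborel)"
    using b0
    by (intro nn_integral_cong)
      (auto simp: indicator_def ennreal_mult''[symmetric] powr_powr powr_add[symmetric] field_simps)
  also have "\<dots> = (\<integral>\<^sup>+ u\<in>{0<..}. ennreal ((1 / b) * (u powr (r / b - 1) * exp (- u))) \<partial>lborel)"
    using b0 by (intro nn_integral_powr_subst) auto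
  also have "\<dots> = (\<integral>\<^sup>+ u. ennreal (1 / b) * (ennreal (u powr (r / b - 1) * exp (- 1 * u)) * indicator {0<..} u) \<partial>lborel)"
    using b0 by (intro nn_integral_cong) (simp add: ennreal_mult'[symmetric] indicator_def)
  also have "\<dots> = ennreal (1 / b) * ennreal (Gamma (r / b) * 1 powr (- (r / b)))"
    using r b0 by (subst nn_integral_cmult, measurable, subst nn_integral_powr_exp) auto
  also have "\<dots> = ennreal (Gamma r) * ennreal (Gamma (r / b) / (b * Gamma r))"
    using b0 less_imp_neq[OF Gamma_real_pos[OF r]] Gamma_real_pos[OF r]
    by (subst (1 2) ennreal_mult'[symmetric]) auto
  finally show ?thesis
    using Gamma_real_pos[OF r] by (subst (asm) ennreal_mult_cancel_left) auto
qed

text \<open>A positive power is not a mixture of decaying exponentials, hence the use of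
  \<open>1 - exp (- s * w)\<close>. The condition \<open>r < b\<close> is the integrability of
  \<open>(1 - exp (- (s powr b))) * s powr (- r - 1)\<close> at 0.\<close>

lemma positive_moment:
  assumes r: "0 < r" "r < b"
  shows "(\<integral>\<^sup>+ w. ennreal (w powr r * g w) \<partial>lborel) = ennreal (Gamma (1 - r / b) / Gamma (1 - r))"
proof -
  have r1: "r < 1" using r b1 by simp
  have G: "0 < Gamma (1 - r)" using r1 by (simp add: Gamma_real_pos)
  have "ennreal (Gamma (1 - r) / r) * (\<integral>\<^sup>+ w. ennreal (w powr r * g w) \<partial>lborel)
      = (\<integral>\<^sup>+ w. ennreal (Gamma (1 - r) / r) * ennreal (w powr r * g w) \<partial>lborel)"
    by (rule nn_integral_cmult[symmetric]) measurable
  also have "\<dots> = (\<integral>\<^sup>+ w. (\<integral>\<^sup>+s. ennreal ((1 - exp (- s * w)) * s powr (- r - 1)) * indicator {0<..} s * ennreal (g w) \<partial>lborel) \<partial>lborel)"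
  proof (rule nn_integral_cong)
    fix w
    show "ennreal (Gamma (1 - r) / r) * ennreal (w powr r * g w) =
      (\<integral>\<^sup>+s. ennreal ((1 - exp (- s * w)) * s powr (- r - 1)) * indicator {0<..} s * ennreal (g w) \<partial>lborel)"
    proof (cases "0 < w")
      case True
      have "ennreal (Gamma (1 - r) / r) * ennreal (w powr r * g w) = ennreal (Gamma (1 - r) / r * w powr r) * ennreal (g w)"
        using r G
        by (subst ennreal_mult'[symmetric], simp, subst ennreal_mult''[symmetric, OF g_nonneg]) (simp add: mult.assoc)
      then show ?thesis
        using r r1 True by (subst nn_integral_multc, measurable, subst nn_integral_one_minus_exp_powr) auto
    qed (simp add: g_zero)
  qed
  also have "\<dots> = (\<integral>\<^sup>+ s. (\<integral>\<^sup>+w. ennreal ((1 - exp (- s * w)) * s powr (- r - 1)) * indicator {0<..} s * ennreal (g w) \<partial>lborel) \<partial>lborel)"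
    by (rule lborel_pair.Fubini') measurable
  also have "\<dots> = (\<integral>\<^sup>+ s\<in>{0<..}. ennreal ((1 - exp (- (s powr b))) * s powr (- r - 1)) \<partial>lborel)"
  proof (rule nn_integral_cong)
    fix s :: real
    show "(\<integral>\<^sup>+w. ennreal ((1 - exp (- s * w)) * s powr (- r - 1)) * indicator {0<..} s * ennreal (g w) \<partial>lborel) =
      ennreal ((1 - exp (- (s powr b))) * s powr (- r - 1)) * indicator {0<..} s"
    proof (cases "0 < s")
      case True
      have "(\<integral>\<^sup>+w. ennreal ((1 - exp (- s * w)) * s powr (- r - 1)) * indicator {0<..} s * ennreal (g w) \<partial>lborel) =
        (\<integral>\<^sup>+w. ennreal (s powr (- r - 1)) * (ennreal (g w) - ennreal (exp (- s * w) * g w)) \<partial>lborel)"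
      proof (rule nn_integral_cong)
        fix w
        have "ennreal (g w) - ennreal (exp (- s * w) * g w) = ennreal ((1 - exp (- s * w)) * g w)"
          by (subst ennreal_minus) (auto simp: g_nonneg algebra_simps)
        then show "ennreal ((1 - exp (- s * w)) * s powr (- r - 1)) * indicator {0<..} s * ennreal (g w) =
            ennreal (s powr (- r - 1)) * (ennreal (g w) - ennreal (exp (- s * w) * g w))"
          using True by (simp add: ennreal_mult''[symmetric] ennreal_mult'[symmetric] g_nonneg mult_ac)
      qed
      also have "\<dots> = ennreal (s powr (- r - 1)) * (\<integral>\<^sup>+w. ennreal (g w) - ennreal (exp (- s * w) * g w) \<partial>lborel)"
        by (rule nn_integral_cmult) measurable
      also have "(\<integral>\<^sup>+w. ennreal (g w) - ennreal (exp (- s * w) * g w) \<partial>lborel) =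
          (\<integral>\<^sup>+w. ennreal (g w) \<partial>lborel) - (\<integral>\<^sup>+w. ennreal (exp (- s * w) * g w) \<partial>lborel)"
      proof (rule nn_integral_diff)
        show "(\<integral>\<^sup>+w. ennreal (exp (- s * w) * g w) \<partial>lborel) \<noteq> \<infinity>"
          using True by (subst laplace_g) auto
        show "AE w in lborel. ennreal (exp (- s * w) * g w) \<le> ennreal (g w)"
        proof (intro AE_I2 ennreal_leI)
          fix w show "exp (- s * w) * g w \<le> g w"
            using True g_nonneg[of w] by (cases "0 < w") (auto simp: g_zero intro!: mult_left_le_one_le)
        qed
      qed measurable
      also have "\<dots> = ennreal (1 - exp (- (s powr b)))"
        unfolding nn_integral_g laplace_g[OF less_imp_le[OF True]]
        by (metis ennreal_1 ennreal_minus exp_ge_zero)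
      finally show ?thesis using True by (simp add: ennreal_mult'' mult_ac)
    qed simp
  qed
  also have "\<dots> = (\<integral>\<^sup>+ s\<in>{0<..}. ennreal ((1 / b) * ((1 - exp (- (1 * s powr b) * 1)) * (1 * s powr b) powr (- (r / b) - 1))) *
       ennreal (1 * \<bar>b\<bar> * s powr (b - 1)) \<partial>lborel)"
    using b0
    by (intro nn_integral_cong)
      (auto simp: indicator_def ennreal_mult''[symmetric] powr_powr powr_add[symmetric] field_simps)
  also have "\<dots> = (\<integral>\<^sup>+ u\<in>{0<..}. ennreal ((1 / b) * ((1 - exp (- u * 1)) * u powr (- (r / b) - 1))) \<partial>lborel)"
    using b0 by (intro nn_integral_powr_subst) auto
  also have "\<dots> = (\<integral>\<^sup>+ u. ennreal (1 / b) * (ennreal ((1 - exp (- u * 1)) * u powr (- (r / b) - 1)) * indicator {0<..} u) \<partial>lborel)"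
    using b0 by (intro nn_integral_cong) (simp add: ennreal_mult'[symmetric] indicator_def)
  also have "\<dots> = ennreal (1 / b) * ennreal (Gamma (1 - r / b) / (r / b) * 1 powr (r / b))"
    using r b0 by (subst nn_integral_cmult, measurable, subst nn_integral_one_minus_exp_powr) auto
  also have "\<dots> = ennreal (1 / b * (Gamma (1 - r / b) / (r / b) * 1 powr (r / b)))"
    using b0 by (intro ennreal_mult'[symmetric]) auto
  also have "1 / b * (Gamma (1 - r / b) / (r / b) * 1 powr (r / b)) = Gamma (1 - r) / r * (Gamma (1 - r / b) / Gamma (1 - r))"
    using b0 r G by simp
  also have "ennreal \<dots> = ennreal (Gamma (1 - r) / r) * ennreal (Gamma (1 - r / b) / Gamma (1 - r))"
    using r G by (intro ennreal_mult') auto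
  finally show ?thesis
    using G r by (subst (asm) ennreal_mult_cancel_left) auto
qed

text \<open>The moments of \<open>w powr (- b)\<close>, which has the Mittag-Leffler law of the
  inverse subordinator at time 1. Parametrizing by \<open>k\<close> merges negative, zero and
  positive order into one formula, as needed for a series whose first exponent is negative.\<close>

lemma moment:
  assumes k: "- 1 < k"
  shows "(\<integral>\<^sup>+ w. ennreal (w powr (- (b * k)) * g w) \<partial>lborel) = ennreal (Gamma (1 + k) / Gamma (1 + b * k))"
proof -
  consider "0 < k" | "k = 0" | "k < 0" by linarith
  then show ?thesis
  proof cases
    case 1
    then have "0 < b * k" using b0 by simp
    with 1 have "b * k \<notin> \<int>\<^sub>\<le>\<^sub>0" "k \<notin> \<int>\<^sub>\<le>\<^sub>0" by (auto dest: nonpos_Ints_nonpos)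
    then have "Gamma (k + 1) = k * Gamma k" "Gamma (b * k + 1) = b * k * Gamma (b * k)"
      by (auto intro!: Gamma_plus1)
    then have "Gamma (1 + k) / Gamma (1 + b * k) = Gamma (b * k / b) / (b * Gamma (b * k))"
      using 1 b0 by (simp add: add.commute)
    then show ?thesis using 1 b0 negative_moment[of "b * k"] by simp
  next
    case 2
    have "(\<integral>\<^sup>+ w. ennreal (w powr 0 * g w) \<partial>lborel) = (\<integral>\<^sup>+ w. ennreal (g w) \<partial>lborel)"
      by (intro nn_integral_cong) (auto simp: g_zero)
    with 2 show ?thesis by (simp add: nn_integral_g)
  next
    case 3
    have "b * (- k) < b * 1" using k b0 by (intro mult_strict_left_mono) auto
    with 3 have "0 < - (b * k)" "- (b * k) < b" using b0 by (auto simp: mult_pos_neg)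
    then show ?thesis using b0 positive_moment[of "- (b * k)"] by simp
  qed
qed

end

subsection \<open>Inequalities for the Gamma function\<close>

lemma Gamma_legendre_duplication_real:
  fixes x :: real
  assumes x: "- 1/2 < x"
  shows "Gamma (x + 1/2) * Gamma (x + 1) = 2 powr (- 2 * x) * sqrt pi * Gamma (2 * x + 1)"
proof -
  let ?z = "complex_of_real (x + 1/2)"
  have "?z \<notin> \<int>\<^sub>\<le>\<^sub>0" "?z + 1/2 \<notin> \<int>\<^sub>\<le>\<^sub>0"
    using x by (auto elim!: nonpos_Ints_cases simp: complex_eq_iff)
  then have "Gamma ?z * Gamma (?z + 1/2) = exp ((1 - 2 * ?z) * of_real (ln 2)) * of_real (sqrt pi) * Gamma (2 * ?z)"
    by (rule Gamma_legendre_duplication)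
  also have "?z + 1/2 = complex_of_real (x + 1)" by simp
  also have "2 * ?z = complex_of_real (2 * x + 1)" by simp
  also have "(1 - complex_of_real (2 * x + 1)) * of_real (ln 2) = complex_of_real ((- 2 * x) * ln 2)" by simp
  finally have "complex_of_real (Gamma (x + 1/2) * Gamma (x + 1)) =
      complex_of_real (exp ((- 2 * x) * ln 2) * sqrt pi * Gamma (2 * x + 1))"
    by (simp only: Gamma_complex_of_real of_real_mult exp_of_real[symmetric])
  then show ?thesis by (simp only: of_real_eq_iff) (simp add: powr_def)
qed

text \<open>Legendre duplication rewrites the quotient as
  \<open>4 powr z / pi * Beta (z + 1/2) (1/2)\<close>, and the Beta function decreases in its first
  argument.\<close>

lemma Gamma_double_ratio_mono:
  fixes x y :: real
  assumes x: "- 1/2 < x" and y: "x \<le> y"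
  shows "Gamma (2 * y + 1) / (Gamma (y + 1))\<^sup>2 \<le> 4 powr (y - x) * (Gamma (2 * x + 1) / (Gamma (x + 1))\<^sup>2)"
proof -
  have eq: "Gamma (2 * z + 1) / (Gamma (z + 1))\<^sup>2 = 4 powr z / pi * Beta (z + 1/2) (1/2)" if z: "- 1/2 < z" for z :: real
  proof -
    have G: "Gamma (z + 1) \<noteq> 0" using z less_imp_neq[OF Gamma_real_pos[of "z + 1"]] by simp
    have "4 powr z = (2 powr 2) powr z" by simp
    also have "\<dots> = 2 powr (2 * z)" by (simp only: powr_powr)
    finally have 4: "4 powr z = 2 powr (2 * z)" .
    have K: "2 powr (2 * z) * (Gamma (z + 1/2) * Gamma (z + 1)) = sqrt pi * Gamma (2 * z + 1)"
      unfolding Gamma_legendre_duplication_real[OF z] by (simp add: powr_minus)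
    have r1: "c = p * q * r / s" if "p * (q * r) = s * c" "s \<noteq> 0" for p q r s c :: real
      using that by (simp add: field_simps)
    have 1: "Gamma (2 * z + 1) = 4 powr z * Gamma (z + 1/2) * Gamma (z + 1) / sqrt pi"
      unfolding 4 by (rule r1[OF K]) simp
    have 2: "Beta (z + 1/2) (1/2) = Gamma (z + 1/2) * sqrt pi / Gamma (z + 1)"
    proof -
      have "z + 1/2 + 1/2 = z + 1" by simp
      then show ?thesis by (simp only: Beta_def Gamma_one_half_real)
    qed
    have "4 powr z / pi * Beta (z + 1/2) (1/2) = 4 powr z / (sqrt pi * sqrt pi) * (Gamma (z + 1/2) * sqrt pi / Gamma (z + 1))"
      unfolding 2 by simp
    also have "\<dots> = 4 powr z * Gamma (z + 1/2) / sqrt pi / Gamma (z + 1)"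
    proof -
      have r2: "p / (s * s) * (q * s / r) = p * q / s / r" if "s \<noteq> 0" for p q r s :: real
        using that by simp
      show ?thesis by (rule r2) simp
    qed
    also have "\<dots> = Gamma (2 * z + 1) / (Gamma (z + 1))\<^sup>2"
      unfolding 1 using G by (simp add: power2_eq_square)
    finally show ?thesis by simp
  qed
  have "Beta (y + 1/2) (1/2) \<le> Beta (x + 1/2) (1/2 :: real)"
    using x y by (intro Beta_real_mono) auto
  then have "4 powr y / pi * Beta (y + 1/2) (1/2) \<le> 4 powr y / pi * Beta (x + 1/2) (1/2)"
    by (intro mult_left_mono) auto
  moreover have "4 powr y = 4 powr (y - x) * (4::real) powr x" by (simp add: powr_add[symmetric])
  ultimately show ?thesis using x y by (simp add: eq mult.assoc)
qed

text \<open>Raising \<open>k\<close> by one multiplies the quotient by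
  \<open>(1 + k - \<delta>) / (1 + k) \<le> 1\<close>, so its largest value is the one at
  \<open>k = 0\<close>.\<close>

lemma Gamma_shift_over_fact_le:
  fixes \<delta> :: real
  assumes d: "0 \<le> \<delta>" "\<delta> < 1"
  shows "0 < Gamma (1 + (real k - \<delta>)) \<and> Gamma (1 + (real k - \<delta>)) / fact k \<le> Gamma (1 - \<delta>)"
proof (induction k)
  case 0
  then show ?case using d by (simp add: Gamma_real_pos)
next
  case (Suc k)
  have pos: "0 < 1 + (real k - \<delta>)" using d by simp
  then have "1 + (real k - \<delta>) \<notin> \<int>\<^sub>\<le>\<^sub>0" by (auto dest: nonpos_Ints_nonpos)
  then have G: "Gamma (1 + (real (Suc k) - \<delta>)) = (1 + (real k - \<delta>)) * Gamma (1 + (real k - \<delta>))"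
    using Gamma_plus1[of "1 + (real k - \<delta>)"] by (simp add: algebra_simps)
  have "Gamma (1 + (real (Suc k) - \<delta>)) / fact (Suc k) =
      ((1 + (real k - \<delta>)) / (1 + real k)) * (Gamma (1 + (real k - \<delta>)) / fact k)"
    unfolding G by (simp add: field_simps)
  also have "\<dots> \<le> 1 * (Gamma (1 + (real k - \<delta>)) / fact k)"
    using d Suc pos by (intro mult_right_mono) (auto simp: field_simps less_imp_le)
  finally show ?case using Suc pos unfolding G by simp
qed

text \<open>Cauchy-Schwarz after splitting off \<open>sqrt (r ^ k)\<close>. It is applied to partial
  sums, which are finite, and the bound then passes to the extended-valued series.\<close>

lemma suminf_square_le_weighted:
  fixes x :: "nat \<Rightarrow> real"
  assumes x: "\<And>k. 0 \<le> x k" and r: "0 < r" "r < 1"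
  shows "(\<Sum>k. ennreal (x k))\<^sup>2 \<le> ennreal (1 / (1 - r)) * (\<Sum>k. ennreal ((x k)\<^sup>2 / r ^ k))"
proof (cases "(\<Sum>k. ennreal ((x k)\<^sup>2 / r ^ k)) = \<infinity>")
  case True
  then show ?thesis using r by (simp add: ennreal_mult_top)
next
  case False
  then obtain S where S: "(\<Sum>k. ennreal ((x k)\<^sup>2 / r ^ k)) = ennreal S" "0 \<le> S"
    by (cases "(\<Sum>k. ennreal ((x k)\<^sup>2 / r ^ k))") auto
  have part: "(\<Sum>k<n. x k) \<le> sqrt (S / (1 - r))" for n
  proof -
    have "(\<Sum>k<n. (x k)\<^sup>2 / r ^ k) \<le> S"
    proof -
      have "ennreal (\<Sum>k<n. (x k)\<^sup>2 / r ^ k) = (\<Sum>k<n. ennreal ((x k)\<^sup>2 / r ^ k))"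
        using r by (intro sum_ennreal[symmetric]) auto
      also have "\<dots> \<le> ennreal S"
        unfolding S(1)[symmetric] by (rule sum_le_suminf) auto
      finally show ?thesis using S by (simp add: ennreal_le_iff)
    qed
    moreover have "(\<Sum>k<n. r ^ k) \<le> 1 / (1 - r)"
      using r sum_le_suminf[of "\<lambda>k. r ^ k" "{..<n}"] by (simp add: suminf_geometric summable_geometric)
    moreover have "(\<Sum>k<n. x k)\<^sup>2 \<le> (\<Sum>k<n. r ^ k) * (\<Sum>k<n. (x k)\<^sup>2 / r ^ k)"
    proof -
      have "x k = sqrt (r ^ k) * (x k / sqrt (r ^ k))" for k using r by simp
      then have "(\<Sum>k<n. x k)\<^sup>2 = (\<Sum>k<n. sqrt (r ^ k) * (x k / sqrt (r ^ k)))\<^sup>2" by simp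
      also have "\<dots> \<le> (\<Sum>k<n. (sqrt (r ^ k))\<^sup>2) * (\<Sum>k<n. (x k / sqrt (r ^ k))\<^sup>2)"
        by (rule Cauchy_Schwarz_ineq_sum)
      finally show ?thesis using r by (simp add: power_divide real_sqrt_pow2)
    qed
    ultimately have "(\<Sum>k<n. x k)\<^sup>2 \<le> 1 / (1 - r) * S"
      using r S by (smt (verit) mult_mono sum_nonneg zero_le_power zero_le_power2 divide_nonneg_nonneg)
    then show ?thesis by (intro real_le_rsqrt) simp
  qed
  have "(\<Sum>k. ennreal (x k)) \<le> ennreal (sqrt (S / (1 - r)))"
  proof (rule suminf_le_const)
    fix n show "(\<Sum>k<n. ennreal (x k)) \<le> ennreal (sqrt (S / (1 - r)))"
      using part[of n] x by (simp add: sum_ennreal ennreal_leI)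
  qed auto
  then have "(\<Sum>k. ennreal (x k))\<^sup>2 \<le> (ennreal (sqrt (S / (1 - r))))\<^sup>2"
    by (intro power_mono) auto
  also have "\<dots> = ennreal (1 / (1 - r)) * ennreal S"
    using r S by (simp add: ennreal_power ennreal_mult'[symmetric] real_sqrt_pow2)
  finally show ?thesis using S by simp
qed

subsection \<open>Gaussian integrals\<close>

lemma nn_integral_gaussian_1d:
  fixes A c :: real
  assumes A: "0 < A"
  shows "(\<integral>\<^sup>+y. ennreal (exp (- A * y\<^sup>2 + c * y)) \<partial>lborel) = ennreal (sqrt (pi / A) * exp (c\<^sup>2 / (4 * A)))"
proof -
  let ?\<sigma> = "sqrt (1 / (2 * A))" and ?\<mu> = "c / (2 * A)"
  have "exp (- A * y\<^sup>2 + c * y) = sqrt (pi / A) * exp (c\<^sup>2 / (4 * A)) * normal_density ?\<mu> ?\<sigma> y" for y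
  proof -
    have 1: "normal_density ?\<mu> ?\<sigma> y = 1 / sqrt (pi / A) * exp (- (A * (y - ?\<mu>)\<^sup>2))"
      using A by (simp add: normal_density_def field_simps)
    have 2: "- A * y\<^sup>2 + c * y = c\<^sup>2 / (4 * A) + - (A * (y - ?\<mu>)\<^sup>2)"
      using A by (simp add: power2_eq_square field_simps)
    show ?thesis unfolding 1 2 exp_add using A by simp
  qed
  then have "(\<integral>\<^sup>+y. ennreal (exp (- A * y\<^sup>2 + c * y)) \<partial>lborel) =
      (\<integral>\<^sup>+y. ennreal (sqrt (pi / A) * exp (c\<^sup>2 / (4 * A))) * ennreal (normal_density ?\<mu> ?\<sigma> y) \<partial>lborel)"
    using A by (intro nn_integral_cong) (simp add: ennreal_mult'')
  also have "\<dots> = ennreal (sqrt (pi / A) * exp (c\<^sup>2 / (4 * A))) * (\<integral>\<^sup>+y. ennreal (normal_density ?\<mu> ?\<sigma> y) \<partial>lborel)"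
    by (rule nn_integral_cmult) measurable
  also have "(\<integral>\<^sup>+y. ennreal (normal_density ?\<mu> ?\<sigma> y) \<partial>lborel) = 1"
    using A by (subst nn_integral_eq_integral) auto
  finally show ?thesis by simp
qed

lemma nn_integral_gaussian:
  fixes A :: real and c :: "real^'d::finite"
  assumes A: "0 < A"
  shows "(\<integral>\<^sup>+y. ennreal (exp (- A * (norm y)\<^sup>2 + c \<bullet> y)) \<partial>lborel) =
     ennreal ((pi / A) powr (real CARD('d) / 2) * exp ((norm c)\<^sup>2 / (4 * A)))"
proof -
  have "(\<integral>\<^sup>+y. ennreal (exp (- A * (norm y)\<^sup>2 + c \<bullet> y)) \<partial>lborel) =
     (\<integral>\<^sup>+y. (\<Prod>b\<in>Basis. ennreal (exp (- A * (y \<bullet> b)\<^sup>2 + (c \<bullet> b) * (y \<bullet> b)))) \<partial>lborel)"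
  proof (rule nn_integral_cong)
    fix y :: "real^'d"
    have "(norm y)\<^sup>2 = (\<Sum>b\<in>Basis. (y \<bullet> b)\<^sup>2)"
      unfolding power2_norm_eq_inner by (subst euclidean_inner) (simp add: power2_eq_square)
    moreover have "c \<bullet> y = (\<Sum>b\<in>Basis. (c \<bullet> b) * (y \<bullet> b))" by (rule euclidean_inner)
    ultimately have "- A * (norm y)\<^sup>2 + c \<bullet> y = (\<Sum>b\<in>Basis. - A * (y \<bullet> b)\<^sup>2 + (c \<bullet> b) * (y \<bullet> b))"
      by (simp add: sum.distrib sum_distrib_left sum_subtractf sum_negf)
    then show "ennreal (exp (- A * (norm y)\<^sup>2 + c \<bullet> y)) = (\<Prod>b\<in>Basis. ennreal (exp (- A * (y \<bullet> b)\<^sup>2 + (c \<bullet> b) * (y \<bullet> b))))"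
      by (simp add: exp_sum prod_ennreal)
  qed
  also have "\<dots> = (\<Prod>b\<in>(Basis :: (real^'d) set). (\<integral>\<^sup>+y. ennreal (exp (- A * y\<^sup>2 + (c \<bullet> b) * y)) \<partial>lborel))"
    by (rule nn_integral_lborel_prod) auto
  also have "\<dots> = (\<Prod>b\<in>(Basis :: (real^'d) set). ennreal (sqrt (pi / A) * exp ((c \<bullet> b)\<^sup>2 / (4 * A))))"
    by (simp only: nn_integral_gaussian_1d[OF A])
  also have "\<dots> = ennreal (\<Prod>b\<in>(Basis :: (real^'d) set). sqrt (pi / A) * exp ((c \<bullet> b)\<^sup>2 / (4 * A)))"
    using A by (intro prod_ennreal) auto
  also have "(\<Prod>b\<in>(Basis :: (real^'d) set). sqrt (pi / A) * exp ((c \<bullet> b)\<^sup>2 / (4 * A))) =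
      sqrt (pi / A) ^ CARD('d) * exp ((norm c)\<^sup>2 / (4 * A))"
  proof -
    have "(norm c)\<^sup>2 = (\<Sum>b\<in>Basis. (c \<bullet> b)\<^sup>2)"
      unfolding power2_norm_eq_inner by (subst euclidean_inner) (simp add: power2_eq_square)
    then show ?thesis by (simp add: prod.distrib exp_sum[symmetric] sum_divide_distrib)
  qed
  also have "sqrt (pi / A) ^ CARD('d) = (pi / A) powr (real CARD('d) / 2)"
  proof -
    have "sqrt (pi / A) ^ CARD('d) = ((pi / A) powr (1/2)) powr real CARD('d)"
      using A by (simp add: powr_half_sqrt powr_realpow)
    then show ?thesis by (simp add: powr_powr)
  qed
  finally show ?thesis .
qed

lemma heat_p_nonneg: "0 \<le> heat_p \<nu> s x"
  by (simp add: heat_p_def)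

lemma heat_p_pos: "0 < \<nu> \<Longrightarrow> 0 < s \<Longrightarrow> 0 < heat_p \<nu> s x"
  by (simp add: heat_p_def)

lemma heat_p_measurable [measurable]:
  "(\<lambda>(s, x). heat_p \<nu> s x) \<in> borel_measurable (borel \<Otimes>\<^sub>M borel)"
  unfolding heat_p_def by measurable

lemma nn_integral_exp_heat_p:
  fixes c :: "real^'d::finite"
  assumes \<nu>: "0 < \<nu>" and a: "0 < a"
  shows "(\<integral>\<^sup>+y. ennreal (exp (c \<bullet> y) * heat_p \<nu> a y) \<partial>lborel) = ennreal (exp (\<nu> * (norm c)\<^sup>2 * a))"
proof -
  let ?A = "1 / (4 * \<nu> * a)" and ?d = "real CARD('d)"
  have A: "0 < ?A" using \<nu> a by simp
  have "(\<integral>\<^sup>+y. ennreal (exp (c \<bullet> y) * heat_p \<nu> a y) \<partial>lborel) =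
      (\<integral>\<^sup>+y. ennreal ((4 * pi * \<nu> * a) powr (- ?d / 2)) * ennreal (exp (- ?A * (norm y)\<^sup>2 + c \<bullet> y)) \<partial>lborel)"
    by (intro nn_integral_cong) (simp add: heat_p_def ennreal_mult'[symmetric] exp_add exp_minus field_simps exp_diff)
  also have "\<dots> = ennreal ((4 * pi * \<nu> * a) powr (- ?d / 2)) * ennreal ((pi / ?A) powr (?d / 2) * exp ((norm c)\<^sup>2 / (4 * ?A)))"
    by (subst nn_integral_cmult, measurable, subst nn_integral_gaussian[OF A]) simp
  also have "\<dots> = ennreal ((4 * pi * \<nu> * a) powr (- ?d / 2) * ((pi / ?A) powr (?d / 2) * exp ((norm c)\<^sup>2 / (4 * ?A))))"
    by (simp add: ennreal_mult'[symmetric])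
  also have "(4 * pi * \<nu> * a) powr (- ?d / 2) * ((pi / ?A) powr (?d / 2) * exp ((norm c)\<^sup>2 / (4 * ?A))) = exp (\<nu> * (norm c)\<^sup>2 * a)"
  proof -
    have 1: "pi / ?A = 4 * pi * \<nu> * a" using \<nu> a by simp
    have 2: "(norm c)\<^sup>2 / (4 * ?A) = \<nu> * (norm c)\<^sup>2 * a" using \<nu> a by simp
    show ?thesis unfolding 1 2 using \<nu> a by (simp add: powr_minus)
  qed
  finally show ?thesis .
qed

text \<open>The two elementary inequalities behind the bound are
  \<open>a a' / (a + a') \<le> (a + a') / 4\<close> and \<open>a + a' \<ge> 2 sqrt (a a')\<close>.\<close>

lemma nn_integral_exp_heat_p_heat_p_le:
  fixes c :: "real^'d::finite"
  assumes \<nu>: "0 < \<nu>" and a: "0 < a" "0 < a'"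
  defines "l \<equiv> \<nu> * (norm c)\<^sup>2 / 4" and "d \<equiv> real CARD('d)"
  shows "(\<integral>\<^sup>+y. ennreal (exp (c \<bullet> y) * (heat_p \<nu> a y * heat_p \<nu> a' y)) \<partial>lborel) \<le>
     ennreal ((8 * pi * \<nu>) powr (- d / 2) * ((a powr (- d / 4) * exp (l * a)) * (a' powr (- d / 4) * exp (l * a'))))"
proof -
  let ?A = "(a + a') / (4 * \<nu> * a * a')"
  have A: "0 < ?A" using \<nu> a by simp
  have Aeq: "?A = 1 / (4 * \<nu> * a) + 1 / (4 * \<nu> * a')" using \<nu> a by (simp add: field_simps)
  let ?K = "(4 * pi * \<nu> * a) powr (- d / 2) * (4 * pi * \<nu> * a') powr (- d / 2)"
  have "(\<integral>\<^sup>+y. ennreal (exp (c \<bullet> y) * (heat_p \<nu> a y * heat_p \<nu> a' y)) \<partial>lborel) =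
      (\<integral>\<^sup>+y. ennreal ?K * ennreal (exp (- ?A * (norm y)\<^sup>2 + c \<bullet> y)) \<partial>lborel)"
  proof (rule nn_integral_cong)
    fix y :: "real^'d"
    have "- ?A * (norm y)\<^sup>2 + c \<bullet> y = c \<bullet> y + (- (norm y)\<^sup>2 / (4 * \<nu> * a) + - (norm y)\<^sup>2 / (4 * \<nu> * a'))"
      unfolding Aeq by (simp add: algebra_simps)
    then have "exp (- ?A * (norm y)\<^sup>2 + c \<bullet> y) =
       exp (c \<bullet> y) * (exp (- (norm y)\<^sup>2 / (4 * \<nu> * a)) * exp (- (norm y)\<^sup>2 / (4 * \<nu> * a')))"
      by (simp only: exp_add)
    then have "exp (c \<bullet> y) * (heat_p \<nu> a y * heat_p \<nu> a' y) = ?K * exp (- ?A * (norm y)\<^sup>2 + c \<bullet> y)"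
      by (simp only: heat_p_def d_def mult_ac)
    then show "ennreal (exp (c \<bullet> y) * (heat_p \<nu> a y * heat_p \<nu> a' y)) = ennreal ?K * ennreal (exp (- ?A * (norm y)\<^sup>2 + c \<bullet> y))"
      by (simp only: ennreal_mult''[symmetric] exp_ge_zero)
  qed
  also have "\<dots> = ennreal ?K * ennreal ((pi / ?A) powr (d / 2) * exp ((norm c)\<^sup>2 / (4 * ?A)))"
    unfolding d_def by (subst nn_integral_cmult, measurable, subst nn_integral_gaussian[OF A]) simp
  also have "\<dots> = ennreal (?K * ((pi / ?A) powr (d / 2) * exp ((norm c)\<^sup>2 / (4 * ?A))))"
    by (simp add: ennreal_mult'[symmetric])
  \<comment> \<open>The bound is a product of one function at \<open>a\<close> and the same function
    at \<open>a'\<close>. This is what later turns a double integral over two subordinator variables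
    into a square.\<close>
  also have "?K * ((pi / ?A) powr (d / 2) * exp ((norm c)\<^sup>2 / (4 * ?A))) \<le>
     (8 * pi * \<nu>) powr (- d / 2) * ((a powr (- d / 4) * exp (l * a)) * (a' powr (- d / 4) * exp (l * a')))"
  proof -
    have e: "(norm c)\<^sup>2 / (4 * ?A) \<le> l * a + l * a'"
    proof -
      have "(norm c)\<^sup>2 / (4 * ?A) = (\<nu> * (norm c)\<^sup>2) * (a * a' / (a + a'))" using \<nu> a by (simp add: field_simps)
      also have "a * a' / (a + a') \<le> (a + a') / 4"
      proof -
        have "4 * (a * a') \<le> (a + a') * (a + a')" using zero_le_power2[of "a - a'"] by (simp add: power2_eq_square algebra_simps)
        then show ?thesis using a by (simp add: field_simps)
      qed
      then have "(\<nu> * (norm c)\<^sup>2) * (a * a' / (a + a')) \<le> (\<nu> * (norm c)\<^sup>2) * ((a + a') / 4)"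
        using \<nu> by (intro mult_left_mono) auto
      also have "\<dots> = l * a + l * a'" by (simp add: l_def algebra_simps add_divide_distrib)
      finally show ?thesis .
    qed
    have K: "?K * (pi / ?A) powr (d / 2) \<le> (8 * pi * \<nu>) powr (- d / 2) * (a powr (- d / 4) * a' powr (- d / 4))"
    proof -
      have "?K = ((4 * pi * \<nu>) * (4 * pi * \<nu> * a * a')) powr (- d / 2)"
        using \<nu> a by (subst powr_mult[symmetric]) (auto simp: mult_ac)
      moreover have "(pi / ?A) powr (d / 2) = (1 / (pi / ?A)) powr (- d / 2)"
        using \<nu> a by (simp add: powr_divide powr_minus field_simps)
      ultimately have "?K * (pi / ?A) powr (d / 2) = (((4 * pi * \<nu>) * (4 * pi * \<nu> * a * a')) * (1 / (pi / ?A))) powr (- d / 2)"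
        using \<nu> a by (subst powr_mult) auto
      also have "((4 * pi * \<nu>) * (4 * pi * \<nu> * a * a')) * (1 / (pi / ?A)) = (4 * pi * \<nu>) * (a + a')"
        using \<nu> a by (simp add: field_simps)
      also have "((4 * pi * \<nu>) * (a + a')) powr (- d / 2) \<le> ((8 * pi * \<nu>) * sqrt (a * a')) powr (- d / 2)"
      proof (rule powr_mono2')
        have "2 * sqrt (a * a') \<le> a + a'" using arith_geo_mean_sqrt[of a a'] a by simp
        then have "(4 * pi * \<nu>) * (2 * sqrt (a * a')) \<le> (4 * pi * \<nu>) * (a + a')" using \<nu> by (intro mult_left_mono) auto
        then show "8 * pi * \<nu> * sqrt (a * a') \<le> 4 * pi * \<nu> * (a + a')" by simp
      qed (use \<nu> a in \<open>auto simp: d_def\<close>)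
      also have "\<dots> = (8 * pi * \<nu>) powr (- d / 2) * (sqrt (a * a')) powr (- d / 2)"
        using \<nu> a by (subst powr_mult) auto
      also have "(sqrt (a * a')) powr (- d / 2) = a powr (- d / 4) * a' powr (- d / 4)"
        using a by (simp add: powr_half_sqrt[symmetric] powr_powr powr_mult)
      finally show ?thesis .
    qed
    have "?K * ((pi / ?A) powr (d / 2) * exp ((norm c)\<^sup>2 / (4 * ?A))) = (?K * (pi / ?A) powr (d / 2)) * exp ((norm c)\<^sup>2 / (4 * ?A))"
      by (simp only: mult.assoc)
    also have "\<dots> \<le> ((8 * pi * \<nu>) powr (- d / 2) * (a powr (- d / 4) * a' powr (- d / 4))) * exp (l * a + l * a')"
      by (rule mult_mono[OF K]) (use e in auto)
    finally show ?thesis by (simp add: exp_add mult_ac)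
  qed
  finally show ?thesis by (auto intro: ennreal_leI)
qed

subsection \<open>The space-time heat kernel\<close>

context stable_index begin

text \<open>The heat kernel written as an average over the subordinator at time 1: the inverse
  subordinator at time \<open>t\<close> has the law of \<open>(t / w) powr b\<close>. Extended
  values keep the singularity at the origin visible, where a real-valued integral would return
  0.\<close>

definition kernel :: "real \<Rightarrow> real \<Rightarrow> real^'d::finite \<Rightarrow> ennreal" where
  "kernel \<nu> t x = (\<integral>\<^sup>+w. ennreal (heat_p \<nu> ((t / w) powr b) x * g w) \<partial>lborel)"

lemma kernel_measurable [measurable]:
  "(\<lambda>(t, x). kernel \<nu> t x) \<in> borel_measurable (borel \<Otimes>\<^sub>M borel)"
  unfolding kernel_def split_beta' by measurable

lemma heat_G_measurable [measurable]:
  "(\<lambda>(t, x). heat_G \<nu> b t x) \<in> borel_measurable (borel \<Otimes>\<^sub>M borel)"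
  unfolding heat_G_def fE_def set_lebesgue_integral_def split_beta' by measurable

lemma heat_G_nonpos_time: "t \<le> 0 \<Longrightarrow> heat_G \<nu> b t x = 0"
proof -
  assume t: "t \<le> 0"
  have "fE b t s = 0" for s
  proof -
    have "t * s powr (- 1 / b) \<le> 0" using t by (simp add: mult_nonpos_nonneg)
    then show ?thesis using g_zero by (simp add: fE_def)
  qed
  then show ?thesis by (simp add: heat_G_def set_lebesgue_integral_def)
qed

text \<open>The substitution \<open>w = t * s powr (- 1 / b)\<close> inverts
  \<open>s = (t / w) powr b\<close>, and its Jacobian is exactly the prefactor in
  \<open>fE\<close>.\<close>

lemma heat_G_eq_kernel:
  assumes t: "0 < t"
  shows "heat_G \<nu> b t x = enn2real (kernel \<nu> t x)"
proof -
  have "heat_G \<nu> b t x = enn2real (\<integral>\<^sup>+s. ennreal (indicator {0<..} s *\<^sub>R (heat_p \<nu> s x * fE b t s)) \<partial>lborel)"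
    unfolding heat_G_def set_lebesgue_integral_def
    by (rule integral_eq_nn_integral)
      (use t b0 in \<open>auto simp: fE_def heat_p_nonneg g_nonneg indicator_def\<close>)
  also have "(\<integral>\<^sup>+s. ennreal (indicator {0<..} s *\<^sub>R (heat_p \<nu> s x * fE b t s)) \<partial>lborel) =
     (\<integral>\<^sup>+s\<in>{0<..}. ennreal (heat_p \<nu> ((t / (t * s powr (- 1 / b))) powr b) x * g (t * s powr (- 1 / b))) *
        ennreal (t * \<bar>- 1 / b\<bar> * s powr (- 1 / b - 1)) \<partial>lborel)"
  proof (rule nn_integral_cong)
    fix s :: real
    show "ennreal (indicator {0<..} s *\<^sub>R (heat_p \<nu> s x * fE b t s)) =
      ennreal (heat_p \<nu> ((t / (t * s powr (- 1 / b))) powr b) x * g (t * s powr (- 1 / b))) *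
        ennreal (t * \<bar>- 1 / b\<bar> * s powr (- 1 / b - 1)) * indicator {0<..} s"
    proof (cases "0 < s")
      case True
      have "t / (t * s powr (- 1 / b)) = s powr (1 / b)" using t by (simp add: powr_minus divide_inverse)
      then have 1: "(t / (t * s powr (- 1 / b))) powr b = s" using True b0 by (simp add: powr_powr)
      have 2: "- 1 / b - 1 = - 1 - 1 / b" by simp
      have "t * \<bar>- 1 / b\<bar> * s powr (- 1 / b - 1) = t / b * s powr (- 1 - 1 / b)"
        unfolding 2 using b0 by (simp add: abs_if)
      then show ?thesis unfolding 1 using t b0 True
        by (subst ennreal_mult''[symmetric]) (auto simp: fE_def mult_ac)
    qed simp
  qed
  also have "\<dots> = (\<integral>\<^sup>+w\<in>{0<..}. ennreal (heat_p \<nu> ((t / w) powr b) x * g w) \<partial>lborel)"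
    using t b0 by (intro nn_integral_powr_subst) auto
  also have "\<dots> = kernel \<nu> t x"
    unfolding kernel_def by (intro nn_integral_cong) (auto simp: indicator_def g_zero)
  finally show ?thesis .
qed

text \<open>The sign of the density at a particular point is unknown; unit total mass on the
  positive half-line is enough for the integral to be positive.\<close>

lemma nn_integral_g_pos:
  assumes "(\<And>w. 0 < w \<Longrightarrow> 0 < f w)" and [measurable]: "f \<in> borel_measurable borel"
  shows "(\<integral>\<^sup>+w. ennreal (f w * g w) \<partial>lborel) > 0"
proof (rule ccontr)
  assume "\<not> 0 < (\<integral>\<^sup>+w. ennreal (f w * g w) \<partial>lborel)"
  then have "(\<integral>\<^sup>+w. ennreal (f w * g w) \<partial>lborel) = 0" by simp
  then have "AE w in lborel. ennreal (f w * g w) = 0"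
    by (subst (asm) nn_integral_0_iff_AE) auto
  then have "AE w in lborel. ennreal (g w) = 0"
  proof eventually_elim
    case (elim w)
    then show ?case using assms(1)[of w] g_nonneg[of w] g_zero[of w]
      by (cases "0 < w") (auto simp: ennreal_eq_0_iff mult_le_0_iff)
  qed
  then have "(\<integral>\<^sup>+w. ennreal (g w) \<partial>lborel) = 0"
    by (subst nn_integral_0_iff_AE) auto
  then show False by (simp add: nn_integral_g)
qed

lemma kernel_pos:
  assumes "0 < \<nu>" "0 < t"
  shows "0 < kernel \<nu> t x"
  unfolding kernel_def using assms by (intro nn_integral_g_pos) (auto simp: heat_p_pos)

lemma powr_times_exp_minus_le:
  fixes z p :: real
  assumes z: "0 < z" and p: "0 \<le> p" "p \<le> 2"
  shows "z powr p * exp (- z) \<le> 2"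
proof -
  have "z powr p \<le> 1 + z\<^sup>2"
  proof (cases "z \<le> 1")
    case True
    then have "z powr p \<le> 1" using z p by (intro powr_le1) auto
    then show ?thesis using zero_le_power2[of z] by linarith
  next
    case False
    then have "z powr p \<le> z powr 2" using p by (intro powr_mono) auto
    also have "z powr 2 = z\<^sup>2" using z by simp
    finally show ?thesis by linarith
  qed
  also have "\<dots> \<le> 2 * exp z"
  proof -
    have "1 + z + z\<^sup>2 / 2 \<le> exp z" using z by (intro exp_lower_Taylor_quadratic) auto
    then show ?thesis using z by linarith
  qed
  finally have "z powr p * exp (- z) \<le> 2 * exp z * exp (- z)" by (intro mult_right_mono) auto
  also have "2 * exp z * exp (- z) = 2" by (simp add: exp_minus)
  finally show ?thesis .
qed

text \<open>In the variable \<open>z = (norm x)\<^sup>2 / (4 * \<nu> * s)\<close> the kernel is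
  \<open>(pi * (norm x)\<^sup>2) powr (- d / 2)\<close> times
  \<open>z powr (d / 2) * exp (- z)\<close>, and the second factor is bounded. Uniformity in
  \<open>s\<close> makes the averaged kernel finite off the origin.\<close>

lemma heat_p_le:
  fixes x :: "real^'d::finite"
  assumes \<nu>: "0 < \<nu>" and s: "0 < s" and x: "x \<noteq> 0" and d: "CARD('d) < 4"
  shows "heat_p \<nu> s x \<le> 2 * (pi * (norm x)\<^sup>2) powr (- real CARD('d) / 2)"
proof -
  define p where "p = real CARD('d) / 2"
  have p: "- real CARD('d) / 2 = - p" "0 \<le> p" "p \<le> 2" using d by (auto simp: p_def)
  define z where "z = (norm x)\<^sup>2 / (4 * \<nu> * s)"
  have z: "0 < z" using \<nu> s x by (simp add: z_def)
  have z2: "- (norm x)\<^sup>2 / (4 * \<nu> * s) = - z" by (simp add: z_def)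
  have eq: "4 * pi * \<nu> * s = pi * (norm x)\<^sup>2 / z" using \<nu> s x by (simp add: z_def)
  have "(pi * (norm x)\<^sup>2 / z) powr (- p) = (pi * (norm x)\<^sup>2) powr (- p) / z powr (- p)"
    by (rule powr_divide)
  also have "\<dots> = (pi * (norm x)\<^sup>2) powr (- p) * z powr p"
    by (simp only: powr_minus divide_inverse inverse_inverse_eq)
  finally have "heat_p \<nu> s x = (pi * (norm x)\<^sup>2) powr (- p) * (z powr p * exp (- z))"
    unfolding heat_p_def p(1) z2 eq by (simp only: mult.assoc)
  also have "\<dots> \<le> (pi * (norm x)\<^sup>2) powr (- p) * 2"
    using z p by (intro mult_left_mono powr_times_exp_minus_le) auto
  finally show ?thesis unfolding p(1) by (simp only: mult.commute)
qed

lemma kernel_finite: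
  fixes x :: "real^'d::finite"
  assumes \<nu>: "0 < \<nu>" and t: "0 < t" and x: "x \<noteq> 0" and d: "CARD('d) < 4"
  shows "kernel \<nu> t x < \<infinity>"
proof -
  let ?C = "2 * (pi * (norm x)\<^sup>2) powr (- real CARD('d) / 2)"
  have "kernel \<nu> t x \<le> (\<integral>\<^sup>+w. ennreal ?C * ennreal (g w) \<partial>lborel)"
    unfolding kernel_def
  proof (rule nn_integral_mono)
    fix w
    show "ennreal (heat_p \<nu> ((t / w) powr b) x * g w) \<le> ennreal ?C * ennreal (g w)"
    proof (cases "0 < w")
      case True
      then have "heat_p \<nu> ((t / w) powr b) x * g w \<le> ?C * g w"
        using t by (intro mult_right_mono heat_p_le g_nonneg \<nu> x d) auto
      then show ?thesis by (subst ennreal_mult''[symmetric, OF g_nonneg]) (rule ennreal_leI)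
    qed (simp add: g_zero)
  qed
  also have "\<dots> = ennreal ?C" by (subst nn_integral_cmult) (auto simp: nn_integral_g)
  finally show ?thesis by (auto simp: less_top[symmetric] top_unique)
qed

lemma ennreal_heat_G:
  fixes x :: "real^'d::finite"
  assumes "0 < \<nu>" and "0 < t" and "x \<noteq> 0" and "CARD('d) < 4"
  shows "ennreal (heat_G \<nu> b t x) = kernel \<nu> t x"
  using kernel_finite[OF assms] assms(2) by (simp add: heat_G_eq_kernel)

text \<open>Holds at the origin as well, where the right side may be infinite; upper bounds can thus
  avoid exceptional points.\<close>

lemma ennreal_heat_G_le:
  assumes "0 < t"
  shows "ennreal (heat_G \<nu> b t x) \<le> kernel \<nu> t x"
  using assms by (cases "kernel \<nu> t x") (auto simp: heat_G_eq_kernel)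

lemma heat_G_nonneg: "0 \<le> heat_G \<nu> b t x"
  by (cases "0 < t") (auto simp: heat_G_eq_kernel heat_G_nonpos_time)

lemma heat_G_pos:
  fixes x :: "real^'d::finite"
  assumes "0 < \<nu>" and "0 < t" and "x \<noteq> 0" and "CARD('d) < 4"
  shows "0 < heat_G \<nu> b t x"
  using kernel_pos[of \<nu> t x] ennreal_heat_G[OF assms] assms by (metis ennreal_less_zero_iff)

section \<open>Exponential moments of the kernel and of the inverse subordinator\<close>

lemma nn_integral_exp_kernel:
  fixes c :: "real^'d::finite"
  assumes \<nu>: "0 < \<nu>" and t: "0 < t"
  shows "(\<integral>\<^sup>+y. ennreal (exp (c \<bullet> y)) * kernel \<nu> t y \<partial>lborel) =
    (\<integral>\<^sup>+w. ennreal (exp (\<nu> * (norm c)\<^sup>2 * (t / w) powr b) * g w) \<partial>lborel)"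
proof -
  have "(\<integral>\<^sup>+y. ennreal (exp (c \<bullet> y)) * kernel \<nu> t y \<partial>lborel) =
     (\<integral>\<^sup>+y. (\<integral>\<^sup>+w. ennreal (exp (c \<bullet> y)) * ennreal (heat_p \<nu> ((t / w) powr b) y * g w) \<partial>lborel) \<partial>lborel)"
    unfolding kernel_def by (subst nn_integral_cmult) auto
  also have "\<dots> = (\<integral>\<^sup>+w. (\<integral>\<^sup>+y. ennreal (exp (c \<bullet> y)) * ennreal (heat_p \<nu> ((t / w) powr b) y * g w) \<partial>lborel) \<partial>lborel)"
    by (rule lborel_pair.Fubini') measurable
  also have "\<dots> = (\<integral>\<^sup>+w. ennreal (exp (\<nu> * (norm c)\<^sup>2 * (t / w) powr b) * g w) \<partial>lborel)"
  proof (rule nn_integral_cong)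
    fix w
    show "(\<integral>\<^sup>+y. ennreal (exp (c \<bullet> y)) * ennreal (heat_p \<nu> ((t / w) powr b) y * g w) \<partial>lborel) =
      ennreal (exp (\<nu> * (norm c)\<^sup>2 * (t / w) powr b) * g w)"
    proof (cases "0 < w")
      case True
      have "(\<integral>\<^sup>+y. ennreal (exp (c \<bullet> y)) * ennreal (heat_p \<nu> ((t / w) powr b) y * g w) \<partial>lborel) =
        (\<integral>\<^sup>+y. ennreal (exp (c \<bullet> y) * heat_p \<nu> ((t / w) powr b) y) * ennreal (g w) \<partial>lborel)"
        by (intro nn_integral_cong) (simp add: ennreal_mult''[symmetric] ennreal_mult'[symmetric] g_nonneg mult_ac)
      also have "\<dots> = ennreal (exp (\<nu> * (norm c)\<^sup>2 * (t / w) powr b)) * ennreal (g w)"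
        using t True \<nu> by (subst nn_integral_multc, measurable, subst nn_integral_exp_heat_p) auto
      finally show ?thesis by (simp add: ennreal_mult''[OF g_nonneg])
    qed (simp add: g_zero)
  qed
  finally show ?thesis .
qed

lemma nn_integral_kernel:
  assumes "0 < \<nu>" and "0 < t"
  shows "(\<integral>\<^sup>+y. kernel \<nu> t (y :: real^'d::finite) \<partial>lborel) = 1"
  using nn_integral_exp_kernel[OF assms, of "0 :: real^'d"] by (simp add: nn_integral_g)

text \<open>The expectation of \<open>E powr (- \<delta>) * exp (l * E)\<close> for the inverse
  subordinator \<open>E\<close> at time \<open>t\<close>. The value \<open>\<delta> = d / 4\<close>
  arises from the squared kernel, \<open>\<delta> = 0\<close> from the initial datum.\<close>

definition exp_moment :: "real \<Rightarrow> real \<Rightarrow> real \<Rightarrow> ennreal" where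
  "exp_moment \<delta> l t = (\<integral>\<^sup>+w. ennreal (((t / w) powr b) powr (- \<delta>) * exp (l * (t / w) powr b) * g w) \<partial>lborel)"

lemma exp_moment_measurable [measurable]: "exp_moment \<delta> l \<in> borel_measurable borel"
  unfolding exp_moment_def by measurable

text \<open>The square is an average over two independent copies of the subordinator. After Tonelli
  the Gaussian bound separates the two copies.\<close>

lemma nn_integral_exp_kernel_square_le:
  fixes c :: "real^'d::finite"
  assumes \<nu>: "0 < \<nu>" and t: "0 < t"
  shows "(\<integral>\<^sup>+y. ennreal (exp (c \<bullet> y)) * (kernel \<nu> t y)\<^sup>2 \<partial>lborel) \<le>
    ennreal ((8 * pi * \<nu>) powr (- real CARD('d) / 2)) * (exp_moment (real CARD('d) / 4) (\<nu> * (norm c)\<^sup>2 / 4) t)\<^sup>2"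
proof -
  let ?a = "\<lambda>w. (t / w) powr b" and ?l = "\<nu> * (norm c)\<^sup>2 / 4" and ?d = "real CARD('d)"
  let ?K = "(8 * pi * \<nu>) powr (- ?d / 2)"
  let ?E = "\<lambda>w. ?a w powr (- (?d / 4)) * exp (?l * ?a w)"
  have sq: "(kernel \<nu> t y)\<^sup>2 = (\<integral>\<^sup>+w. (\<integral>\<^sup>+w'. ennreal (heat_p \<nu> (?a w) y * g w) * ennreal (heat_p \<nu> (?a w') y * g w') \<partial>lborel) \<partial>lborel)" for y :: "real^'d"
    unfolding kernel_def power2_eq_square
    by (subst nn_integral_cmult, measurable) (subst nn_integral_multc, auto)
  have "(\<integral>\<^sup>+y. ennreal (exp (c \<bullet> y)) * (kernel \<nu> t y)\<^sup>2 \<partial>lborel) =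
    (\<integral>\<^sup>+y. (\<integral>\<^sup>+w. (\<integral>\<^sup>+w'. ennreal (exp (c \<bullet> y)) * (ennreal (heat_p \<nu> (?a w) y * g w) * ennreal (heat_p \<nu> (?a w') y * g w')) \<partial>lborel) \<partial>lborel) \<partial>lborel)"
    unfolding sq by (subst nn_integral_cmult[symmetric], measurable) (subst nn_integral_cmult[symmetric], auto)
  also have "\<dots> = (\<integral>\<^sup>+w. (\<integral>\<^sup>+y. (\<integral>\<^sup>+w'. ennreal (exp (c \<bullet> y)) * (ennreal (heat_p \<nu> (?a w) y * g w) * ennreal (heat_p \<nu> (?a w') y * g w')) \<partial>lborel) \<partial>lborel) \<partial>lborel)"
    by (rule lborel_pair.Fubini') measurable
  also have "\<dots> = (\<integral>\<^sup>+w. (\<integral>\<^sup>+w'. (\<integral>\<^sup>+y. ennreal (exp (c \<bullet> y)) * (ennreal (heat_p \<nu> (?a w) y * g w) * ennreal (heat_p \<nu> (?a w') y * g w')) \<partial>lborel) \<partial>lborel) \<partial>lborel)"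
    by (intro nn_integral_cong, rule lborel_pair.Fubini') measurable
  also have "\<dots> \<le> (\<integral>\<^sup>+w. (\<integral>\<^sup>+w'. ennreal ?K * (ennreal (?E w * g w) * ennreal (?E w' * g w')) \<partial>lborel) \<partial>lborel)"
  proof (intro nn_integral_mono)
    fix w w' :: real
    show "(\<integral>\<^sup>+y. ennreal (exp (c \<bullet> y)) * (ennreal (heat_p \<nu> (?a w) y * g w) * ennreal (heat_p \<nu> (?a w') y * g w')) \<partial>lborel)
       \<le> ennreal ?K * (ennreal (?E w * g w) * ennreal (?E w' * g w'))"
    proof (cases "0 < w \<and> 0 < w'")
      case True
      have "(\<integral>\<^sup>+y. ennreal (exp (c \<bullet> y)) * (ennreal (heat_p \<nu> (?a w) y * g w) * ennreal (heat_p \<nu> (?a w') y * g w')) \<partial>lborel) =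
         (\<integral>\<^sup>+y. ennreal (exp (c \<bullet> y) * (heat_p \<nu> (?a w) y * heat_p \<nu> (?a w') y)) * ennreal (g w * g w') \<partial>lborel)"
        by (intro nn_integral_cong)
          (simp add: ennreal_mult''[symmetric] ennreal_mult'[symmetric] g_nonneg heat_p_nonneg mult_ac)
      also have "\<dots> = (\<integral>\<^sup>+y. ennreal (exp (c \<bullet> y) * (heat_p \<nu> (?a w) y * heat_p \<nu> (?a w') y)) \<partial>lborel) * ennreal (g w * g w')"
        by (rule nn_integral_multc) measurable
      also have "\<dots> \<le> ennreal (?K * ((?a w powr (- ?d / 4) * exp (?l * ?a w)) * (?a w' powr (- ?d / 4) * exp (?l * ?a w')))) * ennreal (g w * g w')"
        using True t by (intro mult_right_mono nn_integral_exp_heat_p_heat_p_le \<nu>) auto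
      also have "\<dots> = ennreal ?K * (ennreal (?E w * g w) * ennreal (?E w' * g w'))"
        by (simp add: ennreal_mult''[symmetric] ennreal_mult'[symmetric] g_nonneg mult_ac)
      finally show ?thesis .
    qed (auto simp: g_zero not_less)
  qed
  also have "\<dots> = ennreal ?K * (exp_moment (?d / 4) ?l t)\<^sup>2"
    unfolding exp_moment_def power2_eq_square
    by (simp add: nn_integral_cmult nn_integral_multc)
  finally show ?thesis .
qed

text \<open>Termwise integration of the exponential series. The term of index 0 requires the moment
  of order \<open>- \<delta>\<close>, which is finite because \<open>\<delta> < 1\<close>.\<close>

lemma exp_moment_series:
  assumes t: "0 < t" and l: "0 \<le> l" and d: "0 \<le> \<delta>" "\<delta> < 1"
  shows "exp_moment \<delta> l t = (\<Sum>k. ennreal (l ^ k / fact k * t powr (b * (real k - \<delta>)) *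
     (Gamma (1 + (real k - \<delta>)) / Gamma (1 + b * (real k - \<delta>)))))"
proof -
  have "exp_moment \<delta> l t = (\<integral>\<^sup>+w. (\<Sum>k. ennreal (l ^ k / fact k * t powr (b * (real k - \<delta>))) * ennreal (w powr (- (b * (real k - \<delta>))) * g w)) \<partial>lborel)"
    unfolding exp_moment_def
  proof (rule nn_integral_cong)
    fix w
    show "ennreal (((t / w) powr b) powr (- \<delta>) * exp (l * (t / w) powr b) * g w) =
      (\<Sum>k. ennreal (l ^ k / fact k * t powr (b * (real k - \<delta>))) * ennreal (w powr (- (b * (real k - \<delta>))) * g w))"
    proof (cases "0 < w")
      case True
      define a where "a = (t / w) powr b"
      have a: "0 < a" using t True by (simp add: a_def)
      have summand: "l ^ k / fact k * t powr (b * (real k - \<delta>)) * (w powr (- (b * (real k - \<delta>))) * g w) =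
          (a powr (- \<delta>) * g w) * ((l * a) ^ k /\<^sub>R fact k)" for k
      proof -
        have "t powr (b * (real k - \<delta>)) * w powr (- (b * (real k - \<delta>))) = (t / w) powr (b * (real k - \<delta>))"
          by (simp only: powr_divide powr_minus) (simp only: divide_inverse)
        also have "\<dots> = a powr (real k - \<delta>)" by (simp add: a_def powr_powr)
        also have "\<dots> = a powr (- \<delta>) * a ^ k"
          using a by (simp add: powr_diff powr_realpow powr_minus field_simps)
        finally have "t powr (b * (real k - \<delta>)) * w powr (- (b * (real k - \<delta>))) = a powr (- \<delta>) * a ^ k" .
        then have "l ^ k / fact k * (t powr (b * (real k - \<delta>)) * w powr (- (b * (real k - \<delta>)))) * g w =
            l ^ k / fact k * (a powr (- \<delta>) * a ^ k) * g w" by simp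
        then show ?thesis by (simp add: power_mult_distrib field_simps)
      qed
      have sums: "(\<lambda>k. (a powr (- \<delta>) * g w) * ((l * a) ^ k /\<^sub>R fact k)) sums ((a powr (- \<delta>) * g w) * exp (l * a))"
        by (intro sums_mult exp_converges)
      have "(\<Sum>k. ennreal (l ^ k / fact k * t powr (b * (real k - \<delta>))) * ennreal (w powr (- (b * (real k - \<delta>))) * g w)) =
         (\<Sum>k. ennreal ((a powr (- \<delta>) * g w) * ((l * a) ^ k /\<^sub>R fact k)))"
        using l by (intro suminf_cong) (simp only: summand[symmetric], subst ennreal_mult', auto)
      also have "\<dots> = ennreal ((a powr (- \<delta>) * g w) * exp (l * a))"
        using sums l a by (subst suminf_ennreal2) (auto simp: sums_iff g_nonneg)
      finally show ?thesis by (simp add: a_def mult_ac)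
    qed (simp add: g_zero)
  qed
  also have "\<dots> = (\<Sum>k. (\<integral>\<^sup>+w. ennreal (l ^ k / fact k * t powr (b * (real k - \<delta>))) * ennreal (w powr (- (b * (real k - \<delta>))) * g w) \<partial>lborel))"
    by (rule nn_integral_suminf) measurable
  also have "\<dots> = (\<Sum>k. ennreal (l ^ k / fact k * t powr (b * (real k - \<delta>)) *
     (Gamma (1 + (real k - \<delta>)) / Gamma (1 + b * (real k - \<delta>)))))"
    using d l by (intro suminf_cong, subst nn_integral_cmult, measurable, subst moment) (auto simp: ennreal_mult'[symmetric])
  finally show ?thesis .
qed

text \<open>Since \<open>t \<mapsto> E exp (l E\<^sub>t)\<close> is increasing, integrating against the density
  \<open>q exp (- q t)\<close> over \<open>[t, \<infinity>)\<close> bounds its value at \<open>t\<close>.\<close>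

lemma exp_moment_le:
  assumes t: "0 < t" and l: "0 \<le> l" and q: "0 < q" and lq: "l < q powr b"
  shows "exp_moment 0 l t \<le> ennreal (exp (q * t) / (1 - l / q powr b))"
proof -
  have mono: "exp_moment 0 l t \<le> exp_moment 0 l r" if "t \<le> r" for r
    unfolding exp_moment_def
  proof (intro nn_integral_mono ennreal_leI)
    fix w
    show "((t / w) powr b) powr (- 0) * exp (l * (t / w) powr b) * g w \<le> ((r / w) powr b) powr (- 0) * exp (l * (r / w) powr b) * g w"
    proof (cases "0 < w")
      case True
      then have "l * (t / w) powr b \<le> l * (r / w) powr b"
        using t that b0 l by (intro mult_left_mono powr_mono2) (auto simp: divide_right_mono)
      then show ?thesis using True t that by (auto intro!: mult_right_mono g_nonneg)
    qed (simp add: g_zero)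
  qed
  have "exp_moment 0 l t * ennreal (exp (- q * t)) = exp_moment 0 l t * (\<integral>\<^sup>+r\<in>{t<..}. ennreal (q * exp (- r * q)) \<partial>lborel)"
    using nn_integral_exp_Ioi[OF q, of t] by (simp add: mult.commute)
  also have "\<dots> = (\<integral>\<^sup>+r. exp_moment 0 l t * (ennreal (q * exp (- r * q)) * indicator {t<..} r) \<partial>lborel)"
    by (rule nn_integral_cmult[symmetric]) measurable
  also have "\<dots> \<le> (\<integral>\<^sup>+r\<in>{0<..}. exp_moment 0 l r * ennreal (q * exp (- r * q)) \<partial>lborel)"
    using t by (intro nn_integral_mono) (auto simp: indicator_def intro!: mult_right_mono mono)
  \<comment> \<open>For \<open>\<delta> = 0\<close> the series is the Mittag-Leffler function at
    \<open>l * r powr b\<close>, and its Laplace transform in \<open>r\<close> is a geometric series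
    with ratio \<open>l / q powr b\<close>.\<close>
  also have "\<dots> = (\<integral>\<^sup>+r. (\<Sum>k. ennreal (l ^ k * q / Gamma (1 + b * real k)) *
      (ennreal (r powr ((1 + b * real k) - 1) * exp (- q * r)) * indicator {0<..} r)) \<partial>lborel)"
  proof (rule nn_integral_cong)
    fix r :: real
    show "exp_moment 0 l r * ennreal (q * exp (- r * q)) * indicator {0<..} r =
       (\<Sum>k. ennreal (l ^ k * q / Gamma (1 + b * real k)) * (ennreal (r powr ((1 + b * real k) - 1) * exp (- q * r)) * indicator {0<..} r))"
    proof (cases "0 < r")
      case True
      have "exp_moment 0 l r * ennreal (q * exp (- r * q)) =
        (\<Sum>k. ennreal (q * exp (- r * q)) * ennreal (l ^ k / fact k * r powr (b * (real k - 0)) * (Gamma (1 + (real k - 0)) / Gamma (1 + b * (real k - 0)))))"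
        using exp_moment_series[OF True l, of 0] by (simp add: mult.commute)
      also have "\<dots> = (\<Sum>k. ennreal (l ^ k * q / Gamma (1 + b * real k)) * ennreal (r powr ((1 + b * real k) - 1) * exp (- q * r)))"
      proof (intro suminf_cong)
        fix k
        have "0 < Gamma (1 + b * real k)" using b0 by (intro Gamma_real_pos) (auto intro: add_pos_nonneg)
        then show "ennreal (q * exp (- r * q)) * ennreal (l ^ k / fact k * r powr (b * (real k - 0)) * (Gamma (1 + (real k - 0)) / Gamma (1 + b * (real k - 0)))) =
          ennreal (l ^ k * q / Gamma (1 + b * real k)) * ennreal (r powr ((1 + b * real k) - 1) * exp (- q * r))"
          using q l by (simp add: Gamma_fact ennreal_mult''[symmetric] ennreal_mult'[symmetric] mult_ac)
      qed
      finally show ?thesis using True by simp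
    qed simp
  qed
  also have "\<dots> = (\<Sum>k. (\<integral>\<^sup>+r. ennreal (l ^ k * q / Gamma (1 + b * real k)) *
      (ennreal (r powr ((1 + b * real k) - 1) * exp (- q * r)) * indicator {0<..} r) \<partial>lborel))"
    by (rule nn_integral_suminf) measurable
  also have "\<dots> = (\<Sum>k. ennreal ((l / q powr b) ^ k))"
  proof (intro suminf_cong)
    fix k
    have p: "0 < 1 + b * real k" using b0 by (auto intro: add_pos_nonneg)
    then have G: "0 < Gamma (1 + b * real k)" by (rule Gamma_real_pos)
    have "(\<integral>\<^sup>+r. ennreal (l ^ k * q / Gamma (1 + b * real k)) *
      (ennreal (r powr ((1 + b * real k) - 1) * exp (- q * r)) * indicator {0<..} r) \<partial>lborel) =
       ennreal (l ^ k * q / Gamma (1 + b * real k)) * ennreal (Gamma (1 + b * real k) * q powr (- (1 + b * real k)))"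
      by (subst nn_integral_cmult, measurable, subst nn_integral_powr_exp[OF p q]) simp
    also have "\<dots> = ennreal (l ^ k * q / Gamma (1 + b * real k) * (Gamma (1 + b * real k) * q powr (- (1 + b * real k))))"
      using q l G by (intro ennreal_mult'[symmetric]) auto
    also have "l ^ k * q / Gamma (1 + b * real k) * (Gamma (1 + b * real k) * q powr (- (1 + b * real k))) = (l / q powr b) ^ k"
    proof -
      have "q powr (- (1 + b * real k)) = 1 / (q * (q powr b) ^ k)"
      proof -
        have "(q powr b) ^ k = q powr (b * real k)" using q by (simp add: powr_realpow[symmetric] powr_powr)
        moreover have "q powr 1 = q" using q by simp
        ultimately show ?thesis by (simp only: powr_minus_divide powr_add)
      qed
      then show ?thesis using G q by (simp add: power_divide)
    qed
    finally show "(\<integral>\<^sup>+r. ennreal (l ^ k * q / Gamma (1 + b * real k)) *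
      (ennreal (r powr ((1 + b * real k) - 1) * exp (- q * r)) * indicator {0<..} r) \<partial>lborel) = ennreal ((l / q powr b) ^ k)" .
  qed
  also have "\<dots> = ennreal (1 / (1 - l / q powr b))"
    using l q lq geometric_sums[of "l / q powr b"]
    by (subst suminf_ennreal2) (auto simp: sums_iff)
  finally have "exp_moment 0 l t * ennreal (exp (- q * t)) * ennreal (exp (q * t)) \<le> ennreal (1 / (1 - l / q powr b)) * ennreal (exp (q * t))"
    by (rule mult_right_mono) simp
  then show ?thesis
    using q l lq by (simp add: mult.assoc ennreal_mult''[symmetric] exp_add[symmetric])
qed

lemma a0_eq:
  assumes n: "n < 4"
  shows "a0 b n = Gamma (1 - real n / 4) / Gamma (1 - b * real n / 4)"
proof -
  have n4: "real n / 4 < 1" using n by simp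
  then have "b * (real n / 4) < 1"
    using b0 b1 by (smt (verit) mult_left_le mult_nonneg_nonneg of_nat_0_le_iff divide_nonneg_nonneg mult_left_le_one_le)
  then have pos: "0 < Gamma (1 - real n / 4)" "0 < Gamma (1 - b * real n / 4)"
    using n4 by (auto intro!: Gamma_real_pos)
  have "a0 b n = enn2real (\<integral>\<^sup>+w. ennreal (w powr (b * real n / 4) * g w) \<partial>lborel)"
    unfolding a0_def by (rule integral_eq_nn_integral) (auto simp: g_nonneg)
  also have "(\<integral>\<^sup>+w. ennreal (w powr (b * real n / 4) * g w) \<partial>lborel) = ennreal (Gamma (1 - real n / 4) / Gamma (1 - b * real n / 4))"
    using moment[of "- (real n / 4)"] n4 by simp
  finally show ?thesis using pos by simp
qed

text \<open>\<open>\<kappa> k\<close> is the order of the moment in the \<open>k\<close>-th term,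
  and \<open>2 * b * \<kappa> k\<close> the power of time in its square. Comparing both Gamma
  quotients with their values at \<open>k = 0\<close> leaves the square of the first entry of
  \<open>const_M\<close>, and the duplication bound costs
  \<open>4 powr (b * real k)\<close>.\<close>

lemma time_coefficient_le:
  assumes n: "n < 4" and bn: "b * real n < 2"
  defines "\<kappa> \<equiv> \<lambda>k. real k - real n / 4"
  shows "(Gamma (1 + \<kappa> k) / Gamma (1 + b * \<kappa> k) / fact k)\<^sup>2 * Gamma (1 + 2 * b * \<kappa> k) \<le> 4 powr (b * real k) * (const_M b n)\<^sup>2"
    and "0 \<le> Gamma (1 + \<kappa> k) / Gamma (1 + b * \<kappa> k)"
    and "0 < 1 + 2 * b * \<kappa> k"
proof -
  let ?\<delta> = "real n / 4"
  have d: "0 \<le> ?\<delta>" "?\<delta> < 1" using n by auto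
  have bd: "2 * (b * ?\<delta>) < 1" using bn by simp
  have kk: "b * \<kappa> k = b * real k - b * ?\<delta>" unfolding \<kappa>_def by (simp add: right_diff_distrib)
  have bk: "0 \<le> b * real k" using b0 by simp
  show pos2: "0 < 1 + 2 * b * \<kappa> k" using bd kk bk by (simp add: mult.assoc)
  then have pos1: "0 < 1 + b * \<kappa> k" using bd kk bk by linarith
  note G = Gamma_shift_over_fact_le[OF d, of k, folded \<kappa>_def]
  show nn: "0 \<le> Gamma (1 + \<kappa> k) / Gamma (1 + b * \<kappa> k)"
    using G Gamma_real_pos[OF pos1] unfolding \<kappa>_def by simp
  have ratio: "Gamma (2 * (b * \<kappa> k) + 1) / (Gamma (b * \<kappa> k + 1))\<^sup>2 \<le>
      4 powr (b * \<kappa> k - (- (b * ?\<delta>))) * (Gamma (2 * (- (b * ?\<delta>)) + 1) / (Gamma ((- (b * ?\<delta>)) + 1))\<^sup>2)"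
    using bd kk bk by (intro Gamma_double_ratio_mono) auto
  have fac: "(Gamma (1 + \<kappa> k) / fact k)\<^sup>2 \<le> (Gamma (1 - ?\<delta>))\<^sup>2"
    using G unfolding \<kappa>_def by (intro power_mono) (auto simp: less_imp_le)
  have M: "a0 b n * sqrt (Gamma (1 - b * real n / 2)) \<le> const_M b n" by (simp add: const_M_def)
  have a0: "0 \<le> a0 b n" unfolding a0_eq[OF n] using d bd by (auto intro!: divide_nonneg_nonneg less_imp_le Gamma_real_pos)
  have Gp: "0 < Gamma (1 - b * real n / 2)" using bn by (auto intro!: Gamma_real_pos)
  have "(Gamma (1 + \<kappa> k) / Gamma (1 + b * \<kappa> k) / fact k)\<^sup>2 * Gamma (1 + 2 * b * \<kappa> k) =
     (Gamma (1 + \<kappa> k) / fact k)\<^sup>2 * (Gamma (2 * (b * \<kappa> k) + 1) / (Gamma (b * \<kappa> k + 1))\<^sup>2)"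
    by (simp add: power_divide power_mult_distrib add.commute mult.assoc)
  also have "\<dots> \<le> (Gamma (1 - ?\<delta>))\<^sup>2 * (4 powr (b * \<kappa> k - (- (b * ?\<delta>))) * (Gamma (2 * (- (b * ?\<delta>)) + 1) / (Gamma ((- (b * ?\<delta>)) + 1))\<^sup>2))"
    using pos2 Gamma_real_pos[OF pos2]
    by (intro mult_mono fac ratio) (auto simp: add.commute mult.assoc less_imp_le)
  also have "\<dots> = 4 powr (b * real k) * (a0 b n * sqrt (Gamma (1 - b * real n / 2)))\<^sup>2"
    using Gp by (simp add: a0_eq[OF n] kk power_mult_distrib power_divide)
  also have "\<dots> \<le> 4 powr (b * real k) * (const_M b n)\<^sup>2"
    using M a0 Gp by (intro mult_left_mono power_mono) auto
  finally show "(Gamma (1 + \<kappa> k) / Gamma (1 + b * \<kappa> k) / fact k)\<^sup>2 * Gamma (1 + 2 * b * \<kappa> k) \<le> 4 powr (b * real k) * (const_M b n)\<^sup>2" .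
qed

text \<open>The series for \<open>exp_moment\<close> has \<open>L\<^sup>2\<close> norms decaying like powers of \<open>2 powr (b - 2)\<close>; Cauchy-Schwarz
  with these powers as weights sums it with the same constant as Minkowski's inequality.\<close>

lemma nn_integral_exp_moment_square_le:
  assumes n: "n < 4" and bn: "b * real n < 2" and q: "0 < \<gamma>" and l: "0 \<le> l" "4 * l \<le> \<gamma> powr b"
  shows "(\<integral>\<^sup>+t\<in>{0<..}. ennreal (exp (- \<gamma> * t)) * (exp_moment (real n / 4) l t)\<^sup>2 \<partial>lborel) \<le>
    ennreal ((const_M b n)\<^sup>2 * \<gamma> powr (b * real n / 2 - 1) / (1 - 2 powr (b - 2))\<^sup>2)"
proof -
  define \<kappa> where "\<kappa> k = real k - real n / 4" for k
  define m where "m k = Gamma (1 + \<kappa> k) / Gamma (1 + b * \<kappa> k)" for k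
  \<comment> \<open>Since \<open>4 * l \<le> \<gamma> powr b\<close>, the \<open>k\<close>-th
    squared norm is at most a constant times \<open>4 powr (b * real k) / 16 ^ k\<close>, that is
    \<open>\<rho> ^ (2 * k)\<close>. Dividing by the weight \<open>\<rho> ^ k\<close> leaves a
    geometric series, so \<open>1 - \<rho>\<close> enters twice: once through the weights and once
    through this sum.\<close>
  define \<rho> where "\<rho> = 2 powr (b - 2)"
  define c where "c k = l ^ k / fact k * m k" for k
  note tc = time_coefficient_le[OF n bn, folded \<kappa>_def, folded m_def]
  have m0: "0 \<le> m k" for k by (rule tc(2))
  have pos: "0 < 1 + 2 * b * \<kappa> k" for k by (rule tc(3))
  have \<rho>: "0 < \<rho>" "\<rho> < 1" using b1 by (auto simp: \<rho>_def powr_less_one)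
  have c0: "0 \<le> c k" for k using l m0 by (simp add: c_def)
  have bound: "ennreal (exp (- \<gamma> * t)) * (exp_moment (real n / 4) l t)\<^sup>2 \<le>
      ennreal (1 / (1 - \<rho>)) * (\<Sum>k. ennreal ((c k)\<^sup>2 / \<rho> ^ k) * ennreal (t powr (1 + 2 * b * \<kappa> k - 1) * exp (- \<gamma> * t)))"
    if t: "0 < t" for t
  proof -
    have ser: "exp_moment (real n / 4) l t = (\<Sum>k. ennreal (c k * t powr (b * \<kappa> k)))"
      using exp_moment_series[OF t l(1), of "real n / 4"] n by (simp add: c_def m_def \<kappa>_def mult_ac)
    have "(exp_moment (real n / 4) l t)\<^sup>2 \<le> ennreal (1 / (1 - \<rho>)) * (\<Sum>k. ennreal ((c k * t powr (b * \<kappa> k))\<^sup>2 / \<rho> ^ k))"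
      unfolding ser by (rule suminf_square_le_weighted) (use c0 \<rho> in auto)
    then have "ennreal (exp (- \<gamma> * t)) * (exp_moment (real n / 4) l t)\<^sup>2 \<le>
       ennreal (exp (- \<gamma> * t)) * (ennreal (1 / (1 - \<rho>)) * (\<Sum>k. ennreal ((c k * t powr (b * \<kappa> k))\<^sup>2 / \<rho> ^ k)))"
      by (rule mult_left_mono) simp
    also have "\<dots> = ennreal (1 / (1 - \<rho>)) * (\<Sum>k. ennreal (exp (- \<gamma> * t)) * ennreal ((c k * t powr (b * \<kappa> k))\<^sup>2 / \<rho> ^ k))"
      by (simp only: ennreal_suminf_cmult mult.left_commute)
    also have "(\<lambda>k. ennreal (exp (- \<gamma> * t)) * ennreal ((c k * t powr (b * \<kappa> k))\<^sup>2 / \<rho> ^ k)) =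
        (\<lambda>k. ennreal ((c k)\<^sup>2 / \<rho> ^ k) * ennreal (t powr (1 + 2 * b * \<kappa> k - 1) * exp (- \<gamma> * t)))"
    proof
      fix k
      have "(t powr (b * \<kappa> k))\<^sup>2 = t powr (1 + 2 * b * \<kappa> k - 1)"
        using t by (simp add: power2_eq_square powr_add[symmetric] mult.assoc)
      then have "exp (- \<gamma> * t) * ((c k * t powr (b * \<kappa> k))\<^sup>2 / \<rho> ^ k) = (c k)\<^sup>2 / \<rho> ^ k * (t powr (1 + 2 * b * \<kappa> k - 1) * exp (- \<gamma> * t))"
        by (simp add: power_mult_distrib)
      then show "ennreal (exp (- \<gamma> * t)) * ennreal ((c k * t powr (b * \<kappa> k))\<^sup>2 / \<rho> ^ k) =
          ennreal ((c k)\<^sup>2 / \<rho> ^ k) * ennreal (t powr (1 + 2 * b * \<kappa> k - 1) * exp (- \<gamma> * t))"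
        using \<rho> by (subst (1 2) ennreal_mult'[symmetric]) auto
    qed
    finally show ?thesis .
  qed
  have "(\<integral>\<^sup>+t\<in>{0<..}. ennreal (exp (- \<gamma> * t)) * (exp_moment (real n / 4) l t)\<^sup>2 \<partial>lborel) \<le>
    (\<integral>\<^sup>+t. ennreal (1 / (1 - \<rho>)) * (\<Sum>k. ennreal ((c k)\<^sup>2 / \<rho> ^ k) * (ennreal (t powr (1 + 2 * b * \<kappa> k - 1) * exp (- \<gamma> * t)) * indicator {0<..} t)) \<partial>lborel)"
  proof (rule nn_integral_mono)
    fix t :: real
    show "ennreal (exp (- \<gamma> * t)) * (exp_moment (real n / 4) l t)\<^sup>2 * indicator {0<..} t \<le>
       ennreal (1 / (1 - \<rho>)) * (\<Sum>k. ennreal ((c k)\<^sup>2 / \<rho> ^ k) * (ennreal (t powr (1 + 2 * b * \<kappa> k - 1) * exp (- \<gamma> * t)) * indicator {0<..} t))"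
      using bound[of t] by (cases "0 < t") auto
  qed
  also have "\<dots> = ennreal (1 / (1 - \<rho>)) * (\<Sum>k. \<integral>\<^sup>+t. ennreal ((c k)\<^sup>2 / \<rho> ^ k) * (ennreal (t powr (1 + 2 * b * \<kappa> k - 1) * exp (- \<gamma> * t)) * indicator {0<..} t) \<partial>lborel)"
    by (subst nn_integral_cmult, measurable, subst nn_integral_suminf) auto
  also have "\<dots> \<le> ennreal (1 / (1 - \<rho>)) * (\<Sum>k. ennreal ((const_M b n)\<^sup>2 * \<gamma> powr (b * real n / 2 - 1) * \<rho> ^ k))"
  proof (intro mult_left_mono suminf_le)
    fix k
    have "(\<integral>\<^sup>+t. ennreal ((c k)\<^sup>2 / \<rho> ^ k) * (ennreal (t powr (1 + 2 * b * \<kappa> k - 1) * exp (- \<gamma> * t)) * indicator {0<..} t) \<partial>lborel)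
       = ennreal ((c k)\<^sup>2 / \<rho> ^ k) * ennreal (Gamma (1 + 2 * b * \<kappa> k) * \<gamma> powr (- (1 + 2 * b * \<kappa> k)))"
      by (subst nn_integral_cmult, measurable, subst nn_integral_powr_exp[OF pos q]) simp
    also have "\<dots> = ennreal ((c k)\<^sup>2 / \<rho> ^ k * (Gamma (1 + 2 * b * \<kappa> k) * \<gamma> powr (- (1 + 2 * b * \<kappa> k))))"
      using \<rho> by (intro ennreal_mult'[symmetric]) auto
    also have "\<dots> \<le> ennreal ((const_M b n)\<^sup>2 * \<gamma> powr (b * real n / 2 - 1) * \<rho> ^ k)"
    proof (rule ennreal_leI)
      let ?g = "\<gamma> powr (b * real n / 2 - 1)"
      have e: "- (1 + 2 * b * \<kappa> k) = (b * real n / 2 - 1) + (- (2 * (b * real k)))"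
        by (simp add: \<kappa>_def right_diff_distrib)
      have "(\<gamma> powr b) ^ (2 * k) = \<gamma> powr (2 * (b * real k))"
        using q by (simp add: powr_realpow[symmetric] powr_powr mult_ac)
      then have gp: "\<gamma> powr (- (1 + 2 * b * \<kappa> k)) = ?g / (\<gamma> powr b) ^ (2 * k)"
        unfolding e by (simp only: powr_add powr_minus divide_inverse)
      have lp: "l ^ (2 * k) / (\<gamma> powr b) ^ (2 * k) \<le> (1 / 4) ^ (2 * k)"
      proof -
        have "l / \<gamma> powr b \<le> 1 / 4" using l q by (simp add: field_simps)
        then have "(l / \<gamma> powr b) ^ (2 * k) \<le> (1 / 4) ^ (2 * k)" using l by (intro power_mono) auto
        then show ?thesis by (simp add: power_divide)
      qed
      have \<rho>k: "4 powr (b * real k) * (1 / 4) ^ (2 * k) = \<rho> ^ k * \<rho> ^ k"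
      proof -
        have "\<rho> ^ k = 2 powr ((b - 2) * real k)"
          by (simp add: \<rho>_def powr_realpow[symmetric] powr_powr)
        then have "(\<rho> ^ k * \<rho> ^ k) = 2 powr ((b - 2) * real k + (b - 2) * real k)"
          by (simp only: powr_add)
        also have "\<dots> = 2 powr (2 * (b * real k)) * 2 powr (- (2 * (2 * real k)))"
          by (simp add: powr_add[symmetric] algebra_simps)
        also have "2 powr (2 * (b * real k)) = (2 powr 2) powr (b * real k)" by (simp only: powr_powr)
        also have "2 powr (- (2 * (2 * real k))) = (2 powr (- 2)) powr real (2 * k)" by (simp add: powr_powr)
        also have "\<dots> = (1 / 4) ^ (2 * k)" by (subst powr_realpow) (auto simp: powr_minus)
        finally show ?thesis by simp
      qed
      have "(c k)\<^sup>2 / \<rho> ^ k * (Gamma (1 + 2 * b * \<kappa> k) * \<gamma> powr (- (1 + 2 * b * \<kappa> k)))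
        = ((m k / fact k)\<^sup>2 * Gamma (1 + 2 * b * \<kappa> k)) * (l ^ (2 * k) / (\<gamma> powr b) ^ (2 * k)) * (?g / \<rho> ^ k)"
        unfolding gp c_def by (simp add: power_mult_distrib power_divide power_mult[symmetric] mult_ac)
      also have "\<dots> \<le> (4 powr (b * real k) * (const_M b n)\<^sup>2) * (1 / 4) ^ (2 * k) * (?g / \<rho> ^ k)"
        by (rule mult_right_mono[OF mult_mono[OF tc(1)[of k] lp]]) (use \<rho> l in auto)
      also have "\<dots> = (const_M b n)\<^sup>2 * ?g * ((4 powr (b * real k) * (1 / 4) ^ (2 * k)) / \<rho> ^ k)" by simp
      also have "(4 powr (b * real k) * (1 / 4) ^ (2 * k)) / \<rho> ^ k = \<rho> ^ k" unfolding \<rho>k using \<rho> by simp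
      finally show "(c k)\<^sup>2 / \<rho> ^ k * (Gamma (1 + 2 * b * \<kappa> k) * \<gamma> powr (- (1 + 2 * b * \<kappa> k))) \<le> (const_M b n)\<^sup>2 * ?g * \<rho> ^ k" .
    qed
    finally show "(\<integral>\<^sup>+t. ennreal ((c k)\<^sup>2 / \<rho> ^ k) * (ennreal (t powr (1 + 2 * b * \<kappa> k - 1) * exp (- \<gamma> * t)) * indicator {0<..} t) \<partial>lborel)
        \<le> ennreal ((const_M b n)\<^sup>2 * \<gamma> powr (b * real n / 2 - 1) * \<rho> ^ k)" .
  qed auto
  also have "(\<Sum>k. ennreal ((const_M b n)\<^sup>2 * \<gamma> powr (b * real n / 2 - 1) * \<rho> ^ k)) = ennreal ((const_M b n)\<^sup>2 * \<gamma> powr (b * real n / 2 - 1) * (1 / (1 - \<rho>)))"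
    using sums_mult[OF geometric_sums[of \<rho>], of "(const_M b n)\<^sup>2 * \<gamma> powr (b * real n / 2 - 1)"] \<rho>
    by (subst suminf_ennreal2) (auto simp: sums_iff)
  also have "ennreal (1 / (1 - \<rho>)) * \<dots> = ennreal ((const_M b n)\<^sup>2 * \<gamma> powr (b * real n / 2 - 1) / (1 - \<rho>)\<^sup>2)"
    using \<rho> by (simp add: ennreal_mult'[symmetric] power2_eq_square)
  finally show ?thesis unfolding \<rho>_def .
qed

text \<open>The tilt enters as \<open>l = \<nu> * (norm c)\<^sup>2 / 4\<close>, the quarter coming
  from the product of two Gaussians; this is how \<open>4 * l \<le> \<gamma> powr b\<close> becomes
  the condition on \<open>c\<close>.\<close>

lemma kernel_energy_le:
  fixes c :: "real^'d::finite"
  assumes \<nu>: "0 < \<nu>" and n: "CARD('d) < 4" and bn: "b * real CARD('d) < 2"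
    and q: "0 < \<gamma>" and c: "\<nu> * (norm c)\<^sup>2 \<le> \<gamma> powr b"
  shows "(\<integral>\<^sup>+t\<in>{0<..}. (\<integral>\<^sup>+y. ennreal (exp (- \<gamma> * t + c \<bullet> y)) * (kernel \<nu> t y)\<^sup>2 \<partial>lborel) \<partial>lborel) \<le>
    ennreal ((8 * pi * \<nu>) powr (- real CARD('d) / 2) *
      ((const_M b CARD('d))\<^sup>2 * \<gamma> powr (b * real CARD('d) / 2 - 1) / (1 - 2 powr (b - 2))\<^sup>2))"
proof -
  let ?K = "(8 * pi * \<nu>) powr (- real CARD('d) / 2)" and ?\<delta> = "real CARD('d) / 4" and ?l = "\<nu> * (norm c)\<^sup>2 / 4"
  have "(\<integral>\<^sup>+t\<in>{0<..}. (\<integral>\<^sup>+y. ennreal (exp (- \<gamma> * t + c \<bullet> y)) * (kernel \<nu> t y)\<^sup>2 \<partial>lborel) \<partial>lborel) \<le>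
    (\<integral>\<^sup>+t. ennreal ?K * (ennreal (exp (- \<gamma> * t)) * (exp_moment ?\<delta> ?l t)\<^sup>2 * indicator {0<..} t) \<partial>lborel)"
  proof (rule nn_integral_mono)
    fix t :: real
    show "(\<integral>\<^sup>+y. ennreal (exp (- \<gamma> * t + c \<bullet> y)) * (kernel \<nu> t y)\<^sup>2 \<partial>lborel) * indicator {0<..} t \<le>
      ennreal ?K * (ennreal (exp (- \<gamma> * t)) * (exp_moment ?\<delta> ?l t)\<^sup>2 * indicator {0<..} t)"
    proof (cases "0 < t")
      case True
      have "(\<integral>\<^sup>+y. ennreal (exp (- \<gamma> * t + c \<bullet> y)) * (kernel \<nu> t y)\<^sup>2 \<partial>lborel) =
        ennreal (exp (- \<gamma> * t)) * (\<integral>\<^sup>+y. ennreal (exp (c \<bullet> y)) * (kernel \<nu> t y)\<^sup>2 \<partial>lborel)"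
        by (subst nn_integral_cmult[symmetric], measurable)
          (simp only: exp_add ennreal_mult' exp_ge_zero mult.assoc)
      also have "\<dots> \<le> ennreal (exp (- \<gamma> * t)) * (ennreal ?K * (exp_moment ?\<delta> ?l t)\<^sup>2)"
        by (intro mult_left_mono nn_integral_exp_kernel_square_le \<nu> True) simp
      finally show ?thesis using True by (simp add: mult_ac)
    qed simp
  qed
  also have "\<dots> = ennreal ?K * (\<integral>\<^sup>+t\<in>{0<..}. ennreal (exp (- \<gamma> * t)) * (exp_moment ?\<delta> ?l t)\<^sup>2 \<partial>lborel)"
    by (rule nn_integral_cmult) measurable
  also have "\<dots> \<le> ennreal ?K * ennreal ((const_M b CARD('d))\<^sup>2 * \<gamma> powr (b * real CARD('d) / 2 - 1) / (1 - 2 powr (b - 2))\<^sup>2)"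
    using c \<nu> by (intro mult_left_mono nn_integral_exp_moment_square_le n bn q) auto
  finally show ?thesis by (subst ennreal_mult') simp_all
qed

end

subsection \<open>The Walsh isometry\<close>

locale white_noise = prob_space P for P :: "'w measure" +
  fixes F :: "real \<Rightarrow> 'w measure" and W :: "(real \<times> (real^'d::finite)) set \<Rightarrow> 'w \<Rightarrow> real"
  assumes filtration: "is_filtration P F" and noise: "is_white_noise P F W"
begin

lemma subalgebra_F: "subalgebra P (F t)"
  using filtration by (simp add: is_filtration_def)

lemma measurable_F_P: "f \<in> borel_measurable (F t) \<Longrightarrow> f \<in> borel_measurable P"
  by (rule measurable_from_subalg[OF subalgebra_F])

lemma measurable_F_mono: "s \<le> t \<Longrightarrow> f \<in> borel_measurable (F s) \<Longrightarrow> f \<in> borel_measurable (F t)"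
  using filtration unfolding is_filtration_def
  by (intro measurable_from_subalg[of "F t" "F s"]) (auto simp: subalgebra_def)

lemma W_measurable: "wn_set A \<Longrightarrow> W A \<in> borel_measurable P"
  using noise by (simp add: is_white_noise_def)

lemma W_law:
  assumes A: "wn_set A"
  shows "integrable P (W A)" and "integrable P (\<lambda>\<omega>. (W A \<omega>)\<^sup>2)" and "(\<integral>\<omega>. W A \<omega> \<partial>P) = 0"
    and "(\<integral>\<omega>. (W A \<omega>)\<^sup>2 \<partial>P) = measure lborel A"
proof -
  note [measurable] = W_measurable[OF A]
  have "integrable P (W A) \<and> integrable P (\<lambda>\<omega>. (W A \<omega>)\<^sup>2) \<and> (\<integral>\<omega>. W A \<omega> \<partial>P) = 0 \<and> (\<integral>\<omega>. (W A \<omega>)\<^sup>2 \<partial>P) = measure lborel A"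
  proof (cases "measure lborel A > 0")
    case True
    let ?s = "sqrt (measure lborel A)"
    have D: "distributed P lborel (W A) (normal_density 0 ?s)"
      using noise A True by (auto simp: is_white_noise_def)
    have s: "0 < ?s" using True by simp
    have e: "(\<integral>\<omega>. W A \<omega> \<partial>P) = 0" by (rule normal_distributed_expectation[OF s D])
    have "variance (W A) = ?s\<^sup>2" by (rule normal_distributed_variance[OF s D])
    then have v: "(\<integral>\<omega>. (W A \<omega>)\<^sup>2 \<partial>P) = measure lborel A" using True by (simp add: e)
    have "integrable lborel (\<lambda>x. normal_density 0 ?s x * x)"
      by (rule integrable_normal_moment_nz_1[OF s])
    then have i1: "integrable P (\<lambda>\<omega>. W A \<omega>)"
      using distributed_integrable[OF D, of "\<lambda>x. x"] by simp
    have "integrable lborel (\<lambda>x. normal_density 0 ?s x * x\<^sup>2)"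
      using integrable_normal_moment[OF s, of 0 2] by simp
    then have i2: "integrable P (\<lambda>\<omega>. (W A \<omega>)\<^sup>2)"
      using distributed_integrable[OF D, of "\<lambda>x. x\<^sup>2"] by simp
    show ?thesis using e v i1 i2 by blast
  next
    case False
    then have m: "measure lborel A = 0" by (simp add: zero_less_measure_iff)
    have ae: "AE \<omega> in P. W A \<omega> = 0"
      using noise A False unfolding is_white_noise_def by presburger
    have "integrable P (W A)" by (subst integrable_cong_AE[of _ _ "\<lambda>_. 0"]) (use ae in auto)
    moreover have "integrable P (\<lambda>\<omega>. (W A \<omega>)\<^sup>2)" by (subst integrable_cong_AE[of _ _ "\<lambda>_. 0"]) (use ae in auto)
    moreover have "(\<integral>\<omega>. W A \<omega> \<partial>P) = (\<integral>\<omega>. 0 \<partial>P)" by (rule integral_cong_AE) (use ae in auto)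
    moreover have "(\<integral>\<omega>. (W A \<omega>)\<^sup>2 \<partial>P) = (\<integral>\<omega>. 0 \<partial>P)" by (rule integral_cong_AE) (use ae in auto)
    ultimately show ?thesis using m by simp
  qed
  then show "integrable P (W A)" and "integrable P (\<lambda>\<omega>. (W A \<omega>)\<^sup>2)" and "(\<integral>\<omega>. W A \<omega> \<partial>P) = 0"
    and "(\<integral>\<omega>. (W A \<omega>)\<^sup>2 \<partial>P) = measure lborel A" by auto
qed

lemma W_Un: "wn_set A \<Longrightarrow> wn_set B \<Longrightarrow> A \<inter> B = {} \<Longrightarrow> AE \<omega> in P. W (A \<union> B) \<omega> = W A \<omega> + W B \<omega>"
  using noise by (simp add: is_white_noise_def)

lemma W_adapted: "wn_set A \<Longrightarrow> A \<subseteq> {0..t} \<times> UNIV \<Longrightarrow> W A \<in> borel_measurable (F t)"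
  using noise by (simp add: is_white_noise_def)

lemma indep_var_F_W:
  assumes X: "X \<in> borel_measurable (F t)" and A: "wn_set A" "A \<subseteq> {t<..} \<times> UNIV"
  shows "indep_var borel X borel (W A)"
proof -
  have "indep_set (sets (F t)) {W A -` B \<inter> space P | B. B \<in> sets borel}"
    using noise A by (auto simp: is_white_noise_def)
  then have *: "indep_sets (case_bool (sets (F t)) {W A -` B \<inter> space P | B. B \<in> sets borel}) UNIV"
    by (simp add: indep_set_def)
  have "X -` B \<inter> space P \<in> sets (F t)" if "B \<in> sets borel" for B
    using measurable_sets[OF X that] subalgebra_F[of t] by (simp add: subalgebra_def)
  then have "indep_sets (\<lambda>i. {case_bool X (W A) i -` B \<inter> space P | B. B \<in> sets (case_bool borel borel i)}) UNIV"
    by (intro indep_sets_mono_sets[OF *]) (auto split: bool.split)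
  then show ?thesis
    unfolding indep_var_def indep_vars_def2 using measurable_F_P[OF X] W_measurable[OF A(1)]
    by (auto split: bool.split)
qed

text \<open>Integrability of \<open>X\<close> in place of boundedness matters, because
  \<open>X\<close> will also contain the noise of an earlier box.\<close>

lemma expectation_F_W:
  assumes X: "X \<in> borel_measurable (F t)" "integrable P X" and A: "wn_set A" "A \<subseteq> {t<..} \<times> UNIV"
  shows "integrable P (\<lambda>\<omega>. X \<omega> * W A \<omega>)" and "(\<integral>\<omega>. X \<omega> * W A \<omega> \<partial>P) = 0"
    and "integrable P (\<lambda>\<omega>. X \<omega> * (W A \<omega>)\<^sup>2)"
    and "(\<integral>\<omega>. X \<omega> * (W A \<omega>)\<^sup>2 \<partial>P) = (\<integral>\<omega>. X \<omega> \<partial>P) * measure lborel A"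
proof -
  note I = indep_var_F_W[OF X(1) A]
  have "indep_var borel (id \<circ> X) borel ((\<lambda>x. x\<^sup>2) \<circ> W A)"
    by (rule indep_var_compose[OF I]) auto
  then have I2: "indep_var borel X borel (\<lambda>\<omega>. (W A \<omega>)\<^sup>2)" by (simp add: comp_def)
  show "integrable P (\<lambda>\<omega>. X \<omega> * W A \<omega>)" by (rule indep_var_integrable[OF I X(2) W_law(1)[OF A(1)]])
  show "(\<integral>\<omega>. X \<omega> * W A \<omega> \<partial>P) = 0"
    using indep_var_lebesgue_integral[OF I X(2) W_law(1)[OF A(1)]] W_law(3)[OF A(1)] by simp
  show "integrable P (\<lambda>\<omega>. X \<omega> * (W A \<omega>)\<^sup>2)" by (rule indep_var_integrable[OF I2 X(2) W_law(2)[OF A(1)]])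
  show "(\<integral>\<omega>. X \<omega> * (W A \<omega>)\<^sup>2 \<partial>P) = (\<integral>\<omega>. X \<omega> \<partial>P) * measure lborel A"
    using indep_var_lebesgue_integral[OF I2 X(2) W_law(2)[OF A(1)]] W_law(4)[OF A(1)] by simp
qed

lemma wn_set_subset: "wn_set A \<Longrightarrow> B \<in> sets lborel \<Longrightarrow> B \<subseteq> A \<Longrightarrow> wn_set B"
  unfolding wn_set_def using emeasure_mono[of B A lborel] by (auto simp: le_less_trans)

lemma wn_set_Un: "wn_set A \<Longrightarrow> wn_set B \<Longrightarrow> wn_set (A \<union> B)"
  unfolding wn_set_def using emeasure_subadditive[of A lborel B] by (auto simp: le_less_trans)

text \<open>Independence of the past is only available for the noise of a single set, so products
  \<open>W C W D\<close> are reduced to squares by polarization: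
  \<open>2 W C W D = (W C)\<^sup>2 + (W D)\<^sup>2 - 2 (W (C - D))\<^sup>2 - 2 (W (D - C))\<^sup>2 + (W (C - D \<union> (D - C)))\<^sup>2\<close>.\<close>

lemma expectation_F_W_W:
  assumes X: "X \<in> borel_measurable (F t)" "integrable P X"
    and C: "wn_set C" "C \<subseteq> {t<..} \<times> UNIV" and D: "wn_set D" "D \<subseteq> {t<..} \<times> UNIV"
  shows "integrable P (\<lambda>\<omega>. X \<omega> * (W C \<omega> * W D \<omega>))"
    and "(\<integral>\<omega>. X \<omega> * (W C \<omega> * W D \<omega>) \<partial>P) = (\<integral>\<omega>. X \<omega> \<partial>P) * measure lborel (C \<inter> D)"
proof -
  note [measurable] = measurable_F_P[OF X(1)] W_measurable[OF C(1)] W_measurable[OF D(1)]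
  have sets: "C \<in> sets lborel" "D \<in> sets lborel" using C D by (auto simp: wn_set_def)
  let ?C = "C - D" and ?D = "D - C"
  have wC: "wn_set ?C" and wD: "wn_set ?D" and wI: "wn_set (C \<inter> D)"
    using sets by (auto intro: wn_set_subset[OF C(1)] wn_set_subset[OF D(1)])
  have wU: "wn_set (?C \<union> ?D)" by (rule wn_set_Un[OF wC wD])
  note [measurable] = W_measurable[OF wC] W_measurable[OF wD] W_measurable[OF wU]
  have sub: "?C \<subseteq> {t<..} \<times> UNIV" "?D \<subseteq> {t<..} \<times> UNIV" "?C \<union> ?D \<subseteq> {t<..} \<times> UNIV" using C D by auto
  have "AE \<omega> in P. W (?C \<union> (C \<inter> D)) \<omega> = W ?C \<omega> + W (C \<inter> D) \<omega>" by (rule W_Un[OF wC wI]) auto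
  moreover have "?C \<union> (C \<inter> D) = C" by auto
  ultimately have aC: "AE \<omega> in P. W C \<omega> = W ?C \<omega> + W (C \<inter> D) \<omega>" by simp
  have "AE \<omega> in P. W (?D \<union> (C \<inter> D)) \<omega> = W ?D \<omega> + W (C \<inter> D) \<omega>" by (rule W_Un[OF wD wI]) auto
  moreover have "?D \<union> (C \<inter> D) = D" by auto
  ultimately have aD: "AE \<omega> in P. W D \<omega> = W ?D \<omega> + W (C \<inter> D) \<omega>" by simp
  have aU: "AE \<omega> in P. W (?C \<union> ?D) \<omega> = W ?C \<omega> + W ?D \<omega>" by (rule W_Un[OF wC wD]) auto
  let ?R = "\<lambda>\<omega>. (X \<omega> * (W C \<omega>)\<^sup>2 + X \<omega> * (W D \<omega>)\<^sup>2 - 2 * (X \<omega> * (W ?C \<omega>)\<^sup>2) - 2 * (X \<omega> * (W ?D \<omega>)\<^sup>2)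
      + X \<omega> * (W (?C \<union> ?D) \<omega>)\<^sup>2) / 2"
  have ae: "AE \<omega> in P. X \<omega> * (W C \<omega> * W D \<omega>) = ?R \<omega>"
    using aC aD aU by eventually_elim (simp add: power2_eq_square algebra_simps)
  note i = expectation_F_W(3)[OF X C] expectation_F_W(3)[OF X D] expectation_F_W(3)[OF X wC sub(1)]
    expectation_F_W(3)[OF X wD sub(2)] expectation_F_W(3)[OF X wU sub(3)]
  note e = expectation_F_W(4)[OF X C] expectation_F_W(4)[OF X D] expectation_F_W(4)[OF X wC sub(1)]
    expectation_F_W(4)[OF X wD sub(2)] expectation_F_W(4)[OF X wU sub(3)]
  have iR: "integrable P ?R" using i by simp
  show "integrable P (\<lambda>\<omega>. X \<omega> * (W C \<omega> * W D \<omega>))"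
    by (subst integrable_cong_AE[OF _ _ ae]) (use iR in auto)
  have "(\<integral>\<omega>. X \<omega> * (W C \<omega> * W D \<omega>) \<partial>P) = (\<integral>\<omega>. ?R \<omega> \<partial>P)"
    by (rule integral_cong_AE[OF _ _ ae]) auto
  also have "\<dots> = (\<integral>\<omega>. X \<omega> \<partial>P) * (measure lborel C + measure lborel D - 2 * measure lborel ?C
      - 2 * measure lborel ?D + measure lborel (?C \<union> ?D)) / 2"
    using i e by (simp add: algebra_simps add_divide_distrib diff_divide_distrib)
  also have "measure lborel C + measure lborel D - 2 * measure lborel ?C
      - 2 * measure lborel ?D + measure lborel (?C \<union> ?D) = 2 * measure lborel (C \<inter> D)"
  proof -
    have fin: "emeasure lborel S \<noteq> \<infinity>" if "wn_set S" for S using that by (auto simp: wn_set_def)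
    have "measure lborel (?C \<union> ?D) = measure lborel ?C + measure lborel ?D"
      using sets by (intro measure_Union fin wC wD) auto
    moreover have "measure lborel (?C \<union> (C \<inter> D)) = measure lborel ?C + measure lborel (C \<inter> D)"
      using sets by (intro measure_Union fin wC wI) auto
    moreover have "measure lborel (?D \<union> (C \<inter> D)) = measure lborel ?D + measure lborel (C \<inter> D)"
      using sets by (intro measure_Union fin wD wI) auto
    moreover have "?C \<union> (C \<inter> D) = C" "?D \<union> (C \<inter> D) = D" by auto
    ultimately show ?thesis by simp
  qed
  finally show "(\<integral>\<omega>. X \<omega> * (W C \<omega> * W D \<omega>) \<partial>P) = (\<integral>\<omega>. X \<omega> \<partial>P) * measure lborel (C \<inter> D)" by simp
qed

end

section \<open>Isometry for elementary integrands\<close>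

lemma wn_set_box:
  fixes A :: "(real^'d::finite) set"
  assumes "0 \<le> a" and "A \<in> sets lborel" and "emeasure lborel A < \<infinity>"
  shows "wn_set ({a<..c} \<times> A)"
proof -
  have "{a<..c} \<times> A \<in> sets (borel \<Otimes>\<^sub>M borel)" using assms by simp
  then have "{a<..c} \<times> A \<in> sets borel" by (simp only: borel_prod)
  moreover have "emeasure lborel ({a<..c} \<times> A) = emeasure lborel {a<..c} * emeasure lborel A"
    unfolding lborel_prod[symmetric] using assms by (intro lborel.emeasure_pair_measure_Times) auto
  moreover have "emeasure lborel {a<..c} < \<infinity>" by (cases "a \<le> c") auto
  ultimately show ?thesis
    using assms by (auto simp: wn_set_def ennreal_mult_less_top)
qed

lemma integral_double_sum:
  fixes f :: "nat \<Rightarrow> nat \<Rightarrow> 'a \<Rightarrow> real"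
  assumes f: "\<And>i j. i < n \<Longrightarrow> j < n \<Longrightarrow> integrable M (f i j)"
  shows "integrable M (\<lambda>x. \<Sum>i<n. \<Sum>j<n. f i j x)"
    and "(\<integral>x. (\<Sum>i<n. \<Sum>j<n. f i j x) \<partial>M) = (\<Sum>i<n. \<Sum>j<n. \<integral>x. f i j x \<partial>M)"
proof -
  have i: "integrable M (\<lambda>x. \<Sum>j<n. f i j x)" if "i < n" for i
    using f that by (intro Bochner_Integration.integrable_sum) auto
  show "integrable M (\<lambda>x. \<Sum>i<n. \<Sum>j<n. f i j x)"
    by (rule Bochner_Integration.integrable_sum) (use i in auto)
  have "(\<integral>x. (\<Sum>i<n. \<Sum>j<n. f i j x) \<partial>M) = (\<Sum>i<n. \<integral>x. (\<Sum>j<n. f i j x) \<partial>M)"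
    using i by (intro Bochner_Integration.integral_sum) auto
  also have "\<dots> = (\<Sum>i<n. \<Sum>j<n. \<integral>x. f i j x \<partial>M)"
    using f by (intro sum.cong refl Bochner_Integration.integral_sum) auto
  finally show "(\<integral>x. (\<Sum>i<n. \<Sum>j<n. f i j x) \<partial>M) = (\<Sum>i<n. \<Sum>j<n. \<integral>x. f i j x \<partial>M)" .
qed

context white_noise begin

definition box :: "real \<Rightarrow> ('w \<Rightarrow> real) \<times> real \<times> real \<times> (real^'d) set \<Rightarrow> (real \<times> (real^'d)) set" where
  "box t p = {fst (snd p)<..min (fst (snd (snd p))) t} \<times> snd (snd (snd p))"

lemma elem_okD:
  assumes "elem_ok P F p"
  shows "wn_set (box t p)" and "fst p \<in> borel_measurable (F (fst (snd p)))" and "0 \<le> fst (snd p)"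
    and "\<exists>K. \<forall>\<omega>\<in>space P. \<bar>fst p \<omega>\<bar> \<le> K"
  using assms by (auto simp: elem_ok_def box_def bounded_iff case_prod_beta intro!: wn_set_box)

lemma integrable_bounded_mult:
  fixes X Y :: "'w \<Rightarrow> real"
  assumes "X \<in> borel_measurable P" "\<And>\<omega>. \<omega> \<in> space P \<Longrightarrow> \<bar>X \<omega>\<bar> \<le> K" and Y: "integrable P Y"
  shows "integrable P (\<lambda>\<omega>. X \<omega> * Y \<omega>)"
proof (rule Bochner_Integration.integrable_bound)
  show "integrable P (\<lambda>\<omega>. K * \<bar>Y \<omega>\<bar>)" using Y by simp
  show "AE \<omega> in P. norm (X \<omega> * Y \<omega>) \<le> norm (K * \<bar>Y \<omega>\<bar>)"
  proof (rule AE_I2)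
    fix \<omega> assume "\<omega> \<in> space P"
    then have "\<bar>X \<omega>\<bar> * \<bar>Y \<omega>\<bar> \<le> K * \<bar>Y \<omega>\<bar>" using assms by (intro mult_right_mono) auto
    also have "\<dots> \<le> \<bar>K * \<bar>Y \<omega>\<bar>\<bar>" by (rule abs_ge_self)
    finally show "norm (X \<omega> * Y \<omega>) \<le> norm (K * \<bar>Y \<omega>\<bar>)" by (simp only: real_norm_def abs_mult)
  qed
qed (use assms in auto)

text \<open>By symmetry the first box may be assumed to start no later than the second. Cut at the
  later starting time, its early part belongs to the past and pairs to zero with the second noise;
  its late part meets the second box in the full intersection of the two.\<close>

lemma elem_pair_expectation:
  assumes p: "elem_ok P F p" and p': "elem_ok P F p'"
  shows "integrable P (\<lambda>\<omega>. (fst p \<omega> * W (box t p) \<omega>) * (fst p' \<omega> * W (box t p') \<omega>)) \<and>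
    (\<integral>\<omega>. (fst p \<omega> * W (box t p) \<omega>) * (fst p' \<omega> * W (box t p') \<omega>) \<partial>P) =
    (\<integral>\<omega>. fst p \<omega> * fst p' \<omega> \<partial>P) * measure lborel (box t p \<inter> box t p')"
proof -
  have ordered: "integrable P (\<lambda>\<omega>. (fst p \<omega> * W (box t p) \<omega>) * (fst p' \<omega> * W (box t p') \<omega>)) \<and>
    (\<integral>\<omega>. (fst p \<omega> * W (box t p) \<omega>) * (fst p' \<omega> * W (box t p') \<omega>) \<partial>P) =
    (\<integral>\<omega>. fst p \<omega> * fst p' \<omega> \<partial>P) * measure lborel (box t p \<inter> box t p')"
    if p: "elem_ok P F p" and p': "elem_ok P F p'" and le: "fst (snd p) \<le> fst (snd p')" for p p'
  proof -
    obtain Z a c A where pe: "p = (Z, a, c, A)" by (cases p) auto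
    obtain Z' a' c' A' where pe': "p' = (Z', a', c', A')" by (cases p') auto
    let ?B = "box t p" and ?B' = "box t p'"
    \<comment> \<open>The cut is at \<open>a'\<close>: the noise of \<open>?B1\<close> is measurable
      with respect to \<open>F a'\<close>, and \<open>?B2\<close> lies strictly after
      \<open>a'\<close>.\<close>
    let ?B1 = "{a<..min (min c t) a'} \<times> A" and ?B2 = "{a'<..min c t} \<times> A"
    have aa: "a \<le> a'" using le by (simp add: pe pe')
    have ok: "0 \<le> a" "A \<in> sets lborel" "emeasure lborel A < \<infinity>" "0 \<le> a'"
      using p p' by (auto simp: elem_ok_def pe pe')
    have w: "wn_set ?B" "wn_set ?B'" using elem_okD p p' by auto
    have w1: "wn_set ?B1" "wn_set ?B2" using ok by (auto intro!: wn_set_box)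
    define X where "X \<omega> = Z \<omega> * Z' \<omega>" for \<omega>
    have XF: "X \<in> borel_measurable (F a')"
      using elem_okD(2)[OF p] elem_okD(2)[OF p'] measurable_F_mono[OF aa]
      unfolding X_def by (intro borel_measurable_times) (auto simp: pe pe')
    obtain K where K: "\<forall>\<omega>\<in>space P. \<bar>Z \<omega>\<bar> \<le> K" using elem_okD(4)[OF p] by (auto simp: pe)
    obtain K' where K': "\<forall>\<omega>\<in>space P. \<bar>Z' \<omega>\<bar> \<le> K'" using elem_okD(4)[OF p'] by (auto simp: pe')
    have XK: "\<bar>X \<omega>\<bar> \<le> K * K'" if "\<omega> \<in> space P" for \<omega>
    proof -
      have "\<bar>Z \<omega>\<bar> * \<bar>Z' \<omega>\<bar> \<le> K * K'"
      proof (rule mult_mono)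
        show "\<bar>Z \<omega>\<bar> \<le> K" "\<bar>Z' \<omega>\<bar> \<le> K'" using K K' that by auto
        then show "0 \<le> K" "0 \<le> \<bar>Z' \<omega>\<bar>" by linarith+
      qed
      then show ?thesis by (simp add: X_def abs_mult)
    qed
    note XP = measurable_F_P[OF XF]
    have Xi: "integrable P X" using XP XK by (intro integrable_const_bound[of _ "K * K'"]) auto
    have XB1: "integrable P (\<lambda>\<omega>. X \<omega> * W ?B1 \<omega>)"
      by (rule integrable_bounded_mult[OF XP XK W_law(1)[OF w1(1)]])
    have XB1F: "(\<lambda>\<omega>. X \<omega> * W ?B1 \<omega>) \<in> borel_measurable (F a')"
      using ok by (intro borel_measurable_times XF W_adapted w1) auto
    have sub: "?B' \<subseteq> {a'<..} \<times> UNIV" "?B2 \<subseteq> {a'<..} \<times> UNIV" by (auto simp: box_def pe')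
    have BB: "?B1 \<union> ?B2 = ?B" using aa by (auto simp: box_def pe)
    have "AE \<omega> in P. W (?B1 \<union> ?B2) \<omega> = W ?B1 \<omega> + W ?B2 \<omega>" by (rule W_Un[OF w1]) auto
    then have ae: "AE \<omega> in P. (fst p \<omega> * W ?B \<omega>) * (fst p' \<omega> * W ?B' \<omega>) =
        (X \<omega> * W ?B1 \<omega>) * W ?B' \<omega> + X \<omega> * (W ?B2 \<omega> * W ?B' \<omega>)"
      unfolding BB by eventually_elim (simp add: X_def pe pe' algebra_simps)
    have m: "(\<lambda>\<omega>. (fst p \<omega> * W ?B \<omega>) * (fst p' \<omega> * W ?B' \<omega>)) \<in> borel_measurable P"
      using measurable_F_P[OF elem_okD(2)[OF p]] measurable_F_P[OF elem_okD(2)[OF p']] W_measurable w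
      by (intro borel_measurable_times) auto
    have inter: "?B2 \<inter> ?B' = ?B \<inter> ?B'" using aa by (auto simp: box_def pe pe')
    note i1 = expectation_F_W[OF XB1F XB1 w(2) sub(1)]
    note i2 = expectation_F_W_W[OF XF Xi w1(2) sub(2) w(2) sub(1)]
    have iR: "integrable P (\<lambda>\<omega>. (X \<omega> * W ?B1 \<omega>) * W ?B' \<omega> + X \<omega> * (W ?B2 \<omega> * W ?B' \<omega>))"
      using i1(1) i2(1) by simp
    then have "integrable P (\<lambda>\<omega>. (fst p \<omega> * W ?B \<omega>) * (fst p' \<omega> * W ?B' \<omega>))"
      using m ae by (subst integrable_cong_AE[OF _ _ ae]) auto
    moreover have "(\<integral>\<omega>. (fst p \<omega> * W ?B \<omega>) * (fst p' \<omega> * W ?B' \<omega>) \<partial>P) =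
       (\<integral>\<omega>. (X \<omega> * W ?B1 \<omega>) * W ?B' \<omega> + X \<omega> * (W ?B2 \<omega> * W ?B' \<omega>) \<partial>P)"
      by (rule integral_cong_AE[OF m borel_measurable_integrable[OF iR] ae])
    moreover have "\<dots> = (\<integral>\<omega>. X \<omega> \<partial>P) * measure lborel (?B \<inter> ?B')"
      using i1 i2 inter by simp
    ultimately show ?thesis by (simp add: X_def pe pe')
  qed
  show ?thesis
  proof (cases "fst (snd p) \<le> fst (snd p')")
    case True
    then show ?thesis by (rule ordered[OF p p'])
  next
    case False
    then have "fst (snd p') \<le> fst (snd p)" by simp
    from ordered[OF p' p this] show ?thesis
      by (simp add: mult.commute Int_commute)
  qed
qed

lemma simple_walsh_eq_sum: "simple_walsh W t ps \<omega> = (\<Sum>i<length ps. fst (ps ! i) \<omega> * W (box t (ps ! i)) \<omega>)"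
  unfolding simple_walsh_def box_def
  by (simp add: sum_list_sum_nth case_prod_beta atLeast0LessThan)

lemma simple_field_eq_sum:
  assumes "\<And>p. p \<in> set ps \<Longrightarrow> elem_ok P F p"
  shows "indicator ({0..t} \<times> UNIV) ry * simple_field ps (fst ry) (snd ry) \<omega> =
    (\<Sum>i<length ps. fst (ps ! i) \<omega> * indicator (box t (ps ! i)) ry)"
proof -
  have ind: "indicator ({0..t} \<times> UNIV) ry * (fst p \<omega> * indicator {fst (snd p)<..fst (snd (snd p))} (fst ry) * indicator (snd (snd (snd p))) (snd ry))
      = fst p \<omega> * indicator (box t p) ry" if "elem_ok P F p" for p
    using elem_okD(3)[OF that] by (cases ry) (auto simp: box_def indicator_def)
  have sf: "simple_field ps (fst ry) (snd ry) \<omega> = (\<Sum>i<length ps. fst (ps ! i) \<omega> *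
      indicator {fst (snd (ps ! i))<..fst (snd (snd (ps ! i)))} (fst ry) * indicator (snd (snd (snd (ps ! i)))) (snd ry))"
    unfolding simple_field_def sum_list_sum_nth length_map atLeast0LessThan
    by (intro sum.cong) (auto simp: case_prod_beta)
  show ?thesis
    unfolding sf sum_distrib_left by (intro sum.cong refl ind assms) auto
qed

lemma simple_field_square_integral:
  assumes ok: "\<And>p. p \<in> set ps \<Longrightarrow> elem_ok P F p"
  shows "(\<Sum>i<length ps. \<Sum>j<length ps. fst (ps ! i) \<omega> * fst (ps ! j) \<omega> * measure lborel (box t (ps ! i) \<inter> box t (ps ! j))) =
      (\<integral>ry. (indicator ({0..t} \<times> UNIV) ry * simple_field ps (fst ry) (snd ry) \<omega>)\<^sup>2 \<partial>lborel) \<and>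
      integrable lborel (\<lambda>ry. (indicator ({0..t} \<times> UNIV) ry * simple_field ps (fst ry) (snd ry) \<omega>)\<^sup>2)"
proof -
  let ?n = "length ps" and ?B = "\<lambda>i. box t (ps ! i)" and ?Z = "\<lambda>i. fst (ps ! i)"
  have oki: "elem_ok P F (ps ! i)" if "i < ?n" for i using ok that by simp
  have e: "(indicator ({0..t} \<times> UNIV) ry * simple_field ps (fst ry) (snd ry) \<omega>)\<^sup>2 =
      (\<Sum>i<?n. \<Sum>j<?n. ?Z i \<omega> * ?Z j \<omega> * indicator (?B i \<inter> ?B j) ry)" for ry
  proof -
    have f: "indicator ({0..t} \<times> UNIV) ry * simple_field ps (fst ry) (snd ry) \<omega> =
        (\<Sum>i<?n. ?Z i \<omega> * indicator (?B i) ry)"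
      by (rule simple_field_eq_sum[OF ok])
    have "(\<Sum>i<?n. ?Z i \<omega> * indicator (?B i) ry) * (\<Sum>j<?n. ?Z j \<omega> * indicator (?B j) ry) =
        (\<Sum>i<?n. \<Sum>j<?n. (?Z i \<omega> * indicator (?B i) ry) * (?Z j \<omega> * indicator (?B j) ry))"
      by (rule sum_product)
    also have "\<dots> = (\<Sum>i<?n. \<Sum>j<?n. ?Z i \<omega> * ?Z j \<omega> * indicator (?B i \<inter> ?B j) ry)"
    proof (intro sum.cong refl)
      fix i j
      show "(?Z i \<omega> * indicator (?B i) ry) * (?Z j \<omega> * indicator (?B j) ry) = ?Z i \<omega> * ?Z j \<omega> * indicator (?B i \<inter> ?B j) ry"
        by (cases "ry \<in> ?B i"; cases "ry \<in> ?B j"; simp only: indicator_simps Int_iff simp_thms mult_1_right mult_zero_right mult_zero_left not_True_eq_False not_False_eq_True)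
    qed
    finally show ?thesis unfolding f power2_eq_square .
  qed
  have fin: "integrable lborel (\<lambda>ry. indicat_real (box t (ps ! i) \<inter> box t (ps ! j)) ry)" if "i < ?n" "j < ?n" for i j
  proof -
    have wi: "wn_set (?B i)" and wj: "wn_set (?B j)"
      by (rule elem_okD(1)[OF oki[OF that(1)]], rule elem_okD(1)[OF oki[OF that(2)]])
    then have s: "?B i \<inter> ?B j \<in> sets lborel" unfolding wn_set_def by (intro sets.Int) blast+
    then have "wn_set (?B i \<inter> ?B j)" by (rule wn_set_subset[OF wi _ Int_lower1])
    then have "emeasure lborel (?B i \<inter> ?B j) < \<infinity>" unfolding wn_set_def by blast
    then show ?thesis by (rule integrable_real_indicator[OF s])
  qed
  have 1: "integrable lborel (\<lambda>ry. \<Sum>i<?n. \<Sum>j<?n. ?Z i \<omega> * ?Z j \<omega> * indicator (?B i \<inter> ?B j) ry)"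
    by (intro integral_double_sum(1) integrable_mult_right fin)
  have 2: "(\<integral>ry. (\<Sum>i<?n. \<Sum>j<?n. ?Z i \<omega> * ?Z j \<omega> * indicator (?B i \<inter> ?B j) ry) \<partial>lborel) =
      (\<Sum>i<?n. \<Sum>j<?n. ?Z i \<omega> * ?Z j \<omega> * measure lborel (?B i \<inter> ?B j))"
    by (subst integral_double_sum(2), rule integrable_mult_right, rule fin, assumption, assumption)
      (simp only: integral_mult_right_zero Bochner_Integration.integral_indicator space_lborel space_borel Int_UNIV_right)
  show ?thesis unfolding e by (rule conjI[OF 2[symmetric] 1])
qed

text \<open>The boxes may overlap. Instead of refining them to a disjoint family, both squares are
  expanded into double sums, whose entries agree because pairs of boxes contribute the measure of
  their intersection.\<close>

lemma simple_walsh_isometry: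
  assumes ok: "\<And>p. p \<in> set ps \<Longrightarrow> elem_ok P F p"
  shows "(\<integral>\<^sup>+\<omega>. ennreal ((simple_walsh W t ps \<omega>)\<^sup>2) \<partial>P) =
    (\<integral>\<^sup>+\<omega>. (\<integral>\<^sup>+ry. ennreal ((indicator ({0..t} \<times> UNIV) ry * simple_field ps (fst ry) (snd ry) \<omega>)\<^sup>2) \<partial>lborel) \<partial>P)"
proof -
  let ?n = "length ps" and ?B = "\<lambda>i. box t (ps ! i)" and ?Z = "\<lambda>i. fst (ps ! i)"
  have oki: "elem_ok P F (ps ! i)" if "i < ?n" for i using ok that by simp
  note pair = elem_pair_expectation[OF oki oki]
  have sq: "(simple_walsh W t ps \<omega>)\<^sup>2 = (\<Sum>i<?n. \<Sum>j<?n. (?Z i \<omega> * W (?B i) \<omega>) * (?Z j \<omega> * W (?B j) \<omega>))" for \<omega>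
    unfolding simple_walsh_eq_sum power2_eq_square by (rule sum_product)
  have int_sq: "integrable P (\<lambda>\<omega>. (simple_walsh W t ps \<omega>)\<^sup>2)"
    unfolding sq by (rule integral_double_sum(1)) (rule pair[THEN conjunct1])
  have ZZ: "integrable P (\<lambda>\<omega>. ?Z i \<omega> * ?Z j \<omega>)" if ij: "i < ?n" "j < ?n" for i j
  proof -
    obtain K where K: "\<forall>\<omega>\<in>space P. \<bar>?Z i \<omega>\<bar> \<le> K" using elem_okD(4)[OF oki[OF ij(1)]] by auto
    obtain K' where K': "\<forall>\<omega>\<in>space P. \<bar>?Z j \<omega>\<bar> \<le> K'" using elem_okD(4)[OF oki[OF ij(2)]] by auto
    note m = measurable_F_P[OF elem_okD(2)[OF oki]]
    have "integrable P (?Z j)" using m[OF ij(2)] K' by (intro integrable_const_bound[of _ K']) auto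
    then show ?thesis using m[OF ij(1)] K by (intro integrable_bounded_mult[of _ K]) auto
  qed
  note * = simple_field_square_integral[where ps = ps and t = t, OF ok]
  have "(\<integral>\<^sup>+\<omega>. ennreal ((simple_walsh W t ps \<omega>)\<^sup>2) \<partial>P) = ennreal (\<integral>\<omega>. (simple_walsh W t ps \<omega>)\<^sup>2 \<partial>P)"
    by (rule nn_integral_eq_integral[OF int_sq]) auto
  also have "(\<integral>\<omega>. (simple_walsh W t ps \<omega>)\<^sup>2 \<partial>P) = (\<Sum>i<?n. \<Sum>j<?n. (\<integral>\<omega>. ?Z i \<omega> * ?Z j \<omega> \<partial>P) * measure lborel (?B i \<inter> ?B j))"
    unfolding sq
    by (subst integral_double_sum(2), rule pair[THEN conjunct1], assumption, assumption)
      (intro sum.cong refl pair[THEN conjunct2], simp_all only: lessThan_iff)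
  also have "\<dots> = (\<integral>\<omega>. (\<Sum>i<?n. \<Sum>j<?n. ?Z i \<omega> * ?Z j \<omega> * measure lborel (?B i \<inter> ?B j)) \<partial>P)"
    by (subst integral_double_sum(2), rule integrable_mult_left, rule ZZ, assumption, assumption)
      (simp only: integral_mult_left_zero)
  also have "ennreal \<dots> = (\<integral>\<^sup>+\<omega>. ennreal (\<Sum>i<?n. \<Sum>j<?n. ?Z i \<omega> * ?Z j \<omega> * measure lborel (?B i \<inter> ?B j)) \<partial>P)"
  proof (rule nn_integral_eq_integral[symmetric])
    show "integrable P (\<lambda>\<omega>. \<Sum>i<?n. \<Sum>j<?n. ?Z i \<omega> * ?Z j \<omega> * measure lborel (?B i \<inter> ?B j))"
      by (intro integral_double_sum(1) integrable_mult_left ZZ)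
    show "AE \<omega> in P. 0 \<le> (\<Sum>i<?n. \<Sum>j<?n. ?Z i \<omega> * ?Z j \<omega> * measure lborel (?B i \<inter> ?B j))"
    proof (rule AE_I2)
      fix \<omega>
      show "0 \<le> (\<Sum>i<?n. \<Sum>j<?n. ?Z i \<omega> * ?Z j \<omega> * measure lborel (?B i \<inter> ?B j))"
        by (rule ord_le_eq_trans[OF integral_nonneg_AE *[THEN conjunct1, symmetric]]) simp_all
    qed
  qed
  also have "(\<integral>\<^sup>+\<omega>. ennreal (\<Sum>i<?n. \<Sum>j<?n. ?Z i \<omega> * ?Z j \<omega> * measure lborel (?B i \<inter> ?B j)) \<partial>P) =
      (\<integral>\<^sup>+\<omega>. (\<integral>\<^sup>+ry. ennreal ((indicator ({0..t} \<times> UNIV) ry * simple_field ps (fst ry) (snd ry) \<omega>)\<^sup>2) \<partial>lborel) \<partial>P)"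
    proof (rule nn_integral_cong)
      fix \<omega>
      show "ennreal (\<Sum>i<?n. \<Sum>j<?n. ?Z i \<omega> * ?Z j \<omega> * measure lborel (?B i \<inter> ?B j)) =
        (\<integral>\<^sup>+ry. ennreal ((indicator ({0..t} \<times> UNIV) ry * simple_field ps (fst ry) (snd ry) \<omega>)\<^sup>2) \<partial>lborel)"
        by (rule trans[OF arg_cong[where f = ennreal, OF *[THEN conjunct1]] nn_integral_eq_integral[symmetric, OF *[THEN conjunct2]]]) simp_all
    qed
  finally show ?thesis .
qed

end

section \<open>Passage to the limit in the isometry\<close>

lemma square_le_weighted:
  fixes x y e :: real
  assumes "0 < e"
  shows "x\<^sup>2 \<le> (1 + e) * y\<^sup>2 + (1 + 1 / e) * (x - y)\<^sup>2"
proof -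
  have "0 \<le> (e * y - (x - y))\<^sup>2 / e" using assms by simp
  also have "(e * y - (x - y))\<^sup>2 / e = (1 + e) * y\<^sup>2 + (1 + 1 / e) * (x - y)\<^sup>2 - x\<^sup>2"
    using assms by (simp add: power2_eq_square field_simps)
  finally show ?thesis by simp
qed

lemma nn_integral_square_le_weighted:
  fixes x y :: "'a \<Rightarrow> real"
  assumes e: "0 < e" and [measurable]: "x \<in> borel_measurable M" "y \<in> borel_measurable M"
  shows "(\<integral>\<^sup>+\<omega>. ennreal ((x \<omega>)\<^sup>2) \<partial>M) \<le>
    ennreal (1 + e) * (\<integral>\<^sup>+\<omega>. ennreal ((y \<omega>)\<^sup>2) \<partial>M) + ennreal (1 + 1 / e) * (\<integral>\<^sup>+\<omega>. ennreal ((x \<omega> - y \<omega>)\<^sup>2) \<partial>M)"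
proof -
  have "(\<integral>\<^sup>+\<omega>. ennreal ((x \<omega>)\<^sup>2) \<partial>M) \<le>
      (\<integral>\<^sup>+\<omega>. ennreal (1 + e) * ennreal ((y \<omega>)\<^sup>2) + ennreal (1 + 1 / e) * ennreal ((x \<omega> - y \<omega>)\<^sup>2) \<partial>M)"
  proof (rule nn_integral_mono)
    fix \<omega>
    have "ennreal ((x \<omega>)\<^sup>2) \<le> ennreal ((1 + e) * (y \<omega>)\<^sup>2 + (1 + 1 / e) * (x \<omega> - y \<omega>)\<^sup>2)"
      by (rule ennreal_leI[OF square_le_weighted[OF e]])
    also have "\<dots> = ennreal ((1 + e) * (y \<omega>)\<^sup>2) + ennreal ((1 + 1 / e) * (x \<omega> - y \<omega>)\<^sup>2)"
      using e by (intro ennreal_plus) auto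
    also have "\<dots> = ennreal (1 + e) * ennreal ((y \<omega>)\<^sup>2) + ennreal (1 + 1 / e) * ennreal ((x \<omega> - y \<omega>)\<^sup>2)"
      by (simp only: ennreal_mult'' zero_le_power2)
    finally show "ennreal ((x \<omega>)\<^sup>2) \<le> ennreal (1 + e) * ennreal ((y \<omega>)\<^sup>2) + ennreal (1 + 1 / e) * ennreal ((x \<omega> - y \<omega>)\<^sup>2)" .
  qed
  also have "\<dots> = ennreal (1 + e) * (\<integral>\<^sup>+\<omega>. ennreal ((y \<omega>)\<^sup>2) \<partial>M) + ennreal (1 + 1 / e) * (\<integral>\<^sup>+\<omega>. ennreal ((x \<omega> - y \<omega>)\<^sup>2) \<partial>M)"
    by (simp add: nn_integral_add nn_integral_cmult)
  finally show ?thesis .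
qed

text \<open>Working with \<open>x\<^sup>2 \<le> (1 + e) y\<^sup>2 + (1 + 1/e) (x - y)\<^sup>2\<close> instead of Minkowski's inequality
  avoids any finiteness assumption.\<close>

lemma isometric_limit_le:
  fixes f :: "'a \<Rightarrow> real" and g :: "'b \<Rightarrow> real"
  assumes [measurable]: "f \<in> borel_measurable M" "g \<in> borel_measurable N"
      "\<And>n. fs n \<in> borel_measurable M" "\<And>n. gs n \<in> borel_measurable N"
    and eq: "\<And>n. (\<integral>\<^sup>+\<omega>. ennreal ((fs n \<omega>)\<^sup>2) \<partial>M) = (\<integral>\<^sup>+\<omega>. ennreal ((gs n \<omega>)\<^sup>2) \<partial>N)"
    and f: "(\<lambda>n. \<integral>\<^sup>+\<omega>. ennreal ((f \<omega> - fs n \<omega>)\<^sup>2) \<partial>M) \<longlonglongrightarrow> 0"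
    and g: "(\<lambda>n. \<integral>\<^sup>+\<omega>. ennreal ((g \<omega> - gs n \<omega>)\<^sup>2) \<partial>N) \<longlonglongrightarrow> 0"
  shows "(\<integral>\<^sup>+\<omega>. ennreal ((f \<omega>)\<^sup>2) \<partial>M) \<le> (\<integral>\<^sup>+\<omega>. ennreal ((g \<omega>)\<^sup>2) \<partial>N)"
proof -
  let ?F = "\<integral>\<^sup>+\<omega>. ennreal ((f \<omega>)\<^sup>2) \<partial>M" and ?G = "\<integral>\<^sup>+\<omega>. ennreal ((g \<omega>)\<^sup>2) \<partial>N"
  have step: "?F \<le> ennreal (1 + e) * (ennreal (1 + e) * ?G)" if e: "0 < e" for e
  proof -
    let ?a = "\<lambda>n. \<integral>\<^sup>+\<omega>. ennreal ((f \<omega> - fs n \<omega>)\<^sup>2) \<partial>M" and ?b = "\<lambda>n. \<integral>\<^sup>+\<omega>. ennreal ((g \<omega> - gs n \<omega>)\<^sup>2) \<partial>N"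
    have "?F \<le> ennreal (1 + e) * (ennreal (1 + e) * ?G + ennreal (1 + 1 / e) * ?b n) + ennreal (1 + 1 / e) * ?a n" for n
    proof -
      have "?F \<le> ennreal (1 + e) * (\<integral>\<^sup>+\<omega>. ennreal ((fs n \<omega>)\<^sup>2) \<partial>M) + ennreal (1 + 1 / e) * ?a n"
        by (rule nn_integral_square_le_weighted[OF e]) measurable
      also have "(\<integral>\<^sup>+\<omega>. ennreal ((fs n \<omega>)\<^sup>2) \<partial>M) \<le> ennreal (1 + e) * ?G + ennreal (1 + 1 / e) * (\<integral>\<^sup>+\<omega>. ennreal ((gs n \<omega> - g \<omega>)\<^sup>2) \<partial>N)"
        unfolding eq by (rule nn_integral_square_le_weighted[OF e]) measurable
      also have "(\<lambda>\<omega>. ennreal ((gs n \<omega> - g \<omega>)\<^sup>2)) = (\<lambda>\<omega>. ennreal ((g \<omega> - gs n \<omega>)\<^sup>2))"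
        by (simp add: power2_commute)
      finally show ?thesis by (simp add: mult_left_mono add_right_mono)
    qed
    moreover have "(\<lambda>n. ennreal (1 + e) * (ennreal (1 + e) * ?G + ennreal (1 + 1 / e) * ?b n) + ennreal (1 + 1 / e) * ?a n)
        \<longlonglongrightarrow> ennreal (1 + e) * (ennreal (1 + e) * ?G + ennreal (1 + 1 / e) * 0) + ennreal (1 + 1 / e) * 0"
      using f g by (intro tendsto_add ennreal_tendsto_cmult tendsto_const) auto
    ultimately show ?thesis
      by (intro LIMSEQ_le_const[of _ "ennreal (1 + e) * (ennreal (1 + e) * ?G)"]) auto
  qed
  show ?thesis
  proof (cases "?G = \<infinity>")
    case False
    then obtain G where G: "?G = ennreal G" "0 \<le> G" by (cases ?G) auto
    have "(\<lambda>n. ennreal ((1 + 1 / real (Suc n)) * ((1 + 1 / real (Suc n)) * G))) \<longlonglongrightarrow> ennreal ((1 + 0) * ((1 + 0) * G))"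
      by (intro tendsto_ennrealI tendsto_intros LIMSEQ_Suc[OF lim_1_over_n])
    moreover have "?F \<le> ennreal ((1 + e) * ((1 + e) * G))" if "0 < e" for e
      using step[OF that] that G by (simp add: ennreal_mult' del: ennreal_plus)
    then have "?F \<le> ennreal ((1 + 1 / real (Suc n)) * ((1 + 1 / real (Suc n)) * G))" for n by simp
    ultimately show ?thesis unfolding G(1)
      by (intro LIMSEQ_le_const[of "\<lambda>n. ennreal ((1 + 1 / real (Suc n)) * ((1 + 1 / real (Suc n)) * G))"]) auto
  qed simp
qed

lemma isometric_limit:
  fixes f :: "'a \<Rightarrow> real" and g :: "'b \<Rightarrow> real"
  assumes "f \<in> borel_measurable M" "g \<in> borel_measurable N"
      "\<And>n. fs n \<in> borel_measurable M" "\<And>n. gs n \<in> borel_measurable N"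
    and "\<And>n. (\<integral>\<^sup>+\<omega>. ennreal ((fs n \<omega>)\<^sup>2) \<partial>M) = (\<integral>\<^sup>+\<omega>. ennreal ((gs n \<omega>)\<^sup>2) \<partial>N)"
    and "(\<lambda>n. \<integral>\<^sup>+\<omega>. ennreal ((f \<omega> - fs n \<omega>)\<^sup>2) \<partial>M) \<longlonglongrightarrow> 0"
    and "(\<lambda>n. \<integral>\<^sup>+\<omega>. ennreal ((g \<omega> - gs n \<omega>)\<^sup>2) \<partial>N) \<longlonglongrightarrow> 0"
  shows "(\<integral>\<^sup>+\<omega>. ennreal ((f \<omega>)\<^sup>2) \<partial>M) = (\<integral>\<^sup>+\<omega>. ennreal ((g \<omega>)\<^sup>2) \<partial>N)"
  using assms by (intro antisym; intro isometric_limit_le[where fs = fs and gs = gs] isometric_limit_le[where fs = gs and gs = fs]) auto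

context white_noise begin

lemma simple_walsh_measurable:
  assumes ok: "\<And>p. p \<in> set ps \<Longrightarrow> elem_ok P F p"
  shows "simple_walsh W t ps \<in> borel_measurable P"
proof -
  have "(\<lambda>\<omega>. \<Sum>i<length ps. fst (ps ! i) \<omega> * W (box t (ps ! i)) \<omega>) \<in> borel_measurable P"
  proof (intro borel_measurable_sum borel_measurable_times)
    fix i assume "i \<in> {..<length ps}"
    then have "elem_ok P F (ps ! i)" using ok by simp
    from measurable_F_P[OF elem_okD(2)[OF this]] W_measurable[OF elem_okD(1)[OF this]]
    show "fst (ps ! i) \<in> borel_measurable P" "W (box t (ps ! i)) \<in> borel_measurable P" by simp_all
  qed
  then show ?thesis by (subst measurable_cong[of P _ _ borel, OF simple_walsh_eq_sum])
qed

lemma simple_walsh_mean_zero: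
  assumes ok: "\<And>p. p \<in> set ps \<Longrightarrow> elem_ok P F p"
  shows "integrable P (simple_walsh W t ps)" and "(\<integral>\<omega>. simple_walsh W t ps \<omega> \<partial>P) = 0"
proof -
  have one: "integrable P (\<lambda>\<omega>. fst p \<omega> * W (box t p) \<omega>) \<and> (\<integral>\<omega>. fst p \<omega> * W (box t p) \<omega> \<partial>P) = 0" if p: "elem_ok P F p" for p
  proof -
    obtain K where K: "\<forall>\<omega>\<in>space P. \<bar>fst p \<omega>\<bar> \<le> K" using elem_okD(4)[OF p] by auto
    have "integrable P (fst p)"
      using measurable_F_P[OF elem_okD(2)[OF p]] K by (intro integrable_const_bound[of _ K]) auto
    moreover have "box t p \<subseteq> {fst (snd p)<..} \<times> UNIV" by (auto simp: box_def)
    ultimately show ?thesis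
      using expectation_F_W(1,2)[OF elem_okD(2)[OF p] _ elem_okD(1)[OF p]] by blast
  qed
  have i: "integrable P (\<lambda>\<omega>. fst (ps ! i) \<omega> * W (box t (ps ! i)) \<omega>)"
    "(\<integral>\<omega>. fst (ps ! i) \<omega> * W (box t (ps ! i)) \<omega> \<partial>P) = 0" if "i < length ps" for i
    using one[OF ok[OF nth_mem[OF that]]] by blast+
  have eq: "simple_walsh W t ps = (\<lambda>\<omega>. \<Sum>i<length ps. fst (ps ! i) \<omega> * W (box t (ps ! i)) \<omega>)"
    by (rule ext) (rule simple_walsh_eq_sum)
  show "integrable P (simple_walsh W t ps)"
    unfolding eq by (rule Bochner_Integration.integrable_sum) (use i(1) in auto)
  have "(\<integral>\<omega>. simple_walsh W t ps \<omega> \<partial>P) = (\<Sum>i<length ps. \<integral>\<omega>. fst (ps ! i) \<omega> * W (box t (ps ! i)) \<omega> \<partial>P)"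
    unfolding eq by (rule Bochner_Integration.integral_sum) (use i(1) in auto)
  also have "\<dots> = 0" using i(2) by simp
  finally show "(\<integral>\<omega>. simple_walsh W t ps \<omega> \<partial>P) = 0" .
qed

lemma simple_field_measurable:
  fixes ps :: "(('w \<Rightarrow> real) \<times> real \<times> real \<times> (real^'d) set) list"
  assumes ok: "\<And>p. p \<in> set ps \<Longrightarrow> elem_ok P F p"
  shows "(\<lambda>z. indicator ({0..t} \<times> UNIV) (snd z) * simple_field ps (fst (snd z)) (snd (snd z)) (fst z))
    \<in> borel_measurable (P \<Otimes>\<^sub>M lborel)"
proof -
  have "(\<lambda>z. \<Sum>i<length ps. fst (ps ! i) (fst z) * indicator (box t (ps ! i)) (snd z)) \<in> borel_measurable (P \<Otimes>\<^sub>M lborel)"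
  proof (intro borel_measurable_sum borel_measurable_times)
    fix i assume "i \<in> {..<length ps}"
    then have p: "elem_ok P F (ps ! i)" using ok by simp
    have [measurable]: "fst (ps ! i) \<in> borel_measurable P" by (rule measurable_F_P[OF elem_okD(2)[OF p]])
    have [measurable]: "box t (ps ! i) \<in> sets lborel" using elem_okD(1)[OF p, of t] unfolding wn_set_def by blast
    show "(\<lambda>z. fst (ps ! i) (fst z)) \<in> borel_measurable (P \<Otimes>\<^sub>M lborel)" by measurable
    show "(\<lambda>z. indicat_real (box t (ps ! i)) (snd z)) \<in> borel_measurable (P \<Otimes>\<^sub>M lborel)" by measurable
  qed
  then show ?thesis using simple_field_eq_sum[OF ok] by (subst measurable_cong[of "P \<Otimes>\<^sub>M lborel"]) auto
qed

text \<open>The integrands are treated as one function on the product of probability space and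
  space-time, so that the isometry becomes an equality of two square integrals stable under
  mean-square limits. The mean vanishes because elementary integrals have mean zero and the mean is
  controlled by the mean-square distance to them.\<close>

lemma walsh_integral_isometry:
  assumes wi: "walsh_integral P F W t X Y"
  shows "(\<integral>\<^sup>+\<omega>. ennreal ((Y \<omega>)\<^sup>2) \<partial>P) =
    (\<integral>\<^sup>+ry. indicator ({0..t} \<times> UNIV) ry * (\<integral>\<^sup>+\<omega>. ennreal ((X (fst ry) (snd ry) \<omega>)\<^sup>2) \<partial>P) \<partial>lborel)" (is ?iso)
    and "integrable P (\<lambda>\<omega>. (Y \<omega>)\<^sup>2) \<Longrightarrow> integrable P Y \<and> (\<integral>\<omega>. Y \<omega> \<partial>P) = 0"
proof -
  have Ym [measurable]: "Y \<in> borel_measurable P" using wi by (simp add: walsh_integral_def)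
  have Xm: "(\<lambda>(\<omega>, (r, y)). X r y \<omega>) \<in> borel_measurable (P \<Otimes>\<^sub>M lborel)" using wi by (simp add: walsh_integral_def)
  obtain ps where ok: "\<And>n p. p \<in> set (ps n) \<Longrightarrow> elem_ok P F p"
    and Xl: "(\<lambda>n. \<integral>\<^sup>+ \<omega>. (\<integral>\<^sup>+ ry. indicator ({0..t} \<times> UNIV) ry *
              ennreal ((X (fst ry) (snd ry) \<omega> - simple_field (ps n) (fst ry) (snd ry) \<omega>)\<^sup>2) \<partial>lborel) \<partial>P) \<longlonglongrightarrow> 0"
    and Yl: "(\<lambda>n. \<integral>\<^sup>+ \<omega>. ennreal ((Y \<omega> - simple_walsh W t (ps n) \<omega>)\<^sup>2) \<partial>P) \<longlonglongrightarrow> 0"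
    using wi unfolding walsh_integral_def by blast
  let ?I = "indicator ({0..t} \<times> UNIV) :: real \<times> (real^'d) \<Rightarrow> real"
  define g where "g z = ?I (snd z) * X (fst (snd z)) (snd (snd z)) (fst z)" for z
  define gs where "gs n z = ?I (snd z) * simple_field (ps n) (fst (snd z)) (snd (snd z)) (fst z)" for n z
  have gsm [measurable]: "gs n \<in> borel_measurable (P \<Otimes>\<^sub>M lborel)" for n
    unfolding gs_def by (rule simple_field_measurable[OF ok])
  have Xm' [measurable]: "(\<lambda>z. X (fst (snd z)) (snd (snd z)) (fst z)) \<in> borel_measurable (P \<Otimes>\<^sub>M lborel)"
  proof -
    have "(\<lambda>(\<omega>, (r, y)). X r y \<omega>) = (\<lambda>z. X (fst (snd z)) (snd (snd z)) (fst z))" by (auto simp: fun_eq_iff)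
    then show ?thesis using Xm by simp
  qed
  have Im [measurable]: "?I \<in> borel_measurable lborel"
  proof -
    have "{0..t} \<times> (UNIV :: (real^'d) set) \<in> sets (borel \<Otimes>\<^sub>M borel)" by simp
    then show ?thesis unfolding borel_prod by simp
  qed
  have gm [measurable]: "g \<in> borel_measurable (P \<Otimes>\<^sub>M lborel)"
    unfolding g_def by measurable
  have "(\<integral>\<^sup>+\<omega>. ennreal ((Y \<omega>)\<^sup>2) \<partial>P) = (\<integral>\<^sup>+z. ennreal ((g z)\<^sup>2) \<partial>(P \<Otimes>\<^sub>M lborel))"
  proof (rule isometric_limit[where fs = "\<lambda>n. simple_walsh W t (ps n)" and gs = gs])
    show "simple_walsh W t (ps n) \<in> borel_measurable P" for n by (rule simple_walsh_measurable[OF ok])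
    show "(\<integral>\<^sup>+ \<omega>. ennreal ((simple_walsh W t (ps n) \<omega>)\<^sup>2) \<partial>P) = (\<integral>\<^sup>+ z. ennreal ((gs n z)\<^sup>2) \<partial>(P \<Otimes>\<^sub>M lborel))" for n
      by (subst lborel.nn_integral_fst[symmetric], measurable)
        (simp add: gs_def simple_walsh_isometry[OF ok])
    have "(\<integral>\<^sup>+ z. ennreal ((g z - gs n z)\<^sup>2) \<partial>(P \<Otimes>\<^sub>M lborel)) = (\<integral>\<^sup>+ \<omega>. (\<integral>\<^sup>+ ry. indicator ({0..t} \<times> UNIV) ry *
              ennreal ((X (fst ry) (snd ry) \<omega> - simple_field (ps n) (fst ry) (snd ry) \<omega>)\<^sup>2) \<partial>lborel) \<partial>P)" for n
    proof -
      have "(\<integral>\<^sup>+ z. ennreal ((g z - gs n z)\<^sup>2) \<partial>(P \<Otimes>\<^sub>M lborel)) = (\<integral>\<^sup>+ \<omega>. (\<integral>\<^sup>+ ry. ennreal ((g (\<omega>, ry) - gs n (\<omega>, ry))\<^sup>2) \<partial>lborel) \<partial>P)"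
        by (rule lborel.nn_integral_fst[symmetric]) measurable
      also have "\<dots> = (\<integral>\<^sup>+ \<omega>. (\<integral>\<^sup>+ ry. indicator ({0..t} \<times> UNIV) ry *
              ennreal ((X (fst ry) (snd ry) \<omega> - simple_field (ps n) (fst ry) (snd ry) \<omega>)\<^sup>2) \<partial>lborel) \<partial>P)"
        by (intro nn_integral_cong) (simp add: g_def gs_def split: split_indicator)
      finally show ?thesis .
    qed
    with Xl show "(\<lambda>n. \<integral>\<^sup>+ z. ennreal ((g z - gs n z)\<^sup>2) \<partial>(P \<Otimes>\<^sub>M lborel)) \<longlonglongrightarrow> 0" by simp
  qed (use Yl in auto)
  also have "\<dots> = (\<integral>\<^sup>+ry. (\<integral>\<^sup>+\<omega>. ennreal ((g (\<omega>, ry))\<^sup>2) \<partial>P) \<partial>lborel)"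
  proof -
    interpret pair_sigma_finite P "lborel :: (real \<times> (real^'d)) measure" ..
    show ?thesis by (rule nn_integral_snd[symmetric]) measurable
  qed
  also have "\<dots> = (\<integral>\<^sup>+ry. indicator ({0..t} \<times> UNIV) ry * (\<integral>\<^sup>+\<omega>. ennreal ((X (fst ry) (snd ry) \<omega>)\<^sup>2) \<partial>P) \<partial>lborel)"
    by (intro nn_integral_cong) (simp add: g_def split: split_indicator)
  finally show ?iso .
  assume Y2: "integrable P (\<lambda>\<omega>. (Y \<omega>)\<^sup>2)"
  have iY: "integrable P Y" by (rule square_integrable_imp_integrable[OF Ym Y2])
  have "(\<integral>\<omega>. Y \<omega> \<partial>P) = 0"
  proof -
    have bound: "ennreal ((\<integral>\<omega>. Y \<omega> \<partial>P)\<^sup>2) \<le> (\<integral>\<^sup>+ \<omega>. ennreal ((Y \<omega> - simple_walsh W t (ps n) \<omega>)\<^sup>2) \<partial>P)" for n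
    proof (cases "(\<integral>\<^sup>+ \<omega>. ennreal ((Y \<omega> - simple_walsh W t (ps n) \<omega>)\<^sup>2) \<partial>P) = \<infinity>")
      case False
      note m = simple_walsh_measurable[where ps = "ps n" and t = t, OF ok]
      note s = simple_walsh_mean_zero[where ps = "ps n" and t = t, OF ok]
      let ?D = "\<lambda>\<omega>. Y \<omega> - simple_walsh W t (ps n) \<omega>"
      have Dm: "?D \<in> borel_measurable P" using m by simp
      have D2: "integrable P (\<lambda>\<omega>. (?D \<omega>)\<^sup>2)"
        using False Dm by (intro integrableI_nonneg) (auto simp: less_top)
      have D1: "integrable P ?D" using iY s by simp
      \<comment> \<open>Nonnegative variance plays the role of Jensen's inequality: the squared mean
        of \<open>?D\<close>, which is that of \<open>Y\<close>, is at most its mean square.\<close>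
      have "0 \<le> variance ?D" by (rule variance_positive)
      also have "variance ?D = (\<integral>\<omega>. (?D \<omega>)\<^sup>2 \<partial>P) - (\<integral>\<omega>. ?D \<omega> \<partial>P)\<^sup>2" by (rule variance_eq[OF D1 D2])
      also have "(\<integral>\<omega>. ?D \<omega> \<partial>P) = (\<integral>\<omega>. Y \<omega> \<partial>P)" using iY s by simp
      finally have "ennreal ((\<integral>\<omega>. Y \<omega> \<partial>P)\<^sup>2) \<le> ennreal (\<integral>\<omega>. (?D \<omega>)\<^sup>2 \<partial>P)" by (intro ennreal_leI) simp
      also have "\<dots> = (\<integral>\<^sup>+ \<omega>. ennreal ((?D \<omega>)\<^sup>2) \<partial>P)" by (rule nn_integral_eq_integral[symmetric, OF D2]) simp
      finally show ?thesis .
    qed simp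
    have "ennreal ((\<integral>\<omega>. Y \<omega> \<partial>P)\<^sup>2) \<le> 0"
      by (rule LIMSEQ_le_const[OF Yl]) (use bound in auto)
    then show ?thesis by (simp add: ennreal_eq_0_iff)
  qed
  with iY show "integrable P Y \<and> (\<integral>\<omega>. Y \<omega> \<partial>P) = 0" by blast
qed

end

subsection \<open>The second moment of the mild solution\<close>

lemma nn_integral_lborel_reflect:
  fixes f :: "'a::euclidean_space \<Rightarrow> ennreal"
  assumes [measurable]: "f \<in> borel_measurable borel"
  shows "(\<integral>\<^sup>+z. f (x - z) \<partial>lborel) = (\<integral>\<^sup>+z. f z \<partial>lborel)"
proof -
  have L: "lborel = density (distr lborel borel ((-) x)) (\<lambda>_. 1)"
    using lborel_affine[of "- 1" x] by simp
  have "(\<integral>\<^sup>+z. f z \<partial>lborel) = (\<integral>\<^sup>+z. f z \<partial>density (distr lborel borel ((-) x)) (\<lambda>_. 1))"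
    by (rule arg_cong[OF L])
  also have "\<dots> = (\<integral>\<^sup>+z. f (x - z) \<partial>lborel)"
    by (simp add: nn_integral_density nn_integral_distr)
  finally show ?thesis by simp
qed

lemma nn_integral_lborel_pair:
  fixes f :: "real \<times> (real^'d::finite) \<Rightarrow> ennreal"
  assumes "f \<in> borel_measurable borel"
  shows "(\<integral>\<^sup>+p. f p \<partial>lborel) = (\<integral>\<^sup>+t. (\<integral>\<^sup>+x. f (t, x) \<partial>lborel) \<partial>lborel)"
proof -
  have "f \<in> borel_measurable (lborel \<Otimes>\<^sub>M lborel)" using assms by (simp only: lborel_prod measurable_lborel2)
  then show ?thesis unfolding lborel_prod[symmetric] by (rule lborel.nn_integral_fst[symmetric])
qed

locale mild_spde = white_noise P F W + stable_index b
  for P :: "'w measure" and F :: "real \<Rightarrow> 'w measure"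
    and W :: "(real \<times> (real^'d::finite)) set \<Rightarrow> 'w \<Rightarrow> real" and b :: real +
  fixes \<nu> Lip :: real and \<sigma> :: "real \<Rightarrow> real"
    and u0 :: "real^'d \<Rightarrow> real" and u :: "real \<Rightarrow> real^'d \<Rightarrow> 'w \<Rightarrow> real"
  assumes nu: "0 < \<nu>" and dim: "CARD('d) < 4" and bdim: "b * real CARD('d) < 2"
    and lip: "Lip-lipschitz_on UNIV \<sigma>" and sigma0: "\<sigma> 0 = 0"
    and u0_measurable: "u0 \<in> borel_measurable lborel" and u0_nonneg: "\<And>x. 0 \<le> u0 x"
    and u0_bounded: "bounded (range u0)" and u0_support: "compact (closure {x. u0 x \<noteq> 0})"
    and u0_pos: "\<exists>U. open U \<and> U \<noteq> {} \<and> U \<subseteq> {x. \<forall>i. 0 < x $ i} \<and> (\<forall>x\<in>U. 0 < u0 x)"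
    and mild: "mild_solution P F W \<nu> b \<sigma> u0 u"
begin

definition v :: "real \<Rightarrow> real^'d \<Rightarrow> real" where "v t x = (\<integral>\<omega>. (u t x \<omega>)\<^sup>2 \<partial>P)"

definition h :: "real \<Rightarrow> real^'d \<Rightarrow> real" where "h t x = (\<integral>y. u0 y * heat_G \<nu> b t (x - y) \<partial>lborel)"

definition source :: "real \<Rightarrow> real^'d \<Rightarrow> ennreal" where
  "source t x = (\<integral>\<^sup>+\<omega>. ennreal ((\<sigma> (u t x \<omega>))\<^sup>2) \<partial>P)"

text \<open>Vanishing at nonpositive times restricts the source to times before \<open>t\<close>
  automatically, so the renewal equation is a convolution over all of space-time.\<close>

definition k :: "real \<times> (real^'d) \<Rightarrow> ennreal" where
  "k p = indicator {0<..} (fst p) * (kernel \<nu> (fst p) (snd p))\<^sup>2"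

lemma k_measurable [measurable]: "k \<in> borel_measurable borel"
proof -
  have "k \<in> borel_measurable (borel \<Otimes>\<^sub>M borel)" unfolding k_def by measurable
  then show ?thesis by (simp only: borel_prod)
qed

lemma u_measurable: "0 \<le> t \<Longrightarrow> u t x \<in> borel_measurable P"
  using mild measurable_F_P by (auto simp: mild_solution_def)

lemma u_square_integrable: "0 \<le> t \<Longrightarrow> integrable P (\<lambda>\<omega>. (u t x \<omega>)\<^sup>2)"
  using mild by (auto simp: mild_solution_def)

lemma sigma_measurable [measurable]: "\<sigma> \<in> borel_measurable borel"
  by (intro borel_measurable_continuous_onI lipschitz_on_continuous_on[OF lip])

lemma v_nonneg: "0 \<le> v t x"
  by (simp add: v_def)

lemma ennreal_v: "0 \<le> t \<Longrightarrow> ennreal (v t x) = (\<integral>\<^sup>+\<omega>. ennreal ((u t x \<omega>)\<^sup>2) \<partial>P)"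
  unfolding v_def by (rule nn_integral_eq_integral[symmetric, OF u_square_integrable]) auto

lemma v_bounded: "\<exists>C. \<forall>t\<in>{0..T}. \<forall>x. v t x \<le> C"
  using mild by (auto simp: mild_solution_def v_def)

lemma source_le: "0 \<le> t \<Longrightarrow> source t x \<le> ennreal (Lip\<^sup>2) * ennreal (v t x)"
proof -
  assume t: "0 \<le> t"
  note [measurable] = u_measurable[OF t, of x]
  have "source t x \<le> (\<integral>\<^sup>+\<omega>. ennreal (Lip\<^sup>2) * ennreal ((u t x \<omega>)\<^sup>2) \<partial>P)"
    unfolding source_def
  proof (rule nn_integral_mono)
    fix \<omega>
    have "dist (\<sigma> (u t x \<omega>)) (\<sigma> 0) \<le> Lip * dist (u t x \<omega>) 0" by (rule lipschitz_onD[OF lip]) auto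
    then have "\<bar>\<sigma> (u t x \<omega>)\<bar> \<le> Lip * \<bar>u t x \<omega>\<bar>" by (simp add: sigma0)
    then have "\<bar>\<sigma> (u t x \<omega>)\<bar>\<^sup>2 \<le> (Lip * \<bar>u t x \<omega>\<bar>)\<^sup>2" by (intro power_mono) auto
    then have "(\<sigma> (u t x \<omega>))\<^sup>2 \<le> Lip\<^sup>2 * (u t x \<omega>)\<^sup>2" by (simp add: power_mult_distrib)
    then show "ennreal ((\<sigma> (u t x \<omega>))\<^sup>2) \<le> ennreal (Lip\<^sup>2) * ennreal ((u t x \<omega>)\<^sup>2)"
      by (subst ennreal_mult'[symmetric]) (auto intro: ennreal_leI)
  qed
  also have "\<dots> = ennreal (Lip\<^sup>2) * ennreal (v t x)"
    unfolding ennreal_v[OF t] by (rule nn_integral_cmult) measurable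
  finally show ?thesis .
qed

lemma source_ge:
  assumes L: "0 \<le> L" "\<And>z. L * \<bar>z\<bar> \<le> \<bar>\<sigma> z\<bar>" and t: "0 \<le> t"
  shows "ennreal (L\<^sup>2) * ennreal (v t x) \<le> source t x"
proof -
  note [measurable] = u_measurable[OF t, of x]
  have "ennreal (L\<^sup>2) * ennreal (v t x) = (\<integral>\<^sup>+\<omega>. ennreal (L\<^sup>2) * ennreal ((u t x \<omega>)\<^sup>2) \<partial>P)"
    unfolding ennreal_v[OF t] by (rule nn_integral_cmult[symmetric]) measurable
  also have "\<dots> \<le> source t x"
    unfolding source_def
  proof (rule nn_integral_mono)
    fix \<omega>
    have "(L * \<bar>u t x \<omega>\<bar>)\<^sup>2 \<le> \<bar>\<sigma> (u t x \<omega>)\<bar>\<^sup>2" using L by (intro power_mono) auto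
    then have "L\<^sup>2 * (u t x \<omega>)\<^sup>2 \<le> (\<sigma> (u t x \<omega>))\<^sup>2" by (simp add: power_mult_distrib)
    then show "ennreal (L\<^sup>2) * ennreal ((u t x \<omega>)\<^sup>2) \<le> ennreal ((\<sigma> (u t x \<omega>))\<^sup>2)"
      by (subst ennreal_mult'[symmetric]) (auto intro: ennreal_leI)
  qed
  finally show ?thesis .
qed

lemma walsh_exists:
  assumes t: "0 < t"
  obtains Y where "walsh_integral P F W t (\<lambda>r y \<omega>. \<sigma> (u r y \<omega>) * heat_G \<nu> b (t - r) (x - y)) Y"
    and "AE \<omega> in P. u t x \<omega> = h t x + Y \<omega>"
  using mild t unfolding mild_solution_def h_def by blast

lemma source_times_kernel:
  assumes r: "0 \<le> r"
  shows "(\<integral>\<^sup>+\<omega>. ennreal ((\<sigma> (u r y \<omega>) * heat_G \<nu> b t x)\<^sup>2) \<partial>P) = source r y * ennreal ((heat_G \<nu> b t x)\<^sup>2)"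
proof -
  note [measurable] = u_measurable[OF r, of y]
  have "(\<integral>\<^sup>+\<omega>. ennreal ((\<sigma> (u r y \<omega>) * heat_G \<nu> b t x)\<^sup>2) \<partial>P) = (\<integral>\<^sup>+\<omega>. ennreal ((\<sigma> (u r y \<omega>))\<^sup>2) * ennreal ((heat_G \<nu> b t x)\<^sup>2) \<partial>P)"
    by (simp add: power_mult_distrib ennreal_mult'')
  also have "\<dots> = source r y * ennreal ((heat_G \<nu> b t x)\<^sup>2)"
    unfolding source_def by (rule nn_integral_multc) measurable
  finally show ?thesis .
qed

text \<open>In the square of \<open>h + Y\<close> the cross term has mean zero and the isometry
  evaluates the square of \<open>Y\<close>. Square integrability of \<open>Y\<close> is inherited
  from \<open>u\<close>, as \<open>h\<close> is deterministic.\<close>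

lemma second_moment_heat_G:
  assumes t: "0 < t"
  shows "ennreal (v t x) = ennreal ((h t x)\<^sup>2) + (\<integral>\<^sup>+ry. indicator ({0..t} \<times> UNIV) ry *
    (source (fst ry) (snd ry) * ennreal ((heat_G \<nu> b (t - fst ry) (x - snd ry))\<^sup>2)) \<partial>lborel)"
proof -
  obtain Y where wi: "walsh_integral P F W t (\<lambda>r y \<omega>. \<sigma> (u r y \<omega>) * heat_G \<nu> b (t - r) (x - y)) Y"
    and ae: "AE \<omega> in P. u t x \<omega> = h t x + Y \<omega>" by (rule walsh_exists[OF t])
  have t0: "0 \<le> t" using t by simp
  note [measurable] = u_measurable[OF t0, of x]
  have [measurable]: "Y \<in> borel_measurable P" using wi by (simp add: walsh_integral_def)
  note u2 = u_square_integrable[OF t0, of x]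
  have u1: "integrable P (u t x)" by (rule square_integrable_imp_integrable[OF _ u2]) measurable
  have "integrable P (\<lambda>\<omega>. (u t x \<omega>)\<^sup>2 - 2 * h t x * u t x \<omega> + (h t x)\<^sup>2)" using u1 u2 by simp
  moreover have "AE \<omega> in P. (u t x \<omega>)\<^sup>2 - 2 * h t x * u t x \<omega> + (h t x)\<^sup>2 = (Y \<omega>)\<^sup>2"
    using ae by eventually_elim (simp add: power2_eq_square algebra_simps)
  ultimately have Y2: "integrable P (\<lambda>\<omega>. (Y \<omega>)\<^sup>2)"
    by (subst integrable_cong_AE[symmetric, where f = "\<lambda>\<omega>. (u t x \<omega>)\<^sup>2 - 2 * h t x * u t x \<omega> + (h t x)\<^sup>2"]) auto
  note Y = walsh_integral_isometry(2)[OF wi Y2]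
  have "v t x = (\<integral>\<omega>. (h t x)\<^sup>2 + 2 * h t x * Y \<omega> + (Y \<omega>)\<^sup>2 \<partial>P)"
    unfolding v_def by (rule integral_cong_AE) (use ae in \<open>auto elim!: eventually_mono simp: power2_eq_square algebra_simps\<close>)
  also have "\<dots> = (h t x)\<^sup>2 + (\<integral>\<omega>. (Y \<omega>)\<^sup>2 \<partial>P)" using Y Y2 by (simp add: prob_space)
  finally have "ennreal (v t x) = ennreal ((h t x)\<^sup>2) + ennreal (\<integral>\<omega>. (Y \<omega>)\<^sup>2 \<partial>P)"
    by (simp add: ennreal_plus[symmetric] del: ennreal_plus)
  also have "ennreal (\<integral>\<omega>. (Y \<omega>)\<^sup>2 \<partial>P) = (\<integral>\<^sup>+\<omega>. ennreal ((Y \<omega>)\<^sup>2) \<partial>P)"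
    by (rule nn_integral_eq_integral[symmetric, OF Y2]) auto
  also have "\<dots> = (\<integral>\<^sup>+ry. indicator ({0..t} \<times> UNIV) ry *
    (source (fst ry) (snd ry) * ennreal ((heat_G \<nu> b (t - fst ry) (x - snd ry))\<^sup>2)) \<partial>lborel)"
    unfolding walsh_integral_isometry(1)[OF wi]
    by (intro nn_integral_cong) (auto simp: indicator_def source_times_kernel)
  finally show ?thesis .
qed

text \<open>Joint measurability of the solution is only known through the Walsh integrands; dividing
  by the (positive, finite) heat kernel recovers it for the source away from \<open>y = 0\<close>.\<close>

definition S :: "real \<times> (real^'d) \<Rightarrow> ennreal" where
  "S p = (if 0 < fst p \<and> snd p \<noteq> 0 then source (fst p) (snd p) else 0)"

lemma S_measurable [measurable]: "S \<in> borel_measurable borel"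
proof -
  \<comment> \<open>The Walsh integrand for the solution at time \<open>n\<close> and point 0 sees
    the source at times below \<open>n\<close>; the supremum over \<open>n\<close> exhausts all
    times.\<close>
  define \<phi> where "\<phi> n ry = (\<integral>\<^sup>+\<omega>. ennreal ((\<sigma> (u (fst ry) (snd ry) \<omega>) * heat_G \<nu> b (real n - fst ry) (0 - snd ry))\<^sup>2) \<partial>P)" for n :: nat and ry
  have \<phi>m [measurable]: "\<phi> n \<in> borel_measurable borel" if n: "0 < n" for n
  proof -
    obtain Y where wi: "walsh_integral P F W (real n) (\<lambda>r y \<omega>. \<sigma> (u r y \<omega>) * heat_G \<nu> b (real n - r) (0 - y)) Y"
      by (rule walsh_exists[of "real n" 0]) (use n in auto)
    let ?X = "\<lambda>z. \<sigma> (u (fst (snd z)) (snd (snd z)) (fst z)) * heat_G \<nu> b (real n - fst (snd z)) (0 - snd (snd z))"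
    have "(\<lambda>(\<omega>, (r, y)). \<sigma> (u r y \<omega>) * heat_G \<nu> b (real n - r) (0 - y)) \<in> borel_measurable (P \<Otimes>\<^sub>M lborel)"
      using wi unfolding walsh_integral_def by blast
    also have "(\<lambda>(\<omega>, (r, y)). \<sigma> (u r y \<omega>) * heat_G \<nu> b (real n - r) (0 - y)) = ?X" by (auto simp: fun_eq_iff)
    finally have [measurable]: "?X \<in> borel_measurable (P \<Otimes>\<^sub>M lborel)" .
    have "(\<lambda>z. ennreal ((?X z)\<^sup>2)) \<in> borel_measurable (P \<Otimes>\<^sub>M lborel)" by measurable
    from measurable_pair_swap[OF this]
    have "(\<lambda>(x, y). ennreal ((?X (y, x))\<^sup>2)) \<in> borel_measurable (lborel \<Otimes>\<^sub>M P)" .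
    from borel_measurable_nn_integral_fst[OF this]
    have "\<phi> n \<in> borel_measurable lborel" by (simp add: \<phi>_def[abs_def])
    then show ?thesis by simp
  qed
  define \<psi> where "\<psi> n p = (if 0 < fst p \<and> fst p < real n \<and> snd p \<noteq> 0
      then \<phi> n p * ennreal (1 / (heat_G \<nu> b (real n - fst p) (0 - snd p))\<^sup>2) else 0)" for n :: nat and p :: "real \<times> (real^'d)"
  have \<psi>m: "\<psi> n \<in> borel_measurable borel" for n
  proof (cases "0 < n")
    case True
    have [measurable]: "(\<lambda>p. heat_G \<nu> b (real n - fst p) (0 - snd p)) \<in> borel_measurable (borel :: (real \<times> (real^'d)) measure)"
    proof -
      have "(\<lambda>p. heat_G \<nu> b (real n - fst p) (0 - snd p)) \<in> borel_measurable (borel \<Otimes>\<^sub>M (borel :: (real^'d) measure))" by measurable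
      then show ?thesis by (simp only: borel_prod)
    qed
    note [measurable] = \<phi>m[OF True]
    have [measurable]: "Measurable.pred (borel :: (real \<times> (real^'d)) measure) (\<lambda>p. 0 < fst p \<and> fst p < real n \<and> snd p \<noteq> 0)"
    proof -
      have "Measurable.pred (borel \<Otimes>\<^sub>M (borel :: (real^'d) measure)) (\<lambda>p. 0 < fst p \<and> fst p < real n \<and> snd p \<noteq> 0)" by measurable
      then show ?thesis by (simp only: borel_prod)
    qed
    show ?thesis unfolding \<psi>_def by measurable
  next
    case False
    then have "\<psi> n = (\<lambda>p. 0)" by (auto simp: \<psi>_def fun_eq_iff)
    then show ?thesis by simp
  qed
  have \<psi>: "\<psi> n p = (if fst p < real n then S p else 0)" for n p
  proof (cases "0 < fst p \<and> fst p < real n \<and> snd p \<noteq> 0")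
    case True
    let ?G = "heat_G \<nu> b (real n - fst p) (0 - snd p)"
    have G: "0 < ?G" using True by (intro heat_G_pos nu dim) auto
    have "\<psi> n p = source (fst p) (snd p) * (ennreal (?G\<^sup>2) * ennreal (1 / ?G\<^sup>2))"
      using True by (simp add: \<psi>_def \<phi>_def source_times_kernel mult.assoc)
    also have "ennreal (?G\<^sup>2) * ennreal (1 / ?G\<^sup>2) = 1"
      using G by (subst ennreal_mult'[symmetric]) auto
    finally show ?thesis using True by (simp add: S_def)
  qed (auto simp: \<psi>_def S_def)
  have "S = (\<lambda>p. SUP n. \<psi> n p)"
  proof
    fix p :: "real \<times> (real^'d)"
    obtain n :: nat where n: "fst p < real n" using reals_Archimedean2 by blast
    show "S p = (SUP n. \<psi> n p)"
    proof (rule antisym)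
      have "S p = \<psi> n p" using n by (simp add: \<psi>)
      also have "\<dots> \<le> (SUP n. \<psi> n p)" by (rule SUP_upper) simp
      finally show "S p \<le> (SUP n. \<psi> n p)" .
      show "(SUP n. \<psi> n p) \<le> S p" by (rule SUP_least) (simp add: \<psi>)
    qed
  qed
  then show ?thesis using \<psi>m by simp
qed

text \<open>Replacing \<open>source\<close> by \<open>S\<close> and \<open>heat_G\<close> by the
  extended kernel, and opening the closed time interval, alters the integrand only where the time is
  0 or \<open>t\<close> or the point is 0 or \<open>x\<close>, a null set.\<close>

lemma second_moment:
  assumes t: "0 < t"
  shows "ennreal (v t x) = ennreal ((h t x)\<^sup>2) + (\<integral>\<^sup>+z. S z * k ((t, x) - z) \<partial>lborel)"
proof -
  have ae: "AE z in (lborel :: (real \<times> (real^'d)) measure). fst z \<noteq> 0 \<and> fst z \<noteq> t \<and> snd z \<noteq> 0 \<and> snd z \<noteq> x"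
  proof -
    have "AE z in lborel \<Otimes>\<^sub>M (lborel :: (real^'d) measure). fst z \<noteq> 0 \<and> fst z \<noteq> t \<and> snd z \<noteq> 0 \<and> snd z \<noteq> x"
    proof (rule lborel_pair.AE_pair_measure)
      show "AE r in lborel. AE y in lborel. fst (r, y) \<noteq> 0 \<and> fst (r, y) \<noteq> t \<and> snd (r, y) \<noteq> (0 :: real^'d) \<and> snd (r, y) \<noteq> x"
        using AE_lborel_singleton[of "0::real"] AE_lborel_singleton[of t]
      proof eventually_elim
        case (elim r)
        show ?case using AE_lborel_singleton[of "0 :: real^'d"] AE_lborel_singleton[of x]
          by eventually_elim (use elim in auto)
      qed
    qed measurable
    then show ?thesis by (simp only: lborel_prod)
  qed
  have "(\<integral>\<^sup>+ry. indicator ({0..t} \<times> UNIV) ry *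
      (source (fst ry) (snd ry) * ennreal ((heat_G \<nu> b (t - fst ry) (x - snd ry))\<^sup>2)) \<partial>lborel) = (\<integral>\<^sup>+z. S z * k ((t, x) - z) \<partial>lborel)"
  proof (rule nn_integral_cong_AE)
    show "AE z in lborel. indicator ({0..t} \<times> UNIV) z *
      (source (fst z) (snd z) * ennreal ((heat_G \<nu> b (t - fst z) (x - snd z))\<^sup>2)) = S z * k ((t, x) - z)"
      using ae
    proof eventually_elim
      case (elim z)
      show ?case
      proof (cases "0 < fst z \<and> fst z < t")
        case True
        have "ennreal ((heat_G \<nu> b (t - fst z) (x - snd z))\<^sup>2) = (ennreal (heat_G \<nu> b (t - fst z) (x - snd z)))\<^sup>2"
          by (simp add: ennreal_power heat_G_nonneg)
        also have "\<dots> = (kernel \<nu> (t - fst z) (x - snd z))\<^sup>2"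
          using True elim by (subst ennreal_heat_G[OF nu _ _ dim]) auto
        finally show ?thesis using True elim by (cases z) (auto simp: S_def k_def)
      next
        case False
        then show ?thesis using elim by (cases z) (auto simp: S_def k_def indicator_def)
      qed
    qed
  qed
  then show ?thesis using second_moment_heat_G[OF t, of x] by simp
qed

section \<open>Exponentially weighted renewal iteration\<close>

definition contraction :: "real \<Rightarrow> real" where
  "contraction \<gamma> = Lip\<^sup>2 * ((8 * pi * \<nu>) powr (- real CARD('d) / 2) *
      ((const_M b CARD('d))\<^sup>2 * \<gamma> powr (b * real CARD('d) / 2 - 1) / (1 - 2 powr (b - 2))\<^sup>2))"

lemma contraction_nonneg: "0 \<le> contraction \<gamma>"
  by (simp add: contraction_def)

lemma weighted_k_measurable:
  "(\<lambda>p. ennreal (exp (- \<gamma> * fst p + c \<bullet> snd p)) * k p) \<in> borel_measurable borel"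
  by (intro borel_measurable_times_ennreal measurable_compose[OF _ measurable_ennreal] borel_measurable_continuous_onI
      continuous_intros k_measurable)

lemma weighted_energy_le:
  fixes c :: "real^'d"
  assumes \<gamma>: "0 < \<gamma>" and c: "\<nu> * (norm c)\<^sup>2 \<le> \<gamma> powr b"
  shows "ennreal (Lip\<^sup>2) * (\<integral>\<^sup>+p. ennreal (exp (- \<gamma> * fst p + c \<bullet> snd p)) * k p \<partial>lborel) \<le> ennreal (contraction \<gamma>)"
proof -
  note m = weighted_k_measurable[of \<gamma> c]
  have "(\<integral>\<^sup>+p. ennreal (exp (- \<gamma> * fst p + c \<bullet> snd p)) * k p \<partial>lborel) =
     (\<integral>\<^sup>+t. (\<integral>\<^sup>+x. ennreal (exp (- \<gamma> * t + c \<bullet> x)) * k (t, x) \<partial>lborel) \<partial>lborel)"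
    using nn_integral_lborel_pair[OF m] by simp
  also have "\<dots> = (\<integral>\<^sup>+t\<in>{0<..}. (\<integral>\<^sup>+x. ennreal (exp (- \<gamma> * t + c \<bullet> x)) * (kernel \<nu> t x)\<^sup>2 \<partial>lborel) \<partial>lborel)"
    by (intro nn_integral_cong) (simp add: k_def indicator_def)
  also have "\<dots> \<le> ennreal ((8 * pi * \<nu>) powr (- real CARD('d) / 2) *
      ((const_M b CARD('d))\<^sup>2 * \<gamma> powr (b * real CARD('d) / 2 - 1) / (1 - 2 powr (b - 2))\<^sup>2))"
    by (rule kernel_energy_le[OF nu dim bdim \<gamma> c])
  finally have "ennreal (Lip\<^sup>2) * (\<integral>\<^sup>+p. ennreal (exp (- \<gamma> * fst p + c \<bullet> snd p)) * k p \<partial>lborel) \<le> ennreal (Lip\<^sup>2) * \<dots>"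
    by (rule mult_left_mono) simp
  then show ?thesis unfolding contraction_def by (subst ennreal_mult') simp_all
qed

text \<open>Exponentials are multiplicative on space-time, hence eigenfunctions of convolution with
  \<open>k\<close>; the eigenvalue is the tilted energy.\<close>

lemma weighted_convolution:
  fixes c :: "real^'d"
  shows "(\<integral>\<^sup>+z. ennreal (exp (\<gamma> * fst z - c \<bullet> snd z)) * k ((t, x) - z) \<partial>lborel) =
    ennreal (exp (\<gamma> * t - c \<bullet> x)) * (\<integral>\<^sup>+p. ennreal (exp (- \<gamma> * fst p + c \<bullet> snd p)) * k p \<partial>lborel)"
proof -
  let ?f = "\<lambda>p. ennreal (exp (\<gamma> * t - c \<bullet> x)) * (ennreal (exp (- \<gamma> * fst p + c \<bullet> snd p)) * k p)"
  note m = weighted_k_measurable[of \<gamma> c]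
  have "ennreal (exp (\<gamma> * fst z - c \<bullet> snd z)) * k ((t, x) - z) = ?f ((t, x) - z)" for z
  proof -
    have "\<gamma> * fst z - c \<bullet> snd z = (\<gamma> * t - c \<bullet> x) + (- \<gamma> * fst ((t, x) - z) + c \<bullet> snd ((t, x) - z))"
      by (simp add: inner_diff_right algebra_simps)
    then have "exp (\<gamma> * fst z - c \<bullet> snd z) = exp (\<gamma> * t - c \<bullet> x) * exp (- \<gamma> * fst ((t, x) - z) + c \<bullet> snd ((t, x) - z))"
      by (simp only: exp_add)
    then show ?thesis by (simp only: ennreal_mult' exp_ge_zero mult.assoc)
  qed
  then have "(\<integral>\<^sup>+z. ennreal (exp (\<gamma> * fst z - c \<bullet> snd z)) * k ((t, x) - z) \<partial>lborel) = (\<integral>\<^sup>+z. ?f ((t, x) - z) \<partial>lborel)"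
    by simp
  also have "\<dots> = (\<integral>\<^sup>+z. ?f z \<partial>lborel)"
    using m by (intro nn_integral_lborel_reflect) simp
  also have "\<dots> = ennreal (exp (\<gamma> * t - c \<bullet> x)) * (\<integral>\<^sup>+p. ennreal (exp (- \<gamma> * fst p + c \<bullet> snd p)) * k p \<partial>lborel)"
    using m by (intro nn_integral_cmult) simp
  finally show ?thesis .
qed

lemma h_nonneg: "0 \<le> h t x"
  unfolding h_def by (intro integral_nonneg_AE AE_I2 mult_nonneg_nonneg u0_nonneg heat_G_nonneg)

text \<open>Since \<open>h\<close> is squared in the renewal equation, it is estimated with half the
  tilt and half the rate. The constant is independent of \<open>c\<close>, which later allows the
  direction of \<open>c\<close> to follow \<open>x\<close>.\<close>

lemma initial_term_le:
  assumes \<gamma>: "0 < \<gamma>"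
  shows "\<exists>H\<ge>0. \<forall>c. \<nu> * (norm c)\<^sup>2 \<le> \<gamma> powr b \<longrightarrow> (\<forall>t>0. \<forall>x. (h t x)\<^sup>2 \<le> H * exp (\<gamma> * t - c \<bullet> x))"
proof -
  obtain U where U: "\<And>y. \<bar>u0 y\<bar> \<le> U" using u0_bounded by (auto simp: bounded_iff)
  obtain K where K: "\<And>y. u0 y \<noteq> 0 \<Longrightarrow> norm y \<le> K"
    using compact_imp_bounded[OF u0_support] closure_subset[of "{x. u0 x \<noteq> 0}"] by (auto simp: bounded_iff)
  have U0: "0 \<le> U" using U[of 0] by linarith
  \<comment> \<open>The largest admissible norm of \<open>c\<close>. On the support of
    \<open>u0\<close>, inside the ball of radius \<open>K\<close>, the tilt by \<open>c / 2\<close>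
    then costs at most the exponential factor in \<open>B\<close>.\<close>
  define \<rho> where "\<rho> = sqrt (\<gamma> powr b / \<nu>)"
  define B where "B = U * exp (\<rho> * \<bar>K\<bar> / 2)"
  define D where "D = B / (1 - 2 powr (b - 2))"
  have two: "2 powr (b - 2) < 1" using b1 by (simp add: powr_less_one)
  have B0: "0 \<le> B" using U0 by (simp add: B_def)
  have D0: "0 \<le> D" using B0 two by (simp add: D_def)
  have "(h t x)\<^sup>2 \<le> D\<^sup>2 * exp (\<gamma> * t - c \<bullet> x)" if c: "\<nu> * (norm c)\<^sup>2 \<le> \<gamma> powr b" and t: "0 < t" for c t x
  proof -
    have "(norm c)\<^sup>2 \<le> \<gamma> powr b / \<nu>" using c nu by (simp add: field_simps)
    then have nc: "norm c \<le> \<rho>" unfolding \<rho>_def by (rule real_le_rsqrt)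
    let ?c = "(1/2) *\<^sub>R c"
    let ?l = "\<nu> * (norm c)\<^sup>2 / 4"
    have "ennreal (h t x) \<le> (\<integral>\<^sup>+y. ennreal (u0 y * heat_G \<nu> b t (x - y)) \<partial>lborel)"
    proof -
      have [measurable]: "u0 \<in> borel_measurable borel" using u0_measurable by simp
      have "h t x = enn2real (\<integral>\<^sup>+y. ennreal (u0 y * heat_G \<nu> b t (x - y)) \<partial>lborel)"
        unfolding h_def by (rule integral_eq_nn_integral) (auto simp: u0_nonneg heat_G_nonneg)
      then show ?thesis
        by (cases "(\<integral>\<^sup>+y. ennreal (u0 y * heat_G \<nu> b t (x - y)) \<partial>lborel)") auto
    qed
    also have "\<dots> \<le> (\<integral>\<^sup>+y. ennreal (B * exp (- (?c \<bullet> x))) * (ennreal (exp (?c \<bullet> (x - y))) * kernel \<nu> t (x - y)) \<partial>lborel)"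
    proof (rule nn_integral_mono)
      fix y
      have "u0 y \<le> B * exp (- (?c \<bullet> x)) * exp (?c \<bullet> (x - y))"
      proof (cases "u0 y = 0")
        case False
        have "?c \<bullet> y \<le> norm ?c * norm y" by (rule norm_cauchy_schwarz)
        also have "\<dots> \<le> (\<rho> / 2) * \<bar>K\<bar>" using nc K[OF False] order_trans[OF norm_ge_zero nc] by (intro mult_mono) auto
        finally have "0 \<le> \<rho> * \<bar>K\<bar> / 2 - ?c \<bullet> y" by simp
        then have "1 \<le> exp (\<rho> * \<bar>K\<bar> / 2 - ?c \<bullet> y)" by simp
        then have "U * 1 \<le> U * exp (\<rho> * \<bar>K\<bar> / 2 - ?c \<bullet> y)" using U0 by (intro mult_left_mono)
        also have "\<rho> * \<bar>K\<bar> / 2 - ?c \<bullet> y = \<rho> * \<bar>K\<bar> / 2 + - (?c \<bullet> x) + ?c \<bullet> (x - y)" by (simp add: inner_diff_right algebra_simps)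
        finally have "U \<le> B * exp (- (?c \<bullet> x)) * exp (?c \<bullet> (x - y))" by (simp only: B_def exp_add mult.assoc mult_1_right)
        then show ?thesis using U[of y] by linarith
      qed (use B0 in simp)
      then have "ennreal (u0 y) * ennreal (heat_G \<nu> b t (x - y)) \<le> ennreal (B * exp (- (?c \<bullet> x)) * exp (?c \<bullet> (x - y))) * kernel \<nu> t (x - y)"
        by (intro mult_mono ennreal_leI ennreal_heat_G_le t) auto
      moreover have "ennreal (B * exp (- (?c \<bullet> x)) * exp (?c \<bullet> (x - y))) = ennreal (B * exp (- (?c \<bullet> x))) * ennreal (exp (?c \<bullet> (x - y)))"
        by (rule ennreal_mult'') simp
      ultimately show "ennreal (u0 y * heat_G \<nu> b t (x - y)) \<le> ennreal (B * exp (- (?c \<bullet> x))) * (ennreal (exp (?c \<bullet> (x - y))) * kernel \<nu> t (x - y))"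
        unfolding ennreal_mult''[OF heat_G_nonneg] by (simp only: mult.assoc)
    qed
    also have "\<dots> = ennreal (B * exp (- (?c \<bullet> x))) * (\<integral>\<^sup>+y. ennreal (exp (?c \<bullet> (x - y))) * kernel \<nu> t (x - y) \<partial>lborel)"
      by (rule nn_integral_cmult) measurable
    also have "(\<integral>\<^sup>+y. ennreal (exp (?c \<bullet> (x - y))) * kernel \<nu> t (x - y) \<partial>lborel) = (\<integral>\<^sup>+y. ennreal (exp (?c \<bullet> y)) * kernel \<nu> t y \<partial>lborel)"
      by (rule nn_integral_lborel_reflect) measurable
    also have "\<dots> = exp_moment 0 ?l t"
      unfolding nn_integral_exp_kernel[OF nu t] exp_moment_def
    proof (rule nn_integral_cong)
      fix w
      show "ennreal (exp (\<nu> * (norm ?c)\<^sup>2 * (t / w) powr b) * g w) = ennreal (((t / w) powr b) powr (- 0) * exp (?l * (t / w) powr b) * g w)"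
        using t by (cases "0 < w") (auto simp: g_zero power_mult_distrib power_divide)
    qed
    also have "\<dots> \<le> ennreal (exp (\<gamma> / 2 * t) / (1 - 2 powr (b - 2)))"
    proof -
      have half: "(\<gamma> / 2) powr b = \<gamma> powr b / 2 powr b" using \<gamma> by (simp add: powr_divide)
      \<comment> \<open>The quarter from halving the tilt outweighs the factor
        \<open>2 powr b\<close> from halving the rate, so \<open>exp_moment_le\<close> applies with
        a ratio bounded away from 1 uniformly in \<open>c\<close>.\<close>
      have le: "?l / (\<gamma> / 2) powr b \<le> 2 powr (b - 2)"
        using c \<gamma> by (simp add: half powr_diff field_simps)
      have "?l < (\<gamma> / 2) powr b"
      proof -
        have "?l \<le> 2 powr (b - 2) * (\<gamma> / 2) powr b" using le \<gamma> by (simp add: field_simps)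
        also have "\<dots> < 1 * (\<gamma> / 2) powr b" using two \<gamma> by (intro mult_strict_right_mono) auto
        finally show ?thesis by simp
      qed
      then have "exp_moment 0 ?l t \<le> ennreal (exp (\<gamma> / 2 * t) / (1 - ?l / (\<gamma> / 2) powr b))"
        using \<gamma> nu by (intro exp_moment_le t) auto
      also have "\<dots> \<le> ennreal (exp (\<gamma> / 2 * t) / (1 - 2 powr (b - 2)))"
        using le two by (intro ennreal_leI divide_left_mono) (auto intro!: mult_pos_pos)
      finally show ?thesis .
    qed
    finally have "ennreal (h t x) \<le> ennreal (B * exp (- (?c \<bullet> x))) * ennreal (exp (\<gamma> / 2 * t) / (1 - 2 powr (b - 2)))"
      by (simp add: mult_left_mono)
    also have "\<dots> = ennreal (B * exp (- (?c \<bullet> x)) * (exp (\<gamma> / 2 * t) / (1 - 2 powr (b - 2))))"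
      using B0 by (intro ennreal_mult'[symmetric]) auto
    finally have "h t x \<le> B * exp (- (?c \<bullet> x)) * (exp (\<gamma> / 2 * t) / (1 - 2 powr (b - 2)))"
      using B0 two by (subst (asm) ennreal_le_iff) auto
    also have "\<dots> = D * exp (\<gamma> / 2 * t + - (?c \<bullet> x))" unfolding D_def exp_add by simp
    finally have "(h t x)\<^sup>2 \<le> (D * exp (\<gamma> / 2 * t + - (?c \<bullet> x)))\<^sup>2"
      by (intro power_mono h_nonneg)
    also have "\<dots> = D\<^sup>2 * exp (\<gamma> * t - c \<bullet> x)"
      by (simp add: power_mult_distrib power2_eq_square exp_add[symmetric] algebra_simps)
    finally show ?thesis .
  qed
  then show ?thesis by (intro exI[of _ "D\<^sup>2"]) auto
qed

text \<open>On a bounded time interval the solution has a crude uniform bound. Each use of the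
  renewal inequality multiplies this bound by the contraction factor and reproduces the target
  bound, so only the latter survives in the limit. The crude bound depends on \<open>T\<close>, the
  surviving constant does not.\<close>

lemma second_moment_upper:
  assumes \<gamma>: "0 < \<gamma>" and q: "contraction \<gamma> < 1"
  shows "\<exists>A\<ge>0. \<forall>c. \<nu> * (norm c)\<^sup>2 \<le> \<gamma> powr b \<longrightarrow> (\<forall>t>0. \<forall>x. v t x \<le> A * exp (\<gamma> * t - c \<bullet> x))"
proof -
  obtain H where H0: "0 \<le> H" and H: "\<And>c t x. \<nu> * (norm c)\<^sup>2 \<le> \<gamma> powr b \<Longrightarrow> 0 < t \<Longrightarrow> (h t x)\<^sup>2 \<le> H * exp (\<gamma> * t - c \<bullet> x)"
    using initial_term_le[OF \<gamma>] by blast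
  let ?q = "contraction \<gamma>"
  \<comment> \<open>The fixed point of the iteration \<open>A \<mapsto> H + A * ?q\<close>.\<close>
  define A where "A = H / (1 - ?q)"
  have A0: "0 \<le> A" using H0 q by (simp add: A_def)
  have A: "H + A * ?q = A" using q by (simp add: A_def field_simps)
  have "v T x \<le> A * exp (\<gamma> * T - c \<bullet> x)" if c: "\<nu> * (norm c)\<^sup>2 \<le> \<gamma> powr b" and T: "0 < T" for c T x
  proof -
    obtain C0 where C0: "\<forall>t\<in>{0..T}. \<forall>x. v t x \<le> C0" using v_bounded[of T] by blast
    define C where "C = max C0 0"
    have C: "0 \<le> C" "\<And>t x. 0 \<le> t \<Longrightarrow> t \<le> T \<Longrightarrow> v t x \<le> C" using C0 by (auto simp: C_def le_max_iff_disj)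
    \<comment> \<open>Two weights run in parallel: the tilted one carries the target bound, while
      the crude constant is propagated with the untilted weight \<open>c = 0\<close>.\<close>
    have claim: "v t x \<le> A * exp (\<gamma> * t - c \<bullet> x) + C * ?q ^ N * exp (\<gamma> * t)" if t: "0 < t" "t \<le> T" for N t x
      using t
    proof (induction N arbitrary: t x)
      case 0
      have "v t x \<le> C * 1" using C(2)[of t x] 0 by simp
      also have "\<dots> \<le> C * exp (\<gamma> * t)" using C(1) \<gamma> 0 by (intro mult_left_mono) auto
      finally show ?case using A0 by (simp add: add_increasing)
    next
      case (Suc N)
      let ?E = "\<lambda>c z. ennreal (exp (\<gamma> * fst z - c \<bullet> snd z)) * k ((t, x) - z)"
      have Em: "?E c \<in> borel_measurable lborel" for c
      proof -
        have "(\<lambda>z. k ((t, x) - z)) \<in> borel_measurable borel"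
          by (rule measurable_compose[OF _ k_measurable]) (auto intro!: borel_measurable_continuous_onI continuous_intros)
        moreover have "(\<lambda>z. exp (\<gamma> * fst z - c \<bullet> snd z)) \<in> borel_measurable borel"
          by (intro borel_measurable_continuous_onI continuous_intros)
        ultimately show ?thesis by simp
      qed
      have pt: "S z * k ((t, x) - z) \<le> ennreal (Lip\<^sup>2) * (ennreal A * ?E c z + ennreal (C * ?q ^ N) * ?E 0 z)" for z
      proof (cases "0 < fst z \<and> fst z < t")
        case True
        have "S z \<le> source (fst z) (snd z)" by (simp add: S_def)
        also have "\<dots> \<le> ennreal (Lip\<^sup>2) * ennreal (v (fst z) (snd z))" using True by (intro source_le) simp
        also have "ennreal (v (fst z) (snd z)) \<le> ennreal (A * exp (\<gamma> * fst z - c \<bullet> snd z) + C * ?q ^ N * exp (\<gamma> * fst z))"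
          using Suc.IH[of "fst z" "snd z"] True Suc.prems by (intro ennreal_leI) auto
        also have "\<dots> = ennreal A * ennreal (exp (\<gamma> * fst z - c \<bullet> snd z)) + ennreal (C * ?q ^ N) * ennreal (exp (\<gamma> * fst z - 0 \<bullet> snd z))"
          using A0 C(1) contraction_nonneg[of \<gamma>] by (simp add: ennreal_mult''[symmetric])
        finally have "S z * k ((t, x) - z) \<le> ennreal (Lip\<^sup>2) * (ennreal A * ennreal (exp (\<gamma> * fst z - c \<bullet> snd z)) + ennreal (C * ?q ^ N) * ennreal (exp (\<gamma> * fst z - 0 \<bullet> snd z))) * k ((t, x) - z)"
          by (intro mult_right_mono) (auto simp: mult_left_mono)
        then show ?thesis by (simp only: distrib_right mult.assoc)
      next
        case False
        then have "S z * k ((t, x) - z) = 0" by (cases z) (auto simp: S_def k_def)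
        then show ?thesis by (simp only: zero_le)
      qed
      have "(\<integral>\<^sup>+z. S z * k ((t, x) - z) \<partial>lborel) \<le> (\<integral>\<^sup>+z. ennreal (Lip\<^sup>2) * (ennreal A * ?E c z + ennreal (C * ?q ^ N) * ?E 0 z) \<partial>lborel)"
        by (intro nn_integral_mono pt)
      also have "\<dots> = ennreal (Lip\<^sup>2) * (ennreal A * (\<integral>\<^sup>+z. ?E c z \<partial>lborel) + ennreal (C * ?q ^ N) * (\<integral>\<^sup>+z. ?E 0 z \<partial>lborel))"
        using Em[of c] Em[of 0] by (subst nn_integral_cmult, simp, subst nn_integral_add, simp, simp, subst (1 2) nn_integral_cmult, simp_all)
      also have "\<dots> = ennreal A * ennreal (exp (\<gamma> * t - c \<bullet> x)) * (ennreal (Lip\<^sup>2) * (\<integral>\<^sup>+p. ennreal (exp (- \<gamma> * fst p + c \<bullet> snd p)) * k p \<partial>lborel))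
          + ennreal (C * ?q ^ N) * ennreal (exp (\<gamma> * t - 0 \<bullet> x)) * (ennreal (Lip\<^sup>2) * (\<integral>\<^sup>+p. ennreal (exp (- \<gamma> * fst p + 0 \<bullet> snd p)) * k p \<partial>lborel))"
        unfolding weighted_convolution by (simp only: distrib_left mult_ac)
      also have "\<dots> \<le> ennreal A * ennreal (exp (\<gamma> * t - c \<bullet> x)) * ennreal ?q + ennreal (C * ?q ^ N) * ennreal (exp (\<gamma> * t - 0 \<bullet> x)) * ennreal ?q"
        using \<gamma> c by (intro add_mono mult_left_mono weighted_energy_le) auto
      also have "\<dots> = ennreal (A * exp (\<gamma> * t - c \<bullet> x) * ?q + C * ?q ^ N * exp (\<gamma> * t) * ?q)"
        using A0 C(1) contraction_nonneg[of \<gamma>] by (simp add: ennreal_mult''[symmetric])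
      finally have "ennreal (v t x) \<le> ennreal (H * exp (\<gamma> * t - c \<bullet> x)) + ennreal (A * exp (\<gamma> * t - c \<bullet> x) * ?q + C * ?q ^ N * exp (\<gamma> * t) * ?q)"
        using second_moment[OF Suc.prems(1), of x] H[OF c Suc.prems(1), of x]
        by (auto intro!: add_mono ennreal_leI)
      also have "\<dots> = ennreal ((H + A * ?q) * exp (\<gamma> * t - c \<bullet> x) + C * ?q ^ Suc N * exp (\<gamma> * t))"
        using A0 C(1) contraction_nonneg[of \<gamma>] H0 by (subst ennreal_plus[symmetric]) (auto simp: algebra_simps)
      finally show ?case
        using A0 C(1) contraction_nonneg[of \<gamma>] unfolding A by (subst (asm) ennreal_le_iff) auto
    qed
    have "(\<lambda>N. A * exp (\<gamma> * T - c \<bullet> x) + C * ?q ^ N * exp (\<gamma> * T)) \<longlonglongrightarrow> A * exp (\<gamma> * T - c \<bullet> x) + C * 0 * exp (\<gamma> * T)"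
      using q contraction_nonneg[of \<gamma>] by (intro tendsto_intros LIMSEQ_realpow_zero)
    then show ?thesis
      using claim[OF T] by (intro LIMSEQ_le_const[of "\<lambda>N. A * exp (\<gamma> * T - c \<bullet> x) + C * ?q ^ N * exp (\<gamma> * T)"]) auto
  qed
  with A0 show ?thesis by blast
qed

end

section \<open>Decay beyond the threshold speed\<close>

lemma elog_mult_le:
  assumes t: "0 < t" and v: "v \<le> exp (a * t)"
  shows "ereal (1 / t) * elog v \<le> ereal a"
proof (cases "0 < v")
  case True
  then have "ln v \<le> ln (exp (a * t))" using v by (subst ln_le_cancel_iff) auto
  then have "ln v \<le> a * t" by simp
  then have "1 / t * ln v \<le> a" using t by (simp add: field_simps)
  then show ?thesis using True by (simp add: elog_def)
qed (use t in \<open>simp add: elog_def\<close>)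

lemma le_exp_of_elog_le:
  assumes t: "0 < t" and v: "ereal (1 / t) * elog v \<le> ereal a"
  shows "v \<le> exp (a * t)"
proof (cases "0 < v")
  case True
  then have "1 / t * ln v \<le> a" using v by (simp add: elog_def)
  then have "ln v \<le> a * t" using t by (simp add: field_simps)
  then have "exp (ln v) \<le> exp (a * t)" by simp
  then show ?thesis using True by simp
qed (use less_imp_le[OF exp_gt_zero[of "a * t"]] in linarith)

context mild_spde begin

lemma Lip_nonneg: "0 \<le> Lip"
  using lip by (simp add: lipschitz_on_def)

text \<open>With \<open>e = 1 - b * d / 2\<close> and \<open>X = Lip * const_c0 \<nu> b d\<close>,
  the contraction factor equals
  \<open>(2 * \<nu>) powr (e / b) * X\<^sup>2 * \<gamma> powr (- e)\<close>; the power of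
  \<open>2 * \<nu>\<close> cancels the one in \<open>const_c0\<close>. Solving for
  \<open>\<gamma>\<close> gives the stated bound, whose exponent is \<open>2 / e\<close>.\<close>

lemma contraction_less_1:
  assumes \<gamma>: "0 < \<gamma>"
    and large: "(2 * \<nu>) powr (1 / b) * (Lip * const_c0 \<nu> b CARD('d)) powr (4 / (2 - b * real CARD('d))) < \<gamma>"
  shows "contraction \<gamma> < 1"
proof -
  let ?d = "real CARD('d)"
  define e where "e = 1 - b * ?d / 2"
  have e: "0 < e" using bdim by (simp add: e_def)
  define X where "X = Lip * const_c0 \<nu> b CARD('d)"
  have X0: "0 \<le> X" using Lip_nonneg by (simp add: X_def const_c0_def)
  have ex: "4 / (2 - b * ?d) = 2 / e" "1 / b - ?d / 2 = e / b" "b * ?d / 2 - 1 = - e"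
    using e b0 by (auto simp: e_def field_simps)
  have X2: "X powr 2 = X\<^sup>2" using X0 by (cases "X = 0") auto
  have "((2 * \<nu>) powr (1 / b) * X powr (2 / e)) powr e < \<gamma> powr e"
    using large X0 e unfolding ex X_def[symmetric] by (intro powr_less_mono2) auto
  also have "((2 * \<nu>) powr (1 / b) * X powr (2 / e)) powr e = (2 * \<nu>) powr (e / b) * X\<^sup>2"
    using e X0 nu b0 by (simp add: powr_mult powr_powr X2)
  finally have lt: "(2 * \<nu>) powr (e / b) * X\<^sup>2 < \<gamma> powr e" .
  have "X\<^sup>2 = Lip\<^sup>2 * ((const_M b CARD('d))\<^sup>2 / ((2 * \<nu>) powr (e / b) * (1 - 2 powr (b - 2))\<^sup>2 * (8 * pi * \<nu>) powr (?d / 2)))"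
    unfolding X_def const_c0_def ex power_mult_distrib by (subst real_sqrt_pow2) auto
  then have "contraction \<gamma> = (2 * \<nu>) powr (e / b) * X\<^sup>2 * \<gamma> powr (- e)"
    unfolding contraction_def ex using nu by (simp add: powr_minus field_simps)
  also have "\<dots> < \<gamma> powr e * \<gamma> powr (- e)"
    using lt \<gamma> by (intro mult_strict_right_mono) auto
  also have "\<dots> = 1" using \<gamma> by (simp add: powr_add[symmetric])
  finally show ?thesis .
qed

lemma growth_neg:
  assumes \<theta>: "(2 * \<nu>) powr (1 / b) * (Lip * const_c0 \<nu> b CARD('d)) powr (2 * (2 - b) / (2 - b * real CARD('d))) < \<theta>"
  shows "growth_L P u \<theta> < 0"
proof -
  let ?d = "real CARD('d)"
  define X where "X = Lip * const_c0 \<nu> b CARD('d)"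
  have X0: "0 \<le> X" using Lip_nonneg by (simp add: X_def const_c0_def)
  have \<theta>0: "0 < \<theta>" by (rule le_less_trans[OF _ \<theta>]) simp
  \<comment> \<open>With the largest tilt along \<open>x\<close> the rate is
    \<open>\<gamma> - sqrt (\<gamma> powr b / \<nu>) * \<theta>\<close>, negative as soon as
    \<open>\<gamma> powr (2 - b) < \<theta>\<^sup>2 / \<nu>\<close>. Taking half of this limit
    leaves room for strictness, and translates the lower bound required of \<open>\<gamma>\<close>
    into exactly the assumed threshold for \<open>\<theta>\<close>.\<close>
  define \<gamma> where "\<gamma> = (\<theta> / sqrt (2 * \<nu>)) powr (2 / (2 - b))"
  have \<gamma>: "0 < \<gamma>" using \<theta>0 nu by (simp add: \<gamma>_def)
  have b2: "0 < 2 - b" using b1 by simp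
  have \<gamma>2: "\<gamma> powr (2 - b) = \<theta>\<^sup>2 / (2 * \<nu>)"
  proof -
    have e: "2 / (2 - b) * (2 - b) = 2" using b2 by (simp add: divide_simps)
    show ?thesis unfolding \<gamma>_def powr_powr e using \<theta>0 nu by (simp add: power_divide)
  qed
  have q: "contraction \<gamma> < 1"
  proof (rule contraction_less_1[OF \<gamma>])
    let ?R = "(2 * \<nu>) powr (1 / b) * X powr (4 / (2 - b * ?d))"
    have "(2 * \<nu>) powr (1 / b) * X powr (2 * (2 - b) / (2 - b * ?d)) / sqrt (2 * \<nu>) < \<theta> / sqrt (2 * \<nu>)"
      using \<theta> nu by (intro divide_strict_right_mono) (auto simp: X_def)
    also have "(2 * \<nu>) powr (1 / b) * X powr (2 * (2 - b) / (2 - b * ?d)) / sqrt (2 * \<nu>) =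
        (2 * \<nu>) powr ((1 / b) * ((2 - b) / 2)) * X powr ((4 / (2 - b * ?d)) * ((2 - b) / 2))"
    proof -
      have "(2 * \<nu>) powr ((1 / b) * ((2 - b) / 2)) = (2 * \<nu>) powr (1 / b - 1 / 2)"
        using b0 by (intro arg_cong[where f = "(powr) (2 * \<nu>)"]) (simp add: field_simps)
      also have "\<dots> = (2 * \<nu>) powr (1 / b) / sqrt (2 * \<nu>)" using nu by (simp only: powr_diff) (simp add: powr_half_sqrt)
      finally have 1: "(2 * \<nu>) powr ((1 / b) * ((2 - b) / 2)) = (2 * \<nu>) powr (1 / b) / sqrt (2 * \<nu>)" .
      have 2: "4 / r * (s / 2) = 2 * s / r" for r s :: real by simp
      show ?thesis unfolding 1 2 by simp
    qed
    also have "\<dots> = ?R powr ((2 - b) / 2)"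
      using X0 nu by (simp only: powr_mult powr_powr)
    finally have "(?R powr ((2 - b) / 2)) powr (2 / (2 - b)) < \<gamma>"
      unfolding \<gamma>_def using b2 by (intro powr_less_mono2) auto
    then show "(2 * \<nu>) powr (1 / b) * (Lip * const_c0 \<nu> b CARD('d)) powr (4 / (2 - b * ?d)) < \<gamma>"
    proof -
      have e: "(2 - b) / 2 * (2 / (2 - b)) = 1" using b2 by (simp add: divide_simps)
      have "?R powr 1 = ?R" by simp
      with \<open>(?R powr ((2 - b) / 2)) powr (2 / (2 - b)) < \<gamma>\<close> show ?thesis
        unfolding powr_powr e X_def by simp
    qed
  qed
  obtain A where A0: "0 \<le> A" and A: "\<And>c t x. \<nu> * (norm c)\<^sup>2 \<le> \<gamma> powr b \<Longrightarrow> 0 < t \<Longrightarrow> v t x \<le> A * exp (\<gamma> * t - c \<bullet> x)"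
    using second_moment_upper[OF \<gamma> q] by blast
  define \<rho> where "\<rho> = sqrt (\<gamma> powr b / \<nu>)"
  have \<rho>0: "0 < \<rho>" using \<gamma> nu by (simp add: \<rho>_def)
  have \<rho>2: "\<nu> * \<rho>\<^sup>2 = \<gamma> powr b" using nu by (simp add: \<rho>_def)
  have "\<gamma> < \<rho> * \<theta>"
  proof (rule power_less_imp_less_base)
    have "\<gamma>\<^sup>2 = \<gamma> powr b * \<gamma> powr (2 - b)" using \<gamma> by (simp add: powr_add[symmetric])
    also have "\<dots> = \<gamma> powr b * \<theta>\<^sup>2 / (2 * \<nu>)" by (simp add: \<gamma>2)
    also have "\<dots> < \<gamma> powr b * \<theta>\<^sup>2 / \<nu>" using nu \<gamma> \<theta>0 by (intro divide_strict_left_mono) auto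
    also have "\<dots> = (\<rho> * \<theta>)\<^sup>2" unfolding \<rho>2[symmetric] using nu by (simp add: power_mult_distrib)
    finally show "\<gamma>\<^sup>2 < (\<rho> * \<theta>)\<^sup>2" .
  qed (use \<rho>0 \<theta>0 in simp)
  then have \<delta>: "0 < \<rho> * \<theta> - \<gamma>" by simp
  define \<delta> where "\<delta> = \<rho> * \<theta> - \<gamma>"
  have bound: "ereal (1 / t) * elog (v t x) \<le> ereal (- \<delta> / 2)"
    if t: "max 1 (2 * A / \<delta>) \<le> t" and x: "\<theta> * t < norm x" for t x
  proof (rule elog_mult_le)
    show t0: "0 < t" using t by simp
    have x0: "0 < norm x" using x \<theta>0 t0 by (smt (verit) mult_pos_pos)
    \<comment> \<open>The tilt depends on \<open>x\<close>, which is legitimate because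
      \<open>A\<close> is the same for all admissible \<open>c\<close>.\<close>
    define c where "c = (\<rho> / norm x) *\<^sub>R x"
    have "norm c = \<rho>" using x0 \<rho>0 by (simp add: c_def)
    then have "v t x \<le> A * exp (\<gamma> * t - c \<bullet> x)" using \<rho>2 by (intro A t0) simp
    also have "c \<bullet> x = \<rho> * norm x" using x0 by (simp add: c_def power2_norm_eq_inner[symmetric] power2_eq_square)
    also have "A * exp (\<gamma> * t - \<rho> * norm x) \<le> A * exp (\<gamma> * t - \<rho> * (\<theta> * t))"
      using A0 \<rho>0 x by (intro mult_left_mono) auto
    also have "\<gamma> * t - \<rho> * (\<theta> * t) = - \<delta> * t" by (simp add: \<delta>_def algebra_simps)
    \<comment> \<open>For large \<open>t\<close> the prefactor is absorbed by half of the decay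
      rate, through \<open>A \<le> \<delta> / 2 * t \<le> exp (\<delta> / 2 * t)\<close>.\<close>
    also have "A * exp (- \<delta> * t) \<le> exp (\<delta> / 2 * t) * exp (- \<delta> * t)"
    proof (rule mult_right_mono)
      have "A \<le> \<delta> / 2 * t" using t \<delta> by (simp add: \<delta>_def[symmetric] field_simps)
      also have "\<dots> \<le> exp (\<delta> / 2 * t)" using exp_ge_add_one_self[of "\<delta> / 2 * t"] by linarith
      finally show "A \<le> exp (\<delta> / 2 * t)" .
    qed simp
    also have "\<dots> = exp (- \<delta> / 2 * t)" by (simp add: exp_add[symmetric])
    finally show "v t x \<le> exp (- \<delta> / 2 * t)" .
  qed
  have "growth_L P u \<theta> \<le> ereal (- \<delta> / 2)"
    unfolding growth_L_def v_def[symmetric]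
  proof (rule Limsup_bounded)
    show "\<forall>\<^sub>F t in at_top. (SUP x\<in>{x. \<theta> * t < norm x}. ereal (1 / t) * elog (v t x)) \<le> ereal (- \<delta> / 2)"
      using eventually_ge_at_top[of "max 1 (2 * A / \<delta>)"]
      by eventually_elim (intro SUP_least bound, auto)
  qed
  also have "\<dots> < 0" using \<delta> by (simp add: \<delta>_def)
  finally show ?thesis .
qed

end

subsection \<open>Lower bound\<close>

lemma not_AE_notin_open:
  fixes U :: "'a::euclidean_space set"
  assumes U: "open U" "U \<noteq> {}"
  shows "\<not> (AE p in lborel. p \<notin> U)"
proof
  assume "AE p in lborel. p \<notin> U"
  then have "U \<in> null_sets lborel" using U by (subst AE_iff_null_sets) auto
  then have "U \<in> null_sets lebesgue" by (rule null_sets_completionI)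
  then show False using open_not_negligible[OF U] by (simp add: negligible_iff_null_sets)
qed

lemma nn_integral_pos_on_open:
  fixes f :: "'a::euclidean_space \<Rightarrow> ennreal"
  assumes [measurable]: "f \<in> borel_measurable borel" and U: "open U" "U \<noteq> {}" and pos: "\<And>x. x \<in> U \<Longrightarrow> x \<noteq> c \<Longrightarrow> 0 < f x"
  shows "0 < (\<integral>\<^sup>+x. f x \<partial>lborel)"
proof (rule ccontr)
  assume "\<not> 0 < (\<integral>\<^sup>+x. f x \<partial>lborel)"
  then have "(\<integral>\<^sup>+x. f x \<partial>lborel) = 0" by simp
  then have "AE x in lborel. f x = 0" by (subst (asm) nn_integral_0_iff_AE) auto
  then have "AE x in lborel. x \<notin> U" using AE_lborel_singleton[of c]
    by eventually_elim (use pos in force)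
  with not_AE_notin_open[OF U] show False by blast
qed

lemma nn_integral_lborel_translate:
  fixes f :: "'a::euclidean_space \<Rightarrow> ennreal"
  assumes [measurable]: "f \<in> borel_measurable borel"
  shows "(\<integral>\<^sup>+p. f (p - z) \<partial>lborel) = (\<integral>\<^sup>+p. f p \<partial>lborel)"
proof -
  have "(\<integral>\<^sup>+p. f (p - z) \<partial>lborel) = (\<integral>\<^sup>+q. f ((z - q) - z) \<partial>lborel)"
    by (rule nn_integral_lborel_reflect[symmetric]) measurable
  also have "\<dots> = (\<integral>\<^sup>+q. f (0 - q) \<partial>lborel)" by simp
  also have "\<dots> = (\<integral>\<^sup>+p. f p \<partial>lborel)" by (rule nn_integral_lborel_reflect) measurable
  finally show ?thesis .
qed

lemma nn_integral_lborel_scale: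
  fixes f :: "real^'d::finite \<Rightarrow> ennreal"
  assumes [measurable]: "f \<in> borel_measurable borel" and a: "0 < a"
  shows "(\<integral>\<^sup>+x. f x \<partial>lborel) = ennreal (a ^ CARD('d)) * (\<integral>\<^sup>+y. f (a *\<^sub>R y) \<partial>lborel)"
proof -
  have L: "lborel = density (distr lborel borel (\<lambda>x::real^'d. a *\<^sub>R x)) (\<lambda>_. ennreal (a ^ CARD('d)))"
    using lborel_affine[of a "0 :: real^'d"] a by simp
  have "(\<integral>\<^sup>+x. f x \<partial>lborel) = (\<integral>\<^sup>+x. f x \<partial>density (distr lborel borel (\<lambda>x::real^'d. a *\<^sub>R x)) (\<lambda>_. ennreal (a ^ CARD('d))))"
    by (rule arg_cong[OF L])
  also have "\<dots> = ennreal (a ^ CARD('d)) * (\<integral>\<^sup>+y. f (a *\<^sub>R y) \<partial>lborel)"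
    by (simp add: nn_integral_density nn_integral_distr nn_integral_cmult)
  finally show ?thesis .
qed

lemma nn_integral_powr_diverges:
  fixes p :: real
  assumes p: "p \<le> 1"
  shows "(\<integral>\<^sup>+t\<in>{0<..}. ennreal (t powr (- p)) \<partial>lborel) = \<infinity>"
proof -
  have le: "ennreal (real n) \<le> (\<integral>\<^sup>+t\<in>{0<..}. ennreal (t powr (- p)) \<partial>lborel)" for n :: nat
  proof -
    have eq: "(\<integral>\<^sup>+t. ennreal (1 / t) * indicator {1..exp (real n)} t \<partial>lborel) = ennreal (ln (exp (real n)) - ln 1)"
      by (rule nn_integral_FTC_Icc) (auto intro!: derivative_eq_intros)
    have "(\<integral>\<^sup>+t. ennreal (1 / t) * indicator {1..exp (real n)} t \<partial>lborel) \<le> (\<integral>\<^sup>+t\<in>{0<..}. ennreal (t powr (- p)) \<partial>lborel)"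
    proof (rule nn_integral_mono)
      fix t :: real
      show "ennreal (1 / t) * indicator {1..exp (real n)} t \<le> ennreal (t powr (- p)) * indicator {0<..} t"
      proof (cases "1 \<le> t")
        case True
        then have "1 / t = t powr (- 1)" by (simp add: powr_minus_divide)
        also have "\<dots> \<le> t powr (- p)" using True p by (intro powr_mono) auto
        finally show ?thesis using True by (auto simp: indicator_def intro: ennreal_leI)
      qed simp
    qed
    then show ?thesis unfolding eq by simp
  qed
  show ?thesis
  proof (rule ccontr)
    assume "(\<integral>\<^sup>+t\<in>{0<..}. ennreal (t powr (- p)) \<partial>lborel) \<noteq> \<infinity>"
    then obtain r where r: "(\<integral>\<^sup>+t\<in>{0<..}. ennreal (t powr (- p)) \<partial>lborel) = ennreal r" "0 \<le> r"
      by (cases "(\<integral>\<^sup>+t\<in>{0<..}. ennreal (t powr (- p)) \<partial>lborel)") auto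
    obtain n :: nat where "r < real n" using reals_Archimedean2 by blast
    with le[of n] r show False by (simp add: ennreal_le_iff)
  qed
qed

text \<open>Self-similarity: the inverse subordinator scales like \<open>t powr b\<close>, and
  Gaussian space like the square root of its clock, hence the factor
  \<open>t powr (b / 2)\<close>.\<close>

lemma (in stable_index) kernel_scaling:
  fixes y :: "real^'d::finite"
  assumes \<nu>: "0 < \<nu>" and t: "0 < t"
  defines "a \<equiv> t powr (b / 2)"
  shows "kernel \<nu> t (a *\<^sub>R y) = ennreal (a powr (- real CARD('d))) * kernel \<nu> 1 y"
proof -
  have a: "0 < a" "a\<^sup>2 = t powr b" using t by (auto simp: a_def power2_eq_square powr_add[symmetric])
  have "heat_p \<nu> ((t / w) powr b) (a *\<^sub>R y) = a powr (- real CARD('d)) * heat_p \<nu> ((1 / w) powr b) y" if w: "0 < w" for w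
  proof -
    define s where "s = (1 / w) powr b"
    have s: "0 < s" using w by (simp add: s_def)
    have tw: "(t / w) powr b = a\<^sup>2 * s" unfolding a(2) s_def by (simp add: powr_divide)
    have "(4 * pi * \<nu> * (a\<^sup>2 * s)) powr (- real CARD('d) / 2) = (a\<^sup>2 * (4 * pi * \<nu> * s)) powr (- real CARD('d) / 2)"
      by (simp only: mult_ac)
    also have "\<dots> = (a\<^sup>2) powr (- real CARD('d) / 2) * (4 * pi * \<nu> * s) powr (- real CARD('d) / 2)"
      by (rule powr_mult)
    also have "(a\<^sup>2) powr (- real CARD('d) / 2) = a powr (- real CARD('d))"
    proof -
      have "a\<^sup>2 = a powr 2" using a by simp
      then show ?thesis by (simp only: powr_powr) simp
    qed
    finally have 1: "(4 * pi * \<nu> * (a\<^sup>2 * s)) powr (- real CARD('d) / 2) = a powr (- real CARD('d)) * (4 * pi * \<nu> * s) powr (- real CARD('d) / 2)" .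
    have 2: "- (norm (a *\<^sub>R y))\<^sup>2 / (4 * \<nu> * (a\<^sup>2 * s)) = - (norm y)\<^sup>2 / (4 * \<nu> * s)"
      using a(1) s \<nu> by (simp add: power_mult_distrib)
    show ?thesis unfolding heat_p_def tw s_def[symmetric] 1 2 by (simp only: mult.assoc)
  qed
  then have "kernel \<nu> t (a *\<^sub>R y) = (\<integral>\<^sup>+w. ennreal (a powr (- real CARD('d))) * ennreal (heat_p \<nu> ((1 / w) powr b) y * g w) \<partial>lborel)"
    unfolding kernel_def
    by (intro nn_integral_cong) (metis (no_types, lifting) g_zero linorder_not_less mult_zero_right ennreal_0 mult.assoc ennreal_mult' powr_ge_zero)
  also have "\<dots> = ennreal (a powr (- real CARD('d))) * kernel \<nu> 1 y"
    unfolding kernel_def by (rule nn_integral_cmult) measurable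
  finally show ?thesis .
qed

text \<open>Coordinatewise inequalities are used because the region
  \<open>norm x > \<theta> * t\<close> is not closed under addition. For \<theta> \<ge> 0 the cone
  lies inside that region, where the growth hypothesis applies.\<close>

definition cone :: "real \<Rightarrow> (real \<times> (real^'d::finite)) set" where
  "cone \<theta> = {p. 0 < fst p \<and> (\<forall>i. \<theta> * fst p < snd p $ i)}"

lemma open_cone: "open (cone \<theta> :: (real \<times> (real^'d::finite)) set)"
proof -
  have "cone \<theta> = {p :: real \<times> (real^'d). 0 < fst p} \<inter> (\<Inter>i. {p. \<theta> * fst p < snd p $ i})"
    by (auto simp: cone_def)
  moreover have "open {p :: real \<times> (real^'d). 0 < fst p}" by (intro open_Collect_less continuous_intros)
  moreover have "open {p :: real \<times> (real^'d). \<theta> * fst p < snd p $ i}" for i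
    by (intro open_Collect_less continuous_intros)
  ultimately show ?thesis by (auto intro!: open_Int open_INT)
qed

lemma open_orthant: "open {x :: real^'d::finite. \<forall>i. 0 < x $ i}"
proof -
  have "{x :: real^'d. \<forall>i. 0 < x $ i} = (\<Inter>i. {x. 0 < x $ i})" by auto
  moreover have "open {x :: real^'d. 0 < x $ i}" for i by (intro open_Collect_less continuous_intros)
  ultimately show ?thesis by (auto intro!: open_INT)
qed

lemma cone_measurable [measurable]: "cone \<theta> \<in> sets borel"
  using open_cone by (rule borel_open)

lemma cone_nonempty: "(cone \<theta> :: (real \<times> (real^'d::finite)) set) \<noteq> {}"
proof -
  have "(1, \<chi> i. \<theta> + 1) \<in> (cone \<theta> :: (real \<times> (real^'d)) set)" by (simp add: cone_def)
  then show ?thesis by blast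
qed

lemma cone_add: "p \<in> cone \<theta> \<Longrightarrow> q \<in> cone \<theta> \<Longrightarrow> p + q \<in> cone \<theta>"
  by (auto simp: cone_def distrib_left intro!: add_strict_mono)

context mild_spde begin

text \<open>The open orthant is invariant under dilations, so scaling makes its spatial integral a
  positive constant times \<open>t powr (- (b * d / 2))\<close>. As \<open>b * d < 2\<close>, the
  integral over large times diverges.\<close>

lemma orthant_energy_infinite: "(\<integral>\<^sup>+p. indicator (cone 0) p * k p \<partial>lborel) = \<infinity>"
proof -
  let ?O = "{x :: real^'d. \<forall>i. 0 < x $ i}"
  define c1 where "c1 = (\<integral>\<^sup>+y. indicator ?O y * (kernel \<nu> 1 y)\<^sup>2 \<partial>lborel)"
  note O = open_orthant
  have [measurable]: "?O \<in> sets borel" using O by (rule borel_open)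
  have "(\<chi> i. 1) \<in> ?O" by simp
  then have "?O \<noteq> {}" by blast
  then have c1: "0 < c1" unfolding c1_def
    by (intro nn_integral_pos_on_open[OF _ O, of _ 0]) (auto simp: kernel_pos nu power2_eq_square ennreal_zero_less_mult_iff)
  have "(\<integral>\<^sup>+p. indicator (cone 0) p * k p \<partial>lborel) = (\<integral>\<^sup>+t. (\<integral>\<^sup>+x. indicator (cone 0) (t, x) * k (t, x) \<partial>lborel) \<partial>lborel)"
    by (rule nn_integral_lborel_pair) measurable
  also have "\<dots> = (\<integral>\<^sup>+t. c1 * (ennreal (t powr (- (b * real CARD('d) / 2))) * indicator {0<..} t) \<partial>lborel)"
  proof (rule nn_integral_cong)
    fix t :: real
    show "(\<integral>\<^sup>+x. indicator (cone 0) (t, x) * k (t, x) \<partial>lborel) = c1 * (ennreal (t powr (- (b * real CARD('d) / 2))) * indicator {0<..} t)"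
    proof (cases "0 < t")
      case t: True
      define a where "a = t powr (b / 2)"
      have a: "0 < a" using t by (simp add: a_def)
      have ks: "kernel \<nu> t (a *\<^sub>R y) = ennreal (a powr (- real CARD('d))) * kernel \<nu> 1 y" for y :: "real^'d"
        unfolding a_def by (rule kernel_scaling[OF nu t])
      have "(\<integral>\<^sup>+x. indicator (cone 0) (t, x) * k (t, x) \<partial>lborel) = (\<integral>\<^sup>+x. indicator ?O x * (kernel \<nu> t x)\<^sup>2 \<partial>lborel)"
        using t by (intro nn_integral_cong) (simp add: cone_def k_def indicator_def)
      also have "\<dots> = ennreal (a ^ CARD('d)) * (\<integral>\<^sup>+y. indicator ?O (a *\<^sub>R y) * (kernel \<nu> t (a *\<^sub>R y))\<^sup>2 \<partial>lborel)"
        using a by (intro nn_integral_lborel_scale) measurable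
      also have "(\<integral>\<^sup>+y. indicator ?O (a *\<^sub>R y) * (kernel \<nu> t (a *\<^sub>R y))\<^sup>2 \<partial>lborel) = (\<integral>\<^sup>+y. (ennreal (a powr (- real CARD('d))))\<^sup>2 * (indicator ?O y * (kernel \<nu> 1 y)\<^sup>2) \<partial>lborel)"
        using a ks by (intro nn_integral_cong) (simp add: indicator_def zero_less_mult_iff power_mult_distrib)
      also have "\<dots> = (ennreal (a powr (- real CARD('d))))\<^sup>2 * c1"
        unfolding c1_def by (rule nn_integral_cmult) measurable
      finally have "(\<integral>\<^sup>+x. indicator (cone 0) (t, x) * k (t, x) \<partial>lborel) = ennreal (a ^ CARD('d)) * (ennreal (a powr (- real CARD('d))))\<^sup>2 * c1"
        by (simp only: mult.assoc)
      also have "ennreal (a ^ CARD('d)) * (ennreal (a powr (- real CARD('d))))\<^sup>2 = ennreal (a ^ CARD('d) * (a powr (- real CARD('d)))\<^sup>2)"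
        using a by (simp add: ennreal_power ennreal_mult')
      also have "a ^ CARD('d) * (a powr (- real CARD('d)))\<^sup>2 = t powr (- (b * real CARD('d) / 2))"
      proof -
        have "a ^ CARD('d) * (a powr (- real CARD('d)))\<^sup>2 = a powr (real CARD('d) + (- real CARD('d) + - real CARD('d)))"
          using a by (simp only: powr_add power2_eq_square powr_realpow[symmetric])
        also have "\<dots> = t powr (- (b * real CARD('d) / 2))" by (simp add: a_def powr_powr)
        finally show ?thesis .
      qed
      finally show ?thesis using t by (simp add: mult.commute)
    next
      case False
      then have "(\<integral>\<^sup>+x. indicator (cone 0) (t, x) * k (t, x) \<partial>lborel) = (\<integral>\<^sup>+x. 0 \<partial>(lborel :: (real^'d) measure))"
        by (intro nn_integral_cong) (simp add: k_def)
      then show ?thesis using False by simp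
    qed
  qed
  also have "\<dots> = c1 * (\<integral>\<^sup>+t\<in>{0<..}. ennreal (t powr (- (b * real CARD('d) / 2))) \<partial>lborel)"
    by (rule nn_integral_cmult) measurable
  also have "\<dots> = \<infinity>"
    using bdim c1 by (subst nn_integral_powr_diverges) (auto simp: ennreal_mult_top)
  finally show ?thesis .
qed

section \<open>Energy and mass of space-time cones\<close>

definition cone_energy :: "real \<Rightarrow> real \<Rightarrow> ennreal" where
  "cone_energy \<theta> \<gamma> = (\<integral>\<^sup>+p. indicator (cone \<theta>) p * (ennreal (exp (- \<gamma> * fst p)) * k p) \<partial>lborel)"

lemma fst_borel [measurable]: "(\<lambda>p. fst p) \<in> borel_measurable (borel :: (real \<times> (real^'d)) measure)"
  by (intro borel_measurable_continuous_onI continuous_intros)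

text \<open>Monotone convergence to the infinite energy of the orthant. One parameter serves as
  slope and as discount rate: when it decreases to 0, the cones fill \<open>cone 0\<close> while the
  damping disappears.\<close>

lemma cone_energy_large:
  assumes C: "C < \<infinity>"
  shows "\<exists>\<theta>>0. C < cone_energy \<theta> \<theta>"
proof -
  let ?e = "\<lambda>n. 1 / real (Suc n)"
  let ?f = "\<lambda>n p. indicator (cone (?e n)) p * (ennreal (exp (- ?e n * fst p)) * k p)"
  have "(\<lambda>n. \<integral>\<^sup>+p. ?f n p \<partial>lborel) \<longlonglongrightarrow> (\<integral>\<^sup>+p. indicator (cone 0) p * k p \<partial>lborel)"
  proof (rule nn_integral_LIMSEQ)
    show "incseq ?f"
    proof (intro incseq_SucI le_funI)
      fix n and p :: "real \<times> (real^'d)"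
      have e: "?e (Suc n) \<le> ?e n" by (simp add: field_simps)
      show "?f n p \<le> ?f (Suc n) p"
      proof (cases "p \<in> cone (?e n)")
        case True
        then have p: "0 < fst p" by (simp add: cone_def)
        then have le: "?e (Suc n) * fst p \<le> ?e n * fst p" using e by (intro mult_right_mono) auto
        have "?e (Suc n) * fst p < snd p $ i" for i
          using True by (intro le_less_trans[OF le]) (simp add: cone_def)
        then have "p \<in> cone (?e (Suc n))" using p by (simp add: cone_def)
        moreover have "exp (- ?e n * fst p) \<le> exp (- ?e (Suc n) * fst p)" using le by simp
        ultimately show ?thesis using True by (auto intro!: mult_right_mono ennreal_leI)
      qed simp
    qed
    fix p :: "real \<times> (real^'d)"
    show "(\<lambda>n. ?f n p) \<longlonglongrightarrow> indicator (cone 0) p * k p"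
    proof (cases "p \<in> cone 0")
      case True
      have ind: "indicator (cone 0) p * k p = k p" using True by simp
      have "(\<lambda>n. ?e n * fst p) \<longlonglongrightarrow> 0 * fst p" by (intro tendsto_intros LIMSEQ_Suc[OF lim_1_over_n])
      then have lim: "(\<lambda>n. ?e n * fst p) \<longlonglongrightarrow> 0" by simp
      have "\<forall>\<^sub>F n in sequentially. ?e n * fst p < snd p $ i" for i
        using True by (intro order_tendstoD(2)[OF lim]) (simp add: cone_def)
      then have "\<forall>\<^sub>F n in sequentially. \<forall>i. ?e n * fst p < snd p $ i" by (rule eventually_all_finite)
      then have ev: "\<forall>\<^sub>F n in sequentially. ennreal (exp (- ?e n * fst p)) * k p = ?f n p"
        by eventually_elim (use True in \<open>simp add: cone_def\<close>)
      show ?thesis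
      proof (cases "k p = \<infinity>")
        case False
        have "(\<lambda>n. exp (- (?e n * fst p))) \<longlonglongrightarrow> exp (- 0)" by (intro tendsto_intros lim)
        then have "(\<lambda>n. k p * ennreal (exp (- (?e n * fst p)))) \<longlonglongrightarrow> k p * ennreal (exp (- 0))"
          using False by (intro ennreal_tendsto_cmult tendsto_ennrealI) (auto simp: less_top)
        then have "(\<lambda>n. ennreal (exp (- ?e n * fst p)) * k p) \<longlonglongrightarrow> k p" by (simp add: mult.commute)
        then show ?thesis unfolding ind by (rule Lim_transform_eventually[OF _ ev])
      next
        case kinf: True
        have "(\<lambda>n. ennreal (exp (- ?e n * fst p)) * k p) \<longlonglongrightarrow> k p" by (simp add: kinf ennreal_mult_top)
        then show ?thesis unfolding ind by (rule Lim_transform_eventually[OF _ ev])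
      qed
    next
      case False
      have "p \<notin> cone (?e n)" for n
      proof
        assume "p \<in> cone (?e n)"
        then have p: "0 < fst p" "\<And>i. ?e n * fst p < snd p $ i" by (auto simp: cone_def)
        have "0 \<le> ?e n * fst p" using p(1) by simp
        then have "0 < snd p $ i" for i using p(2)[of i] by linarith
        then show False using False p(1) by (simp add: cone_def)
      qed
      then show ?thesis using False by simp
    qed
  qed measurable
  then have "(\<lambda>n. cone_energy (?e n) (?e n)) \<longlonglongrightarrow> \<infinity>"
    unfolding orthant_energy_infinite cone_energy_def .
  then have "\<forall>\<^sub>F n in sequentially. C < cone_energy (?e n) (?e n)" using C by (rule order_tendstoD(1))
  then obtain n where "C < cone_energy (?e n) (?e n)" using eventually_happens'[OF sequentially_bot] by blast
  then show ?thesis by (intro exI[of _ "?e n"]) auto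
qed

lemma cone_energy_antimono: "\<theta> \<le> \<theta>' \<Longrightarrow> cone_energy \<theta>' \<gamma> \<le> cone_energy \<theta> \<gamma>"
  unfolding cone_energy_def
proof (rule nn_integral_mono)
  fix p :: "real \<times> (real^'d)" assume "\<theta> \<le> \<theta>'"
  then have "p \<in> cone \<theta>' \<Longrightarrow> p \<in> cone \<theta>"
    by (auto simp: cone_def intro: le_less_trans[OF mult_right_mono])
  then show "indicator (cone \<theta>') p * (ennreal (exp (- \<gamma> * fst p)) * k p) \<le> indicator (cone \<theta>) p * (ennreal (exp (- \<gamma> * fst p)) * k p)"
    by (auto simp: indicator_def)
qed

definition cone_mass :: "real \<Rightarrow> real \<Rightarrow> ennreal" where
  "cone_mass \<theta> \<gamma> = (\<integral>\<^sup>+p. indicator (cone \<theta>) p * (ennreal (exp (- \<gamma> * fst p)) * S p) \<partial>lborel)"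

text \<open>A cone of nonnegative slope avoids the spatial origin, where \<open>S\<close> is set to
  0.\<close>

lemma S_ge:
  assumes L: "0 \<le> L" "\<And>z. L * \<bar>z\<bar> \<le> \<bar>\<sigma> z\<bar>" and p: "p \<in> cone \<theta>" and \<theta>: "0 \<le> \<theta>"
  shows "ennreal (L\<^sup>2) * ennreal (v (fst p) (snd p)) \<le> S p"
proof -
  have p0: "0 < fst p" "\<And>i. \<theta> * fst p < snd p $ i" using p by (auto simp: cone_def)
  have "snd p \<noteq> 0"
  proof
    assume "snd p = 0"
    then have "\<theta> * fst p < 0" using p0(2)[of undefined] by simp
    then show False using \<theta> p0(1) by (simp add: mult_less_0_iff)
  qed
  then show ?thesis using source_ge[OF L, of "fst p" "snd p"] p0(1) by (simp add: S_def)
qed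

text \<open>The cone is closed under addition, so the convolution structure of the second moment makes
  its mass over the cone superlinear in itself.\<close>

lemma cone_mass_superlinear:
  assumes L: "0 \<le> L" "\<And>z. L * \<bar>z\<bar> \<le> \<bar>\<sigma> z\<bar>" and \<theta>: "0 \<le> \<theta>"
  shows "ennreal (L\<^sup>2) * (cone_mass \<theta> \<gamma> * cone_energy \<theta> \<gamma>) \<le> cone_mass \<theta> \<gamma>"
proof -
  let ?f = "\<lambda>p. indicator (cone \<theta>) p * (ennreal (exp (- \<gamma> * fst p)) * S p)"
  let ?K = "\<lambda>p. indicator (cone \<theta>) p * (ennreal (exp (- \<gamma> * fst p)) * k p)"
  have fm [measurable]: "?f \<in> borel_measurable borel" and Km [measurable]: "?K \<in> borel_measurable borel" by measurable
  have pt: "ennreal (L\<^sup>2) * (\<integral>\<^sup>+z. ?f z * ?K (p - z) \<partial>lborel) \<le> ?f p" for p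
  proof (cases "p \<in> cone \<theta>")
    case False
    \<comment> \<open>If \<open>z\<close> and \<open>p - z\<close> were both in the cone, so would
      be their sum \<open>p\<close>; hence the convolution is supported in the cone.\<close>
    have z: "?f z * ?K (p - z) = 0" for z
      using cone_add[of z \<theta> "p - z"] False by (auto simp: indicator_def)
    have I: "(\<integral>\<^sup>+z. ?f z * ?K (p - z) \<partial>lborel) = (\<integral>\<^sup>+z. 0 \<partial>(lborel :: (real \<times> (real^'d)) measure))"
      by (rule nn_integral_cong) (rule z)
    show ?thesis unfolding I by simp
  next
    case True
    have p0: "0 < fst p" using True by (simp add: cone_def)
    have "(\<integral>\<^sup>+z. ?f z * ?K (p - z) \<partial>lborel) \<le> (\<integral>\<^sup>+z. ennreal (exp (- \<gamma> * fst p)) * (S z * k (p - z)) \<partial>lborel)"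
    proof (rule nn_integral_mono)
      fix z
      have "exp (- \<gamma> * fst p) = exp (- \<gamma> * fst z) * exp (- \<gamma> * fst (p - z))"
        by (simp add: exp_add[symmetric] algebra_simps)
      then have e: "ennreal (exp (- \<gamma> * fst p)) = ennreal (exp (- \<gamma> * fst z)) * ennreal (exp (- \<gamma> * fst (p - z)))"
        by (simp only: ennreal_mult' exp_ge_zero)
      have "?f z * ?K (p - z) = (indicator (cone \<theta>) z * indicator (cone \<theta>) (p - z)) * (ennreal (exp (- \<gamma> * fst p)) * (S z * k (p - z)))"
        unfolding e by (simp only: mult_ac)
      also have "\<dots> \<le> 1 * (ennreal (exp (- \<gamma> * fst p)) * (S z * k (p - z)))"
        by (intro mult_right_mono) (auto simp: indicator_def)
      finally show "?f z * ?K (p - z) \<le> ennreal (exp (- \<gamma> * fst p)) * (S z * k (p - z))" by simp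
    qed
    also have "\<dots> = ennreal (exp (- \<gamma> * fst p)) * (\<integral>\<^sup>+z. S z * k (p - z) \<partial>lborel)"
      by (rule nn_integral_cmult) measurable
    also have "(\<integral>\<^sup>+z. S z * k (p - z) \<partial>lborel) \<le> ennreal (v (fst p) (snd p))"
      using second_moment[OF p0, of "snd p"] by simp
    finally have "ennreal (L\<^sup>2) * (\<integral>\<^sup>+z. ?f z * ?K (p - z) \<partial>lborel) \<le> ennreal (L\<^sup>2) * (ennreal (exp (- \<gamma> * fst p)) * ennreal (v (fst p) (snd p)))"
      by (simp add: mult_left_mono)
    also have "\<dots> = ennreal (exp (- \<gamma> * fst p)) * (ennreal (L\<^sup>2) * ennreal (v (fst p) (snd p)))" by (simp only: mult_ac)
    also have "\<dots> \<le> ennreal (exp (- \<gamma> * fst p)) * S p"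
      by (intro mult_left_mono S_ge[OF L True \<theta>]) simp
    finally show ?thesis using True by simp
  qed
  have J: "(\<lambda>x. ?f (snd x) * ?K (fst x - snd x)) \<in> borel_measurable (lborel \<Otimes>\<^sub>M (lborel :: (real \<times> (real^'d)) measure))"
  proof (rule borel_measurable_times_ennreal)
    show "(\<lambda>x. ?f (snd x)) \<in> borel_measurable (lborel \<Otimes>\<^sub>M (lborel :: (real \<times> (real^'d)) measure))"
      by (rule measurable_compose[OF measurable_snd]) (use fm in simp)
    show "(\<lambda>x. ?K (fst x - snd x)) \<in> borel_measurable (lborel \<Otimes>\<^sub>M (lborel :: (real \<times> (real^'d)) measure))"
    proof (rule measurable_compose[OF _ Km])
      have "snd \<in> borel_measurable ((lborel :: (real \<times> (real^'d)) measure) \<Otimes>\<^sub>M (lborel :: (real \<times> (real^'d)) measure))"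
        "fst \<in> borel_measurable ((lborel :: (real \<times> (real^'d)) measure) \<Otimes>\<^sub>M (lborel :: (real \<times> (real^'d)) measure))"
        by measurable
      then show "(\<lambda>x. fst x - snd x) \<in> borel_measurable ((lborel :: (real \<times> (real^'d)) measure) \<Otimes>\<^sub>M (lborel :: (real \<times> (real^'d)) measure))"
        by (intro borel_measurable_diff)
    qed
  qed
  have "cone_mass \<theta> \<gamma> * cone_energy \<theta> \<gamma> = (\<integral>\<^sup>+z. ?f z * (\<integral>\<^sup>+p. ?K (p - z) \<partial>lborel) \<partial>lborel)"
    unfolding nn_integral_lborel_translate[OF Km] cone_mass_def cone_energy_def
    by (rule nn_integral_multc[symmetric]) measurable
  also have "\<dots> = (\<integral>\<^sup>+z. (\<integral>\<^sup>+p. ?f z * ?K (p - z) \<partial>lborel) \<partial>lborel)"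
    by (intro nn_integral_cong nn_integral_cmult[symmetric]) measurable
  also have "\<dots> = (\<integral>\<^sup>+p. (\<integral>\<^sup>+z. ?f z * ?K (p - z) \<partial>lborel) \<partial>lborel)"
    by (rule lborel_pair.Fubini') (use J in \<open>simp add: case_prod_beta'\<close>)
  finally have eq: "cone_mass \<theta> \<gamma> * cone_energy \<theta> \<gamma> = (\<integral>\<^sup>+p. (\<integral>\<^sup>+z. ?f z * ?K (p - z) \<partial>lborel) \<partial>lborel)" .
  have gm: "(\<lambda>p. \<integral>\<^sup>+z. ?f z * ?K (p - z) \<partial>lborel) \<in> borel_measurable lborel"
    using lborel.borel_measurable_nn_integral_fst[OF J] by simp
  have "ennreal (L\<^sup>2) * (cone_mass \<theta> \<gamma> * cone_energy \<theta> \<gamma>) = (\<integral>\<^sup>+p. ennreal (L\<^sup>2) * (\<integral>\<^sup>+z. ?f z * ?K (p - z) \<partial>lborel) \<partial>lborel)"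
    unfolding eq by (rule nn_integral_cmult[symmetric, OF gm])
  also have "\<dots> \<le> cone_mass \<theta> \<gamma>"
    unfolding cone_mass_def by (intro nn_integral_mono pt)
  finally show ?thesis .
qed

text \<open>Positivity of the integral comes from the open set where \<open>u0\<close> is positive.
  Finiteness has to be checked too, since a divergent integral would yield the default value 0; it
  follows from the unit mass of the kernel.\<close>

lemma h_pos:
  assumes t: "0 < t"
  shows "0 < h t x"
proof -
  have [measurable]: "u0 \<in> borel_measurable borel" using u0_measurable by simp
  let ?I = "\<integral>\<^sup>+y. ennreal (u0 y * heat_G \<nu> b t (x - y)) \<partial>lborel"
  have eq: "h t x = enn2real ?I"
    unfolding h_def by (rule integral_eq_nn_integral) (auto simp: u0_nonneg heat_G_nonneg)
  obtain U where U: "\<And>y. \<bar>u0 y\<bar> \<le> U" using u0_bounded by (auto simp: bounded_iff)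
  have "?I \<le> (\<integral>\<^sup>+y. ennreal U * kernel \<nu> t (x - y) \<partial>lborel)"
  proof (rule nn_integral_mono)
    fix y
    have "ennreal (u0 y) * ennreal (heat_G \<nu> b t (x - y)) \<le> ennreal U * kernel \<nu> t (x - y)"
      using U[of y] by (intro mult_mono ennreal_leI ennreal_heat_G_le t) auto
    then show "ennreal (u0 y * heat_G \<nu> b t (x - y)) \<le> ennreal U * kernel \<nu> t (x - y)"
      by (simp only: ennreal_mult''[OF heat_G_nonneg])
  qed
  also have "\<dots> = ennreal U * (\<integral>\<^sup>+y. kernel \<nu> t (x - y) \<partial>lborel)"
    by (rule nn_integral_cmult) measurable
  also have "(\<integral>\<^sup>+y. kernel \<nu> t (x - y) \<partial>lborel) = 1"
    by (subst nn_integral_lborel_reflect) (auto simp: nn_integral_kernel nu t)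
  finally have fin: "?I < \<infinity>" by (simp add: le_less_trans)
  obtain V where V: "open V" "V \<noteq> {}" "\<forall>y\<in>V. 0 < u0 y" using u0_pos by blast
  have "0 < ?I"
  proof (rule nn_integral_pos_on_open[OF _ V(1,2), of _ x])
    fix y assume "y \<in> V" "y \<noteq> x"
    then show "0 < ennreal (u0 y * heat_G \<nu> b t (x - y))"
      using V(3) heat_G_pos[OF nu t _ dim, of "x - y"] by simp
  qed measurable
  then show ?thesis unfolding eq using fin by (simp add: enn2real_positive_iff)
qed

lemma cone_mass_pos:
  assumes L: "0 < L" "\<And>z. L * \<bar>z\<bar> \<le> \<bar>\<sigma> z\<bar>" and \<theta>: "0 \<le> \<theta>"
  shows "0 < cone_mass \<theta> \<gamma>"
  unfolding cone_mass_def
proof (rule nn_integral_pos_on_open[OF _ open_cone[of \<theta>] cone_nonempty[of \<theta>], of _ undefined])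
  fix p assume p: "p \<in> (cone \<theta> :: (real \<times> (real^'d)) set)"
  then have p0: "0 < fst p" by (simp add: cone_def)
  have "0 < (h (fst p) (snd p))\<^sup>2" using h_pos[OF p0, of "snd p"] by simp
  then have "0 < ennreal (v (fst p) (snd p))"
    using second_moment[OF p0, of "snd p"] by (simp add: add_pos_nonneg)
  then have "0 < S p"
    using L(1) by (intro less_le_trans[OF _ S_ge[OF less_imp_le[OF L(1)] L(2) p \<theta>]]) (simp add: ennreal_zero_less_mult_iff)
  then show "0 < indicator (cone \<theta>) p * (ennreal (exp (- \<gamma> * fst p)) * S p)"
    using p by (simp add: ennreal_zero_less_mult_iff)
qed measurable

lemma nn_integral_orthant_exp_finite:
  assumes a: "0 < a"
  shows "(\<integral>\<^sup>+x. indicator {x :: real^'d. \<forall>i. 0 < x $ i} x * ennreal (exp (- (a *\<^sub>R (\<chi> i. 1)) \<bullet> x)) \<partial>lborel) < \<infinity>"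
proof -
  let ?g = "\<lambda>y::real. ennreal (y powr (1 - 1) * exp (- a * y)) * indicator {0<..} y"
  have "(\<integral>\<^sup>+x. indicator {x :: real^'d. \<forall>i. 0 < x $ i} x * ennreal (exp (- (a *\<^sub>R (\<chi> i. 1)) \<bullet> x)) \<partial>lborel)
      \<le> (\<integral>\<^sup>+x. (\<Prod>e\<in>(Basis :: (real^'d) set). ?g (x \<bullet> e)) \<partial>lborel)"
  proof (rule nn_integral_mono)
    fix x :: "real^'d"
    show "indicator {x :: real^'d. \<forall>i. 0 < x $ i} x * ennreal (exp (- (a *\<^sub>R (\<chi> i. 1)) \<bullet> x)) \<le> (\<Prod>e\<in>Basis. ?g (x \<bullet> e))"
    proof (cases "\<forall>i. 0 < x $ i")
      case True
      have B: "\<exists>i. e = axis i 1" if "e \<in> (Basis :: (real^'d) set)" for e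
        using that by (auto simp: Basis_vec_def)
      have pos: "0 < x \<bullet> e" if "e \<in> Basis" for e
        using B[OF that] True by (auto simp: inner_axis)
      have one: "(\<chi> i. 1) \<bullet> e = (1::real)" if "e \<in> (Basis :: (real^'d) set)" for e
        using B[OF that] by (auto simp: inner_axis)
      have "(\<chi> i. 1) \<bullet> x = (\<Sum>e\<in>Basis. ((\<chi> i. 1) \<bullet> e) * (x \<bullet> e))" by (rule euclidean_inner)
      also have "\<dots> = (\<Sum>e\<in>Basis. x \<bullet> e)" by (simp add: one)
      finally have "- (a *\<^sub>R (\<chi> i. 1)) \<bullet> x = (\<Sum>e\<in>Basis. - a * (x \<bullet> e))"
        by (simp add: sum_distrib_left sum_negf)
      then have "ennreal (exp (- (a *\<^sub>R (\<chi> i. 1)) \<bullet> x)) = (\<Prod>e\<in>Basis. ennreal (exp (- a * (x \<bullet> e))))"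
        by (simp add: exp_sum prod_ennreal)
      also have "\<dots> = (\<Prod>e\<in>Basis. ?g (x \<bullet> e))"
      proof (intro prod.cong refl)
        fix e :: "real^'d" assume "e \<in> Basis"
        then have "0 < x \<bullet> e" by (rule pos)
        then show "ennreal (exp (- a * (x \<bullet> e))) = ?g (x \<bullet> e)" by simp
      qed
      finally show ?thesis using True by simp
    qed simp
  qed
  also have "\<dots> = (\<Prod>e\<in>(Basis :: (real^'d) set). (\<integral>\<^sup>+y. ?g y \<partial>lborel))"
    by (rule nn_integral_lborel_prod) auto
  also have "\<dots> = (\<Prod>e\<in>(Basis :: (real^'d) set). ennreal (Gamma 1 * a powr (- 1)))"
    using a by (simp only: nn_integral_powr_exp[OF zero_less_one a])
  also have "\<dots> < \<infinity>" using a by (simp add: ennreal_power)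
  finally show ?thesis .
qed

text \<open>On the cone both \<open>v \<le> exp (\<gamma> t / 4)\<close> (from nonpositive growth) and the exponentially decaying upper
  bound hold; interpolating \<open>v = v\<^sup>1\<^sup>-\<^sup>\<delta> v\<^sup>\<delta>\<close> with small \<open>\<delta>\<close> yields spatial decay at little cost in time.\<close>

lemma cone_mass_finite:
  assumes \<theta>: "0 < \<theta>" and \<gamma>: "0 < \<gamma>" and growth: "growth_L P u \<theta> \<le> 0"
  shows "cone_mass \<theta> \<gamma> < \<infinity>"
proof -
  \<comment> \<open>Any rate above the threshold of the upper bound serves here; it may be far
    larger than \<open>\<gamma>\<close>, which is why interpolation is required.\<close>
  define \<gamma>' where "\<gamma>' = (2 * \<nu>) powr (1 / b) * (Lip * const_c0 \<nu> b CARD('d)) powr (4 / (2 - b * real CARD('d))) + 1"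
  have \<gamma>': "0 < \<gamma>'" by (simp add: \<gamma>'_def add_nonneg_pos)
  have q: "contraction \<gamma>' < 1" by (rule contraction_less_1[OF \<gamma>']) (simp add: \<gamma>'_def)
  obtain A where A0: "0 \<le> A" and A: "\<And>c t x. \<nu> * (norm c)\<^sup>2 \<le> \<gamma>' powr b \<Longrightarrow> 0 < t \<Longrightarrow> v t x \<le> A * exp (\<gamma>' * t - c \<bullet> x)"
    using second_moment_upper[OF \<gamma>' q] by blast
  define N where "N = norm (\<chi> i. 1 :: real^'d)"
  have N: "0 < N"
  proof -
    have "(\<chi> i. 1 :: real^'d) \<noteq> 0" by (simp add: vec_eq_iff)
    then show ?thesis by (simp add: N_def)
  qed
  \<comment> \<open>Gives the tilt its largest admissible norm. All its coordinates are equal and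
    positive, so the bound decays in every direction of the cone.\<close>
  define s where "s = sqrt (\<gamma>' powr b / \<nu>) / N"
  have s: "0 < s" using \<gamma>' nu N by (simp add: s_def)
  define c :: "real^'d" where "c = s *\<^sub>R (\<chi> i. 1)"
  have "\<nu> * (norm c)\<^sup>2 = \<gamma>' powr b"
    using N nu s by (simp add: c_def N_def[symmetric] power_mult_distrib s_def power_divide)
  then have bound: "v t x \<le> A * exp (\<gamma>' * t - c \<bullet> x)" if "0 < t" for t x using A that by simp
  \<comment> \<open>Keeps the rate contributed by the tilted bound below
    \<open>\<gamma> / 4\<close>. Together with \<open>\<gamma> / 4\<close> from the growth
    hypothesis this amounts to \<open>\<gamma> / 2\<close>, less than the discount rate.\<close>
  define \<delta> where "\<delta> = min 1 (\<gamma> / (4 * \<gamma>'))"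
  have \<delta>: "0 < \<delta>" "\<delta> \<le> 1" using \<gamma> \<gamma>' by (auto simp: \<delta>_def)
  have "\<delta> * \<gamma>' \<le> \<gamma> / (4 * \<gamma>') * \<gamma>'" using \<gamma>' by (intro mult_right_mono) (auto simp: \<delta>_def)
  then have \<delta>\<gamma>: "\<delta> * \<gamma>' \<le> \<gamma> / 4" using \<gamma>' by simp
  have "growth_L P u \<theta> < ereal (\<gamma> / 4)" using growth \<gamma> by (simp add: le_less_trans)
  then have "\<forall>\<^sub>F t in at_top. (SUP x\<in>{x. \<theta> * t < norm x}. ereal (1 / t) * elog (v t x)) < ereal (\<gamma> / 4)"
    unfolding growth_L_def v_def[symmetric] by (rule Limsup_lessD)
  then obtain T0 where T0: "\<And>t. T0 \<le> t \<Longrightarrow> (SUP x\<in>{x. \<theta> * t < norm x}. ereal (1 / t) * elog (v t x)) < ereal (\<gamma> / 4)"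
    unfolding eventually_at_top_linorder by blast
  define T where "T = max T0 1"
  have large: "v t x \<le> exp (\<gamma> / 4 * t)" if "T \<le> t" "\<theta> * t < norm x" for t x
  proof (rule le_exp_of_elog_le)
    show "0 < t" using that by (simp add: T_def)
    have "ereal (1 / t) * elog (v t x) \<le> (SUP x\<in>{x. \<theta> * t < norm x}. ereal (1 / t) * elog (v t x))"
      using that by (intro SUP_upper) simp
    also have "\<dots> \<le> ereal (\<gamma> / 4)" using T0[of t] that by (simp add: T_def less_imp_le)
    finally show "ereal (1 / t) * elog (v t x) \<le> ereal (\<gamma> / 4)" .
  qed
  \<comment> \<open>A constant of at least 1 dominates its own power with exponent
    \<open>\<delta> \<le> 1\<close>.\<close>
  define A1 where "A1 = max A 1"
  have A1: "1 \<le> A1" "A \<le> A1" by (auto simp: A1_def)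
  \<comment> \<open>The extra exponential covers times before \<open>T\<close>, where only the
    tilted upper bound is available.\<close>
  define B where "B = A1 * exp (\<gamma>' * T)"
  have B0: "0 \<le> B" "A1 \<le> B"
  proof -
    have "A1 * 1 \<le> A1 * exp (\<gamma>' * T)" using A1 \<gamma>' by (intro mult_left_mono) (auto simp: T_def)
    then show "A1 \<le> B" by (simp add: B_def)
    then show "0 \<le> B" using A1 by linarith
  qed
  have v_le: "v (fst p) (snd p) \<le> B * exp (\<gamma> / 2 * fst p - \<delta> * (c \<bullet> snd p))" if p: "p \<in> cone \<theta>" for p
  proof -
    obtain t x where tx: "p = (t, x)" by (cases p)
    have t: "0 < t" and x: "\<And>i. \<theta> * t < x $ i" using p by (auto simp: cone_def tx)
    have x0: "0 < x $ i" for i using x[of i] \<theta> t by (smt (verit) mult_pos_pos)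
    have "c \<bullet> x = s * (\<Sum>i\<in>UNIV. x $ i)" by (simp add: c_def inner_vec_def sum_distrib_left)
    then have cx: "0 \<le> c \<bullet> x" using s x0 by (simp add: sum_nonneg less_imp_le)
    have "v t x \<le> B * exp (\<gamma> / 2 * t - \<delta> * (c \<bullet> x))"
    proof (cases "T \<le> t")
      case False
      have "v t x \<le> A * exp (\<gamma>' * t - c \<bullet> x)" by (rule bound[OF t])
      also have "\<dots> \<le> A1 * exp (\<gamma>' * T + (\<gamma> / 2 * t - \<delta> * (c \<bullet> x)))"
      proof (intro mult_mono)
        have "\<gamma>' * t \<le> \<gamma>' * T" using False \<gamma>' by (intro mult_left_mono) auto
        moreover have "\<delta> * (c \<bullet> x) \<le> 1 * (c \<bullet> x)" using \<delta> cx by (intro mult_right_mono) auto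
        moreover have "0 \<le> \<gamma> / 2 * t" using \<gamma> t by simp
        ultimately have "\<gamma>' * t - c \<bullet> x \<le> \<gamma>' * T + (\<gamma> / 2 * t - \<delta> * (c \<bullet> x))" by linarith
        then show "exp (\<gamma>' * t - c \<bullet> x) \<le> exp (\<gamma>' * T + (\<gamma> / 2 * t - \<delta> * (c \<bullet> x)))" by simp
      qed (use A1 A0 in auto)
      finally show ?thesis by (simp add: B_def exp_add mult.assoc)
    next
      case True
      have nx: "\<theta> * t < norm x"
        using x[of undefined] component_le_norm_cart[of x undefined] by linarith
      show ?thesis
      proof (cases "0 < v t x")
        case v: True
        have "v t x = v t x powr (1 - \<delta>) * v t x powr \<delta>" using v by (simp add: powr_add[symmetric])
        also have "\<dots> \<le> exp (\<gamma> / 4 * t) powr (1 - \<delta>) * (A1 * exp (\<gamma>' * t - c \<bullet> x)) powr \<delta>"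
        proof (intro mult_mono powr_mono2)
          show "v t x \<le> exp (\<gamma> / 4 * t)" by (rule large[OF True nx])
          show "v t x \<le> A1 * exp (\<gamma>' * t - c \<bullet> x)"
            by (rule order_trans[OF bound[OF t] mult_right_mono[OF A1(2)]]) simp
        qed (use \<delta> v in auto)
        also have "\<dots> = exp ((1 - \<delta>) * (\<gamma> / 4 * t)) * (A1 powr \<delta> * exp (\<delta> * (\<gamma>' * t - c \<bullet> x)))"
          using A1 by (simp add: exp_powr_real powr_mult mult.commute)
        also have "\<dots> \<le> exp (\<gamma> / 4 * t) * (B * exp (\<gamma> / 4 * t - \<delta> * (c \<bullet> x)))"
        proof (intro mult_mono)
          have "(1 - \<delta>) * (\<gamma> / 4 * t) \<le> 1 * (\<gamma> / 4 * t)" using \<delta> \<gamma> t by (intro mult_right_mono) auto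
          then show "exp ((1 - \<delta>) * (\<gamma> / 4 * t)) \<le> exp (\<gamma> / 4 * t)" by simp
          have "A1 powr \<delta> \<le> A1 powr 1" using A1 \<delta> by (intro powr_mono) auto
          then show "A1 powr \<delta> \<le> B" using A1 B0 by simp
          have "\<delta> * \<gamma>' * t \<le> \<gamma> / 4 * t" using \<delta>\<gamma> t by (intro mult_right_mono) auto
          then show "exp (\<delta> * (\<gamma>' * t - c \<bullet> x)) \<le> exp (\<gamma> / 4 * t - \<delta> * (c \<bullet> x))" by (simp add: algebra_simps)
        qed (use B0 in auto)
        also have "\<dots> = B * exp (\<gamma> / 4 * t + (\<gamma> / 4 * t - \<delta> * (c \<bullet> x)))" by (simp only: exp_add mult_ac)
        also have "\<gamma> / 4 * t + (\<gamma> / 4 * t - \<delta> * (c \<bullet> x)) = \<gamma> / 2 * t - \<delta> * (c \<bullet> x)" by simp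
        finally show ?thesis .
      next
        case False
        moreover have "0 \<le> B * exp (\<gamma> / 2 * t - \<delta> * (c \<bullet> x))" using B0 by simp
        ultimately show ?thesis by linarith
      qed
    qed
    then show ?thesis by (simp add: tx)
  qed
  let ?O = "{x :: real^'d. \<forall>i. 0 < x $ i}"
  let ?a = "\<lambda>t. ennreal (exp (- t * (\<gamma> / 2))) * indicator {0<..} t" and ?o = "\<lambda>x. indicator ?O x * ennreal (exp (- ((\<delta> * s) *\<^sub>R (\<chi> i. 1)) \<bullet> x))"
  have Om [measurable]: "?O \<in> sets borel" using open_orthant by (rule borel_open)
  have om [measurable]: "?o \<in> borel_measurable borel"
    by (intro borel_measurable_times_ennreal borel_measurable_indicator Om measurable_compose[OF _ measurable_ennreal] borel_measurable_continuous_onI continuous_intros)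
  have "cone_mass \<theta> \<gamma> \<le> (\<integral>\<^sup>+p. ennreal (Lip\<^sup>2 * B) * (?a (fst p) * ?o (snd p)) \<partial>lborel)"
    unfolding cone_mass_def
  proof (rule nn_integral_mono)
    fix p :: "real \<times> (real^'d)"
    show "indicator (cone \<theta>) p * (ennreal (exp (- \<gamma> * fst p)) * S p) \<le> ennreal (Lip\<^sup>2 * B) * (?a (fst p) * ?o (snd p))"
    proof (cases "p \<in> cone \<theta>")
      case True
      then have p: "0 < fst p" "\<And>i. \<theta> * fst p < snd p $ i" by (auto simp: cone_def)
      have x0: "0 < snd p $ i" for i using p(2)[of i] \<theta> p(1) by (smt (verit) mult_pos_pos)
      have "S p \<le> source (fst p) (snd p)" by (simp add: S_def)
      also have "\<dots> \<le> ennreal (Lip\<^sup>2) * ennreal (v (fst p) (snd p))" using p by (intro source_le) simp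
      also have "\<dots> = ennreal (Lip\<^sup>2 * v (fst p) (snd p))" by (simp add: ennreal_mult')
      also have "\<dots> \<le> ennreal (Lip\<^sup>2 * (B * exp (\<gamma> / 2 * fst p - \<delta> * (c \<bullet> snd p))))"
        by (intro ennreal_leI mult_left_mono v_le True) simp
      finally have "ennreal (exp (- \<gamma> * fst p)) * S p \<le> ennreal (exp (- \<gamma> * fst p)) * ennreal (Lip\<^sup>2 * (B * exp (\<gamma> / 2 * fst p - \<delta> * (c \<bullet> snd p))))"
        by (rule mult_left_mono) simp
      also have "\<dots> = ennreal (exp (- \<gamma> * fst p) * (Lip\<^sup>2 * (B * exp (\<gamma> / 2 * fst p - \<delta> * (c \<bullet> snd p)))))"
        by (rule ennreal_mult'[symmetric]) simp
      also have "exp (- \<gamma> * fst p) * (Lip\<^sup>2 * (B * exp (\<gamma> / 2 * fst p - \<delta> * (c \<bullet> snd p)))) =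
          (Lip\<^sup>2 * B) * (exp (- fst p * (\<gamma> / 2)) * exp (- ((\<delta> * s) *\<^sub>R (\<chi> i. 1)) \<bullet> snd p))"
      proof -
        have "exp (- \<gamma> * fst p) * exp (\<gamma> / 2 * fst p - \<delta> * (c \<bullet> snd p)) = exp (- fst p * (\<gamma> / 2)) * exp (- ((\<delta> * s) *\<^sub>R (\<chi> i. 1)) \<bullet> snd p)"
          unfolding exp_add[symmetric] by (simp add: c_def field_simps)
        then show ?thesis by (simp add: mult_ac)
      qed
      also have "ennreal \<dots> = ennreal (Lip\<^sup>2 * B) * (ennreal (exp (- fst p * (\<gamma> / 2))) * ennreal (exp (- ((\<delta> * s) *\<^sub>R (\<chi> i. 1)) \<bullet> snd p)))"
        by (simp only: ennreal_mult'' exp_ge_zero mult_nonneg_nonneg)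
      finally show ?thesis using True p x0 by simp
    qed simp
  qed
  also have "\<dots> = (\<integral>\<^sup>+t. (\<integral>\<^sup>+x. ennreal (Lip\<^sup>2 * B) * (?a t * ?o x) \<partial>lborel) \<partial>lborel)"
  proof -
    have "(\<lambda>p. ennreal (Lip\<^sup>2 * B) * (?a (fst p) * ?o (snd p))) \<in> borel_measurable (borel \<Otimes>\<^sub>M borel)"
      using om by measurable
    then have "(\<lambda>p. ennreal (Lip\<^sup>2 * B) * (?a (fst p) * ?o (snd p))) \<in> borel_measurable borel" by (simp only: borel_prod)
    from nn_integral_lborel_pair[OF this] show ?thesis by simp
  qed
  also have "\<dots> = ennreal (Lip\<^sup>2 * B) * ((\<integral>\<^sup>+t. ?a t \<partial>lborel) * (\<integral>\<^sup>+x. ?o x \<partial>lborel))"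
    using om by (simp add: nn_integral_cmult nn_integral_multc)
  also have "\<dots> < \<infinity>"
  proof -
    have "(\<integral>\<^sup>+t. ?a t \<partial>lborel) < \<infinity>"
    proof -
      have "ennreal (\<gamma> / 2) * (\<integral>\<^sup>+t. ?a t \<partial>lborel) = (\<integral>\<^sup>+t. ennreal (\<gamma> / 2) * ?a t \<partial>lborel)"
        by (rule nn_integral_cmult[symmetric]) measurable
      also have "\<dots> = (\<integral>\<^sup>+t\<in>{0<..}. ennreal (\<gamma> / 2 * exp (- t * (\<gamma> / 2))) \<partial>lborel)"
        using \<gamma> by (intro nn_integral_cong) (simp only: ennreal_mult'' exp_ge_zero mult.assoc)
      also have "\<dots> = ennreal (exp (- 0 * (\<gamma> / 2)))" using \<gamma> by (intro nn_integral_exp_Ioi) simp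
      finally have fin: "ennreal (\<gamma> / 2) * (\<integral>\<^sup>+t. ?a t \<partial>lborel) < \<infinity>" by simp
      show ?thesis
      proof (rule ccontr)
        assume "\<not> (\<integral>\<^sup>+t. ?a t \<partial>lborel) < \<infinity>"
        then have "(\<integral>\<^sup>+t. ?a t \<partial>lborel) = \<infinity>" by (simp only: infinity_ennreal_def less_top[symmetric] not_not)
        with fin \<gamma> show False by (simp only: infinity_ennreal_def) (simp add: ennreal_mult_top)
      qed
    qed
    moreover have "(\<integral>\<^sup>+x. ?o x \<partial>lborel) < \<infinity>"
      by (rule nn_integral_orthant_exp_finite) (use \<delta> s in simp)
    ultimately show ?thesis by (simp add: ennreal_mult_less_top)
  qed
  finally show ?thesis .
qed

text \<open>The discount rate stays fixed at \<open>\<theta>0\<close> while the slope varies: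
  smaller slopes only enlarge the cone, hence its energy. An energy of at least
  \<open>2 / L\<^sup>2\<close> would force twice the mass to be at most the mass, which is absurd
  for a positive finite mass.\<close>

lemma growth_pos:
  assumes L: "0 < L" "\<And>z. L * \<bar>z\<bar> \<le> \<bar>\<sigma> z\<bar>"
  shows "\<exists>\<theta>0>0. \<forall>\<theta>. 0 < \<theta> \<and> \<theta> < \<theta>0 \<longrightarrow> 0 < growth_L P u \<theta>"
proof -
  obtain \<theta>0 where \<theta>0: "0 < \<theta>0" and E: "ennreal (2 / L\<^sup>2) < cone_energy \<theta>0 \<theta>0"
    using cone_energy_large[of "ennreal (2 / L\<^sup>2)"] by auto
  have "0 < growth_L P u \<theta>" if \<theta>: "0 < \<theta>" "\<theta> < \<theta>0" for \<theta>
  proof (rule ccontr)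
    assume "\<not> 0 < growth_L P u \<theta>"
    then have "growth_L P u \<theta> \<le> 0" by simp
    then have fin: "cone_mass \<theta> \<theta>0 < \<infinity>" by (rule cone_mass_finite[OF \<theta>(1) \<theta>0])
    then obtain m where m: "cone_mass \<theta> \<theta>0 = ennreal m" "0 \<le> m" by (cases "cone_mass \<theta> \<theta>0") auto
    have "0 < cone_mass \<theta> \<theta>0" using \<theta> by (intro cone_mass_pos[OF L]) simp
    then have m0: "0 < m" using m by simp
    have "ennreal (2 / L\<^sup>2) \<le> cone_energy \<theta> \<theta>0"
      using E cone_energy_antimono[of \<theta> \<theta>0 \<theta>0] \<theta> by (intro less_imp_le) (auto intro: less_le_trans)
    then have "ennreal (L\<^sup>2) * (ennreal m * ennreal (2 / L\<^sup>2)) \<le> ennreal (L\<^sup>2) * (ennreal m * cone_energy \<theta> \<theta>0)"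
      by (intro mult_left_mono) auto
    also have "\<dots> \<le> ennreal m"
      using cone_mass_superlinear[OF less_imp_le[OF L(1)] L(2), of \<theta> \<theta>0] \<theta> m by simp
    also have "ennreal (L\<^sup>2) * (ennreal m * ennreal (2 / L\<^sup>2)) = ennreal (2 * m)"
      using m0 L by (simp add: ennreal_mult'[symmetric])
    finally show False using m0 by (simp add: ennreal_le_iff)
  qed
  with \<theta>0 show ?thesis by blast
qed

end

theorem theorem1p3:
  fixes P :: "'w measure" and F :: "real \<Rightarrow> 'w measure"
    and W :: "(real \<times> (real^'d::finite)) set \<Rightarrow> 'w \<Rightarrow> real"
    and \<nu> \<beta> Lip :: real and \<sigma> :: "real \<Rightarrow> real"
    and u0 :: "real^'d \<Rightarrow> real" and u :: "real \<Rightarrow> real^'d \<Rightarrow> 'w \<Rightarrow> real"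
  assumes "prob_space P" and "is_filtration P F" and "is_white_noise P F W"
    and "\<nu> > 0" and "0 < \<beta>" and "\<beta> < 1"
    and "CARD('d) < 4" and "\<beta> * real CARD('d) < 2"
    and "Lip-lipschitz_on UNIV \<sigma>" and "\<sigma> 0 = 0"
    and "u0 \<in> borel_measurable lborel" and "\<forall>x. 0 \<le> u0 x" and "bounded (range u0)"
    and "compact (closure {x. u0 x \<noteq> 0})"
    and "\<exists>U. open U \<and> U \<noteq> {} \<and> U \<subseteq> {x. \<forall>i. 0 < x $ i} \<and> (\<forall>x\<in>U. 0 < u0 x)"
    and "mild_solution P F W \<nu> \<beta> \<sigma> u0 u"
  shows "(\<forall>\<theta>. \<theta> > (2 * \<nu>) powr (1 / \<beta>) *
              (Lip * const_c0 \<nu> \<beta> CARD('d)) powr (2 * (2 - \<beta>) / (2 - \<beta> * real CARD('d)))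
            \<longrightarrow> growth_L P u \<theta> < 0) \<and>
         ((INF z\<in>-{0}. \<bar>\<sigma> z / z\<bar>) > 0 \<longrightarrow>
            (\<exists>\<theta>0>0. \<forall>\<theta>. 0 < \<theta> \<and> \<theta> < \<theta>0 \<longrightarrow> growth_L P u \<theta> > 0))"
proof -
  interpret prob_space P by (rule assms(1))
  interpret mild_spde P F W \<beta> \<nu> Lip \<sigma> u0 u
  proof unfold_locales
    show "\<exists>U. open U \<and> U \<noteq> {} \<and> U \<subseteq> {x. \<forall>i. 0 < x $ i} \<and> (\<forall>x\<in>U. 0 < u0 x)"
      by (rule assms)
  qed (use assms in auto)
  have "0 < L \<Longrightarrow> \<exists>\<theta>0>0. \<forall>\<theta>. 0 < \<theta> \<and> \<theta> < \<theta>0 \<longrightarrow> 0 < growth_L P u \<theta>"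
    if L: "L = (INF z\<in>-{0}. \<bar>\<sigma> z / z\<bar>)" for L
  proof (rule growth_pos)
    fix z
    show "L * \<bar>z\<bar> \<le> \<bar>\<sigma> z\<bar>"
    proof (cases "z = 0")
      case False
      have "L \<le> \<bar>\<sigma> z / z\<bar>"
        unfolding L using False by (intro cINF_lower bdd_belowI[of _ 0]) auto
      then show ?thesis using False by (simp add: field_simps)
    qed (use assms in simp)
  qed
  then show ?thesis using growth_neg by blast
qed

end
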